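(* Let $\alpha\in(\tfrac12,1)$, $s=p^{1-\alpha}$, and $A=\sqrt{2r\log p/n}$ with $r>\alpha$. Assume either $\mathbf X\in\mathrm{SubG}(\sigma^2)$ with $n/p^{3/2}\to\infty$, or $\mathbf X\in\mathcal O_n(p)$ with $n\ge p$. For $\tau>0$ let $T(\tau)=\sum_{j=1}^p\mathbf 1(|z_j|>\tau)$ and for $t\in\mathbb R$ let $\xi(t,\tau)=\mathbf 1(T(\tau)>t)$. Then $$\liminf_{p\to\infty}\frac{\log\inf_{t}\mathrm{Risk}\big(\xi(t,\sqrt{2\log p}),s,A\big)}{s\log p}>-\frac{(r-\alpha)^2}{4r}.$$
   Context: Setting: for each $p$ one observes $(\mathbf y,\mathbf X)$ with $\mathbf y=\mathbf X\boldsymbol\beta+\boldsymbol\varepsilon$, where $\boldsymbol\varepsilon\sim\mathcal N(0,I_n)$, $\mathbf X$ is an $n\times p$ real matrix independent of $\boldsymbol\varepsilon$, $\boldsymbol\beta\in\mathbb R^p$ is unknown, and $n=n(p)\to\infty$ as $p\to\infty$. Design classes: $\mathbf X\in\mathrm{SubG}(\sigma^2)$ means the rows of $\mathbf X$ are i.i.d. centered isotropic ($\mathbb E[xx^T]=I_p$) sub-Gaussian random vectors with sub-Gaussian parameter $\sigma^2$ (for every unit $u$ and $t\in\mathbb R$, $\log\mathbb E e^{t\langle u,x\rangle}\le\sigma^2t^2/2$), and $\mathbf X^T\mathbf X$ is almost surely positive definite; $\mathbf X\in\mathcal O_n(p)$ means $\mathbf X^T\mathbf X=nI_p$. For an integer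 $s$ and $A>0$, $\Xi(s,A)=\{\boldsymbol\beta\in\mathbb R^p:|\mathrm{supp}(\boldsymbol\beta)|=s,\ |\beta_i|\ge A\text{ for }i\in\mathrm{supp}(\boldsymbol\beta)\}$. A test $T$ is a measurable $[0,1]$-valued function of $(\mathbf y,\mathbf X)$; $\mathbb E_{\boldsymbol\beta}$ denotes expectation over $(\mathbf y,\mathbf X)$ under parameter $\boldsymbol\beta$, $\mathbb E_0$ under $\boldsymbol\beta=0$. $\mathrm{Risk}(T,s,A)=\mathbb E_0[T]+\sup_{\boldsymbol\beta\in\Xi(s,A)}\mathbb E_{\boldsymbol\beta}[1-T]$. The vector $\mathbf z=(z_1,\dots,z_p)=(\mathbf X^T\mathbf X)^{-1/2}\mathbf X^T\mathbf y$, where $(\mathbf X^T\mathbf X)^{-1/2}=OD^{-1/2}O^T$ for a spectral decomposition $\mathbf X^T\mathbf X=ODO^T$. *)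

theory Defs
  imports "HOL-Probability.Probability"
begin

text \<open>Vectors in R^k are functions nat => real (only coordinates < k matter);
  an n x p matrix X is a function nat => nat => real, X i j = entry (row i, column j).
  The row index i < n, column index j < p.\<close>

type_synonym rvec = "nat \<Rightarrow> real"
type_synonym rmat = "nat \<Rightarrow> nat \<Rightarrow> real"

definition gram :: "nat \<Rightarrow> nat \<Rightarrow> rmat \<Rightarrow> rmat" where
  "gram n p X = (\<lambda>a b. \<Sum>i<n. X i a * X i b)"

definition orthogonal_mat :: "nat \<Rightarrow> rmat \<Rightarrow> bool" where
  "orthogonal_mat p Q \<longleftrightarrow>
     (\<forall>i<p. \<forall>j<p. (\<Sum>k<p. Q k i * Q k j) = (if i = j then 1 else 0))"

definition pos_def :: "nat \<Rightarrow> rmat \<Rightarrow> bool" where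
  "pos_def p M \<longleftrightarrow> (\<forall>a<p. \<forall>b<p. M a b = M b a) \<and>
     (\<forall>v::rvec. (\<exists>a<p. v a \<noteq> 0) \<longrightarrow> (\<Sum>a<p. \<Sum>b<p. v a * M a b * v b) > 0)"

definition inv_sqrt :: "nat \<Rightarrow> rmat \<Rightarrow> rmat" where
  "inv_sqrt p M = (SOME S. \<exists>Q d. orthogonal_mat p Q \<and> (\<forall>k<p. d k > 0) \<and>
      (\<forall>a<p. \<forall>b<p. M a b = (\<Sum>k<p. Q a k * d k * Q b k)) \<and>
      S = (\<lambda>a b. \<Sum>k<p. Q a k * (1 / sqrt (d k)) * Q b k))"

definition zvec :: "nat \<Rightarrow> nat \<Rightarrow> rvec \<Rightarrow> rmat \<Rightarrow> rvec" where
  "zvec n p y X = (\<lambda>j. \<Sum>k<p. inv_sqrt p (gram n p X) j k * (\<Sum>i<n. X i k * y i))"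

definition Tstat :: "nat \<Rightarrow> nat \<Rightarrow> real \<Rightarrow> rvec \<Rightarrow> rmat \<Rightarrow> real" where
  "Tstat n p \<tau> y X = real (card {j\<in>{..<p}. \<bar>zvec n p y X j\<bar> > \<tau>})"

definition xi_test :: "nat \<Rightarrow> nat \<Rightarrow> real \<Rightarrow> real \<Rightarrow> rvec \<Rightarrow> rmat \<Rightarrow> real" where
  "xi_test n p t \<tau> y X = (if Tstat n p \<tau> y X > t then 1 else 0)"

definition vec_space :: "nat \<Rightarrow> rvec measure" where
  "vec_space k = PiM {..<k} (\<lambda>_. borel)"

definition mat_space :: "nat \<Rightarrow> nat \<Rightarrow> rmat measure" where
  "mat_space n p = PiM {..<n} (\<lambda>_. vec_space p)"

definition noise :: "nat \<Rightarrow> rvec measure" where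
  "noise n = PiM {..<n} (\<lambda>_. density lborel std_normal_density)"

text \<open>E_beta[f] where y = X beta + eps, X ~ DX independent of eps ~ N(0,I_n).\<close>
definition Exp :: "nat \<Rightarrow> nat \<Rightarrow> rmat measure \<Rightarrow> rvec \<Rightarrow> (rvec \<Rightarrow> rmat \<Rightarrow> real) \<Rightarrow> real" where
  "Exp n p DX \<beta> f = (\<integral>X. (\<integral>e. f (\<lambda>i. (\<Sum>k<p. X i k * \<beta> k) + e i) X \<partial>noise n) \<partial>DX)"

definition Xi :: "nat \<Rightarrow> nat \<Rightarrow> real \<Rightarrow> rvec set" where
  "Xi p s A = {\<beta>. (\<forall>i\<ge>p. \<beta> i = 0) \<and> card {i\<in>{..<p}. \<beta> i \<noteq> 0} = s \<and>
                 (\<forall>i<p. \<beta> i \<noteq> 0 \<longrightarrow> \<bar>\<beta> i\<bar> \<ge> A)}"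

definition Risk :: "nat \<Rightarrow> nat \<Rightarrow> rmat measure \<Rightarrow> (rvec \<Rightarrow> rmat \<Rightarrow> real) \<Rightarrow> nat \<Rightarrow> real \<Rightarrow> real" where
  "Risk n p DX T s A = Exp n p DX (\<lambda>_. 0) T +
      (SUP \<beta>\<in>Xi p s A. Exp n p DX \<beta> (\<lambda>y X. 1 - T y X))"

definition subg_row :: "nat \<Rightarrow> real \<Rightarrow> rvec measure \<Rightarrow> bool" where
  "subg_row p \<sigma>2 \<mu> \<longleftrightarrow> prob_space \<mu> \<and> sets \<mu> = sets (vec_space p) \<and>
     (\<forall>a<p. integrable \<mu> (\<lambda>x. x a) \<and> (\<integral>x. x a \<partial>\<mu>) = 0) \<and>
     (\<forall>a<p. \<forall>b<p. integrable \<mu> (\<lambda>x. x a * x b) \<and>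
                   (\<integral>x. x a * x b \<partial>\<mu>) = (if a = b then 1 else 0)) \<and>
     (\<forall>u::rvec. (\<Sum>a<p. (u a)\<^sup>2) = 1 \<longrightarrow> (\<forall>t::real.
        integrable \<mu> (\<lambda>x. exp (t * (\<Sum>a<p. u a * x a))) \<and>
        ln (\<integral>x. exp (t * (\<Sum>a<p. u a * x a)) \<partial>\<mu>) \<le> \<sigma>2 * t\<^sup>2 / 2))"

definition SubG_design :: "nat \<Rightarrow> nat \<Rightarrow> real \<Rightarrow> rmat measure \<Rightarrow> bool" where
  "SubG_design n p \<sigma>2 DX \<longleftrightarrow> (\<exists>\<mu>. subg_row p \<sigma>2 \<mu> \<and> DX = PiM {..<n} (\<lambda>_. \<mu>) \<and>
       (AE X in DX. pos_def p (gram n p X)))"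

definition Orth_design :: "nat \<Rightarrow> nat \<Rightarrow> rmat measure \<Rightarrow> bool" where
  "Orth_design n p DX \<longleftrightarrow> prob_space DX \<and> sets DX = sets (mat_space n p) \<and>
     (AE X in DX. \<forall>a<p. \<forall>b<p. gram n p X a b = (if a = b then real n else 0))"

end

theory Submission
  imports Defs "HOL-Analysis.Generalised_Binomial_Theorem" "HOL-Real_Asymp.Real_Asymp"
begin

text \<open>Given $X$, the statistic is $z = \mu + g$ with $g$ standard Gaussian in $R^p$ and
  $\mu = (X^T X)^{1/2} \beta$, and $|\mu - \sqrt n \beta|^2 \le |(X^T X - n I)\beta|^2 / n$. For the block
  signal this bound is at most $1$ with probability at least $1/2$: it vanishes for orthogonal
  designs, and in the sub-Gaussian case a fourth moment bound and Markov's inequality apply because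
  $n \gg p^{3/2}$. For every threshold $t$ the risk is then at least, up to the factor $1/2$, the smaller
  of the null probability of at least $k$ exceedances and the alternative probability of at most $k$.
  With $k \approx \kappa s$ these are at least $p^{-\kappa(1-\alpha)s(1+o(1))}$ (binomial tail) and
  $p^{-(1-\kappa)(\sqrt r - 1)_+^2 s(1+o(1))}$ (product of Gaussian probabilities), and some
  $\kappa \in (0,1)$ makes both exponents strictly smaller than $(r-\alpha)^2/(4r)$.\<close>

section \<open>The spectral theorem for symmetric matrices\<close>

text \<open>Write \<tau> = sqrt (2 log p), so that exp (\<tau>^2 / 2) = p. Moving a Gaussian
  coordinate or its threshold by 1 changes the relevant log-probabilities only by O(\<tau>) = o(log
  p). This is why \<mu> need only be known up to distance 1. The roughly p noise coordinates that
  must stay below \<tau> contribute a factor at least exp (- 4 exp \<tau>). It is negligible on the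
  scale s log p, because exp \<tau> = p^o(1) while s is a positive power of p.

  The power 3/2 comes from E |(X^T X - n I) \<beta>|^2 \<le> C n A^2 s p: divided by n this is of
  order p^(2 - \<alpha>) log p / n, and 2 - \<alpha> < 3/2.

  A second obstacle is that \<open>inv_sqrt\<close> is a choice and \<open>Exp\<close> a Bochner
  integral, which is 0 on nonmeasurable integrands. No expectation can be compared before the chosen
  matrix is known to depend measurably on X, so the inverse square root is expanded into a series of
  polynomials in the Gram matrix.\<close>

definition orthonormal_fam :: "nat \<Rightarrow> nat \<Rightarrow> (nat \<Rightarrow> rvec) \<Rightarrow> bool" where
  "orthonormal_fam p k u \<longleftrightarrow>
     (\<forall>i<k. \<forall>j<k. (\<Sum>a<p. u i a * u j a) = (if i = j then 1 else 0))"

text \<open>The basis vector e_a minus its orthogonal projection onto the span of the first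
  \<open>k\<close> vectors of \<open>u\<close>.\<close>

definition residual :: "nat \<Rightarrow> (nat \<Rightarrow> rvec) \<Rightarrow> nat \<Rightarrow> rvec" where
  "residual k u a = (\<lambda>b. (if b = a then 1 else 0) - (\<Sum>i<k. u i a * u i b))"

lemma residual_orthogonal:
  assumes "orthonormal_fam p k u" "a < p" "j < k"
  shows "(\<Sum>b<p. u j b * residual k u a b) = 0"
proof -
  have "(\<Sum>b<p. u j b * residual k u a b) =
      (\<Sum>b<p. u j b * (if b = a then 1 else 0)) - (\<Sum>b<p. \<Sum>i<k. u i a * (u i b * u j b))"
    by (simp add: residual_def algebra_simps sum_subtractf sum_distrib_left)
  also have "(\<Sum>b<p. u j b * (if b = a then 1 else 0)) = u j a"
    using assms by (simp add: if_distrib cong: if_cong)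
  also have "(\<Sum>b<p. \<Sum>i<k. u i a * (u i b * u j b)) = (\<Sum>i<k. u i a * (\<Sum>b<p. u i b * u j b))"
    by (subst sum.swap) (simp add: sum_distrib_left)
  also have "\<dots> = (\<Sum>i<k. u i a * (if i = j then 1 else 0))"
    using assms by (intro sum.cong) (auto simp: orthonormal_fam_def)
  also have "\<dots> = u j a"
    using assms by (simp add: if_distrib cong: if_cong)
  finally show ?thesis by simp
qed

lemma residual_norm:
  assumes "orthonormal_fam p k u" "a < p"
  shows "(\<Sum>b<p. (residual k u a b)\<^sup>2) = 1 - (\<Sum>i<k. (u i a)\<^sup>2)"
proof -
  have "(\<Sum>b<p. (residual k u a b)\<^sup>2) =
     (\<Sum>b<p. (if b = a then residual k u a b else 0)) - (\<Sum>b<p. (\<Sum>i<k. u i a * u i b) * residual k u a b)"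
    unfolding sum_subtractf[symmetric]
    by (intro sum.cong) (auto simp: power2_eq_square residual_def algebra_simps)
  also have "(\<Sum>b<p. (if b = a then residual k u a b else 0)) = residual k u a a"
    using assms by simp
  also have "(\<Sum>b<p. (\<Sum>i<k. u i a * u i b) * residual k u a b) =
      (\<Sum>i<k. u i a * (\<Sum>b<p. u i b * residual k u a b))"
    by (simp add: sum_distrib_left sum_distrib_right mult.assoc) (rule sum.swap)
  also have "\<dots> = 0"
    using residual_orthogonal[OF assms] by (intro sum.neutral) auto
  finally show ?thesis by (simp add: residual_def power2_eq_square)
qed

lemma orthonormal_fam_total:
  assumes "orthonormal_fam p k u"
  shows "(\<Sum>a<p. \<Sum>i<k. (u i a)\<^sup>2) = real k"
proof -
  have "(\<Sum>a<p. \<Sum>i<k. (u i a)\<^sup>2) = (\<Sum>i<k. \<Sum>a<p. u i a * u i a)"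
    by (subst sum.swap) (simp add: power2_eq_square)
  also have "\<dots> = (\<Sum>i<k. 1)"
    using assms by (intro sum.cong) (auto simp: orthonormal_fam_def)
  finally show ?thesis by simp
qed

lemma bessel_coordinate:
  assumes "orthonormal_fam p k u" "a < p"
  shows "(\<Sum>i<k. (u i a)\<^sup>2) \<le> 1"
  using residual_norm[OF assms] sum_nonneg[of "{..<p}" "\<lambda>b. (residual k u a b)\<^sup>2"] by simp

text \<open>The squared projections of the p basis vectors sum to k < p, so some e_a has a nonzero
  residual; normalising it gives x. A vector is a function on all naturals, so x is set to 0 from
  index p on to make the sphere below compact.\<close>

lemma orthonormal_fam_incomplete:
  assumes "orthonormal_fam p k u" "k < p"
  obtains x where "\<And>j. j < k \<Longrightarrow> (\<Sum>b<p. u j b * x b) = 0" "(\<Sum>b<p. (x b)\<^sup>2) = 1" "\<And>b. b \<ge> p \<Longrightarrow> x b = 0"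
proof -
  have "\<exists>a<p. (\<Sum>i<k. (u i a)\<^sup>2) < 1"
  proof (rule ccontr)
    assume "\<not> ?thesis"
    hence "1 \<le> (\<Sum>i<k. (u i a)\<^sup>2)" if "a < p" for a using that by force
    hence "(\<Sum>a<p. 1) \<le> (\<Sum>a<p. \<Sum>i<k. (u i a)\<^sup>2)" by (intro sum_mono) auto
    thus False using orthonormal_fam_total[OF assms(1)] assms(2) by simp
  qed
  then obtain a where a: "a < p" "(\<Sum>i<k. (u i a)\<^sup>2) < 1" by blast
  define N where "N = (\<Sum>b<p. (residual k u a b)\<^sup>2)"
  have N: "N > 0" using residual_norm[OF assms(1) a(1)] a(2) by (simp add: N_def)
  define x where "x b = (if b < p then residual k u a b / sqrt N else 0)" for b
  show ?thesis
  proof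
    fix j assume "j < k"
    have "(\<Sum>b<p. u j b * x b) = (\<Sum>b<p. u j b * residual k u a b) / sqrt N"
      by (simp add: x_def sum_divide_distrib)
    thus "(\<Sum>b<p. u j b * x b) = 0" using residual_orthogonal[OF assms(1) a(1) \<open>j<k\<close>] by simp
  next
    have "(\<Sum>b<p. (x b)\<^sup>2) = N / N"
      using N by (simp add: x_def power_divide sum_divide_distrib[symmetric] N_def[symmetric])
    thus "(\<Sum>b<p. (x b)\<^sup>2) = 1" using N by simp
  qed (simp add: x_def)
qed

text \<open>The p Bessel defects are nonnegative and add up to p - p = 0, so every residual
  vanishes. This turns orthonormal columns into orthonormal rows without determinants.\<close>

lemma orthonormal_fam_complete:
  assumes "orthonormal_fam p p u" "a < p" "b < p"
  shows "(\<Sum>i<p. u i a * u i b) = (if a = b then 1 else 0)"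
proof -
  have "(\<Sum>a<p. 1 - (\<Sum>i<p. (u i a)\<^sup>2)) = 0"
    using orthonormal_fam_total[OF assms(1)] by (simp add: sum_subtractf)
  hence "1 - (\<Sum>i<p. (u i a)\<^sup>2) = 0"
    using bessel_coordinate[OF assms(1)] assms(2) by (subst (asm) sum_nonneg_eq_0_iff) auto
  hence "(\<Sum>b<p. (residual p u a b)\<^sup>2) = 0" using residual_norm[OF assms(1,2)] by simp
  hence "residual p u a b = 0" using assms(3) by (subst (asm) sum_nonneg_eq_0_iff) auto
  thus ?thesis by (auto simp: residual_def split: if_splits)
qed

text \<open>Tychonoff: the set is closed in a product of intervals [-1, 1] and, from index p on, of
  singletons.\<close>

lemma compact_sphere_complement:
  "compact {x::rvec. (\<forall>b\<ge>p. x b = 0) \<and> (\<Sum>b<p. (x b)\<^sup>2) = 1 \<and> (\<forall>j<k. (\<Sum>b<p. u j b * x b) = 0)}"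
    (is "compact ?K")
proof -
  let ?B = "PiE UNIV (\<lambda>b. if b < p then {-1..1::real} else {0})"
  have cB: "compact ?B"
  proof -
    have "compactin (product_topology (\<lambda>i. euclidean) UNIV) ?B"
      by (subst compactin_PiE) auto
    thus ?thesis by (simp add: euclidean_product_topology)
  qed
  have cont: "continuous_on UNIV (\<lambda>x::rvec. x b)" for b
    by (rule continuous_on_product_coordinates)
  have "closed {x::rvec. (\<Sum>b<p. (x b)\<^sup>2) = 1}"
    by (intro closed_Collect_eq continuous_intros cont)
  moreover have "closed {x::rvec. \<forall>j<k. (\<Sum>b<p. u j b * x b) = 0}"
    by (intro closed_Collect_all closed_Collect_imp closed_Collect_eq continuous_intros cont open_Collect_const)
  moreover have "?K = ?B \<inter> ({x. (\<Sum>b<p. (x b)\<^sup>2) = 1} \<inter> {x. \<forall>j<k. (\<Sum>b<p. u j b * x b) = 0})"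
  proof -
    have "\<bar>x b\<bar> \<le> 1" if "(\<Sum>b<p. (x b)\<^sup>2) = 1" "b < p" for x :: rvec and b
    proof -
      have "(x b)\<^sup>2 \<le> (\<Sum>b<p. (x b)\<^sup>2)" using that by (intro member_le_sum) auto
      thus ?thesis using that by (simp add: abs_square_le_1)
    qed
    thus ?thesis by (auto simp: PiE_iff abs_le_iff split: if_splits)
  qed
  ultimately show ?thesis using cB by (simp add: compact_Int_closed closed_Int)
qed

text \<open>Rayleigh quotient argument: v maximises the quadratic form of M on the unit sphere of
  the complement of the known eigenvectors. M maps this complement into itself, so w = M v - l v
  lies in it, and moving v towards w would raise the quotient to first order unless w = 0.\<close>

lemma symmetric_eigenvector_in_complement:
  fixes M :: rmat
  assumes sym: "\<And>a b. a < p \<Longrightarrow> b < p \<Longrightarrow> M a b = M b a"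
    and on: "orthonormal_fam p k u" and k: "k < p"
    and eig: "\<And>i a. i < k \<Longrightarrow> a < p \<Longrightarrow> (\<Sum>b<p. M a b * u i b) = d i * u i a"
  obtains v l where "(\<Sum>a<p. v a * v a) = 1" "\<And>j. j < k \<Longrightarrow> (\<Sum>a<p. u j a * v a) = 0"
     "\<And>a. a < p \<Longrightarrow> (\<Sum>b<p. M a b * v b) = l * v a"
proof -
  define K where "K = {x::rvec. (\<forall>b\<ge>p. x b = 0) \<and> (\<Sum>b<p. (x b)\<^sup>2) = 1 \<and> (\<forall>j<k. (\<Sum>b<p. u j b * x b) = 0)}"
  define B where "B x y = (\<Sum>a<p. \<Sum>b<p. x a * M a b * y b)" for x y :: rvec
  define D where "D x y = (\<Sum>a<p. x a * y a)" for x y :: rvec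
  have [simp]: "B (\<lambda>a. x a + t * y a) z = B x z + t * B y z" for x y z t
    by (simp add: B_def sum.distrib[symmetric] sum_distrib_left algebra_simps)
  have [simp]: "B z (\<lambda>a. x a + t * y a) = B z x + t * B z y" for x y z t
    by (simp add: B_def sum.distrib[symmetric] sum_distrib_left algebra_simps)
  have [simp]: "D (\<lambda>a. x a + t * y a) z = D x z + t * D y z" for x y z t
    by (simp add: D_def sum.distrib[symmetric] sum_distrib_left algebra_simps)
  have Dlin2[simp]: "D z (\<lambda>a. x a + t * y a) = D z x + t * D z y" for x y z t
    by (simp add: D_def sum.distrib[symmetric] sum_distrib_left algebra_simps)
  have Dsym: "D x y = D y x" for x y by (simp add: D_def mult.commute)
  have Bsym: "B x y = B y x" for x y
    unfolding B_def by (subst sum.swap) (intro sum.cong, auto simp: sym)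
  have "continuous_on K (\<lambda>x. B x x)" unfolding B_def
    by (intro continuous_intros continuous_on_subset[OF continuous_on_product_coordinates]) auto
  moreover have "K \<noteq> {}" using orthonormal_fam_incomplete[OF on k] unfolding K_def by (smt (verit) Collect_empty_eq)
  moreover have "compact K" unfolding K_def by (rule compact_sphere_complement)
  ultimately obtain v where v: "v \<in> K" and vmax: "\<And>x. x \<in> K \<Longrightarrow> B x x \<le> B v v"
    using continuous_attains_sup[of K "\<lambda>x. B x x"] by blast
  define l where "l = B v v"
  have vv: "D v v = 1" using v by (simp add: K_def D_def power2_eq_square)
  have vu: "D (u j) v = 0" if "j < k" for j using v that by (simp add: K_def D_def)
  have max: "B x x \<le> l * D x x" if x: "\<And>j. j < k \<Longrightarrow> D (u j) x = 0" for x
  proof (cases "D x x = 0")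
    case True
    hence "x a = 0" if "a < p" for a using that unfolding D_def by (subst (asm) sum_nonneg_eq_0_iff) auto
    thus ?thesis using True by (simp add: B_def)
  next
    case False
    hence pos: "D x x > 0" using sum_nonneg[of "{..<p}" "\<lambda>a. x a * x a"] by (simp add: D_def)
    define y where "y b = (if b < p then x b / sqrt (D x x) else 0)" for b
    have "y \<in> K" unfolding K_def
    proof (intro CollectI conjI allI impI)
      have "(\<Sum>b<p. (y b)\<^sup>2) = D x x / D x x"
        using pos by (simp add: y_def power_divide sum_divide_distrib[symmetric] D_def power2_eq_square[symmetric] sum_nonneg)
      thus "(\<Sum>b<p. (y b)\<^sup>2) = 1" using pos by simp
      fix j assume "j < k"
      have "(\<Sum>b<p. u j b * y b) = D (u j) x / sqrt (D x x)" by (simp add: y_def D_def sum_divide_distrib)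
      thus "(\<Sum>b<p. u j b * y b) = 0" using x[OF \<open>j<k\<close>] by simp
    qed (simp add: y_def)
    hence "B y y \<le> l" using vmax by (simp add: l_def)
    moreover have "B y y = B x x / D x x"
    proof -
      have "B y y = (\<Sum>a<p. \<Sum>b<p. x a * M a b * x b / (sqrt (D x x) * sqrt (D x x)))"
        by (simp add: B_def y_def)
      also have "sqrt (D x x) * sqrt (D x x) = D x x" using pos by simp
      finally show ?thesis by (simp add: B_def sum_divide_distrib)
    qed
    ultimately show ?thesis using pos by (simp add: field_simps)
  qed
  define w where "w a = (\<Sum>b<p. M a b * v b) + (- l) * v a" for a
  have BD: "B x v = D x (\<lambda>a. \<Sum>b<p. M a b * v b)" for x
    by (simp add: B_def D_def sum_distrib_left mult.assoc)
  have Dw: "D x w = B x v - l * D x v" for x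
    unfolding w_def Dlin2 BD by simp
  have wu: "D (u j) w = 0" if "j < k" for j
  proof -
    have "B (u j) v = B v (u j)" by (rule Bsym)
    also have "\<dots> = (\<Sum>a<p. v a * (\<Sum>b<p. M a b * u j b))" by (simp add: B_def sum_distrib_left mult.assoc)
    also have "\<dots> = (\<Sum>a<p. v a * (d j * u j a))" using that by (intro sum.cong) (auto simp: eig)
    also have "\<dots> = d j * D (u j) v" by (simp add: D_def sum_distrib_left mult_ac)
    finally show ?thesis using vu[OF that] by (simp add: Dw)
  qed
  have D0: "D x x \<ge> 0" for x by (simp add: D_def sum_nonneg)
  have "D w w = 0"
  proof (rule ccontr)
    assume "D w w \<noteq> 0"
    hence pos: "D w w > 0" using D0[of w] by simp
    define C where "C = l * D w w - B w w"
    \<comment> \<open>Maximality at v + t w: the constant terms cancel, and by \<open>Dw\<close> the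
      linear terms amount to 2 t D w w.\<close>
    have h: "0 \<le> t\<^sup>2 * C - 2 * t * D w w" for t
    proof -
      let ?x = "\<lambda>a. v a + t * w a"
      have "B ?x ?x \<le> l * D ?x ?x" by (rule max) (simp add: vu wu)
      moreover have "B ?x ?x = l + 2 * t * B w v + t\<^sup>2 * B w w"
        by (simp add: l_def Bsym[of v w] algebra_simps power2_eq_square)
      moreover have "D ?x ?x = 1 + 2 * t * D w v + t\<^sup>2 * D w w"
        by (simp add: vv Dsym[of v w] algebra_simps power2_eq_square)
      ultimately have "l + 2 * t * B w v + t\<^sup>2 * B w w \<le> l * (1 + 2 * t * D w v + t\<^sup>2 * D w w)"
        by (simp only:)
      hence "2 * t * (B w v - l * D w v) \<le> t\<^sup>2 * C" by (simp add: C_def algebra_simps)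
      thus ?thesis unfolding Dw[of w, symmetric] by simp
    qed
    \<comment> \<open>Small enough that e C is at most D w w, whereas \<open>h\<close> would force
      it to be at least 2 D w w.\<close>
    define e where "e = D w w / (\<bar>C\<bar> + 1)"
    have "e > 0" using pos by (simp add: e_def)
    moreover have "0 \<le> e * (e * C - 2 * D w w)"
      using h[of e] by (simp add: power2_eq_square algebra_simps)
    ultimately have "0 \<le> e * C - 2 * D w w"
      by (simp add: zero_le_mult_iff)
    hence "2 * D w w \<le> D w w * (C / (\<bar>C\<bar> + 1))" by (simp add: e_def)
    also have "\<dots> \<le> D w w * 1" using pos by (intro mult_left_mono) (auto simp: field_simps)
    finally show False using pos by simp
  qed
  hence w0: "w a = 0" if "a < p" for a
    using that unfolding D_def by (subst (asm) sum_nonneg_eq_0_iff) auto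
  show ?thesis
  proof
    show "(\<Sum>a<p. v a * v a) = 1" using vv by (simp add: D_def)
    show "(\<Sum>a<p. u j a * v a) = 0" if "j < k" for j using vu[OF that] by (simp add: D_def)
    show "(\<Sum>b<p. M a b * v b) = l * v a" if "a < p" for a using w0[OF that] by (simp add: w_def)
  qed
qed

lemma symmetric_eigenbasis:
  fixes M :: rmat
  assumes sym: "\<And>a b. a < p \<Longrightarrow> b < p \<Longrightarrow> M a b = M b a" and "k \<le> p"
  shows "\<exists>u d. orthonormal_fam p k u \<and> (\<forall>i<k. \<forall>a<p. (\<Sum>b<p. M a b * u i b) = d i * u i a)"
  using \<open>k \<le> p\<close>
proof (induction k)
  case 0
  thus ?case by (simp add: orthonormal_fam_def)
next
  case (Suc k)
  then obtain u d where on: "orthonormal_fam p k u"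
    and eig: "\<forall>i<k. \<forall>a<p. (\<Sum>b<p. M a b * u i b) = d i * u i a" by auto
  have kp: "k < p" using Suc.prems by simp
  have eg: "(\<Sum>b<p. M a b * u i b) = d i * u i a" if "i < k" "a < p" for i a
    using eig that by blast
  obtain v l where v: "(\<Sum>a<p. v a * v a) = 1" "\<And>j. j < k \<Longrightarrow> (\<Sum>a<p. u j a * v a) = 0"
     "\<And>a. a < p \<Longrightarrow> (\<Sum>b<p. M a b * v b) = l * v a"
    using symmetric_eigenvector_in_complement[OF sym on kp eg] by blast
  have v': "(\<Sum>a<p. v a * u j a) = 0" if "j < k" for j
    using v(2)[OF that] by (simp add: mult.commute)
  show ?case
  proof (intro exI conjI)
    show "orthonormal_fam p (Suc k) (u(k := v))"
      using on v v' by (auto simp: orthonormal_fam_def less_Suc_eq)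
    show "\<forall>i<Suc k. \<forall>a<p. (\<Sum>b<p. M a b * (u(k := v)) i b) = (d(k := l)) i * (u(k := v)) i a"
      using eig v(3) by (auto simp: less_Suc_eq)
  qed
qed

lemma orthogonal_mat_cols:
  "orthogonal_mat p Q \<Longrightarrow> i < p \<Longrightarrow> j < p \<Longrightarrow> (\<Sum>k<p. Q k i * Q k j) = (if i = j then 1 else 0)"
  by (simp add: orthogonal_mat_def)

lemma orthogonal_mat_rows:
  assumes "orthogonal_mat p Q" "a < p" "b < p"
  shows "(\<Sum>k<p. Q a k * Q b k) = (if a = b then 1 else 0)"
proof -
  have "orthonormal_fam p p (\<lambda>i a. Q a i)"
    using assms(1) by (simp add: orthogonal_mat_def orthonormal_fam_def)
  from orthonormal_fam_complete[OF this assms(2,3)] show ?thesis .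
qed

theorem symmetric_spectral_decomposition:
  fixes M :: rmat
  assumes sym: "\<And>a b. a < p \<Longrightarrow> b < p \<Longrightarrow> M a b = M b a"
  obtains Q d where "orthogonal_mat p Q"
    "\<And>a b. a < p \<Longrightarrow> b < p \<Longrightarrow> M a b = (\<Sum>k<p. Q a k * d k * Q b k)"
proof -
  obtain u d where on: "orthonormal_fam p p u"
    and eig: "\<forall>i<p. \<forall>a<p. (\<Sum>b<p. M a b * u i b) = d i * u i a"
    using symmetric_eigenbasis[of p M p] sym by blast
  define Q where "Q a k = u k a" for a k
  have oQ: "orthogonal_mat p Q" using on by (simp add: Q_def orthogonal_mat_def orthonormal_fam_def)
  show ?thesis
  proof
    show "orthogonal_mat p Q" by (rule oQ)
    fix a b assume ab: "a < p" "b < p"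
    have "(\<Sum>k<p. Q a k * d k * Q b k) = (\<Sum>k<p. (\<Sum>c<p. M a c * Q c k) * Q b k)"
      using eig ab by (intro sum.cong) (auto simp: Q_def mult_ac)
    also have "\<dots> = (\<Sum>c<p. M a c * (\<Sum>k<p. Q c k * Q b k))"
      by (simp add: sum_distrib_left sum_distrib_right mult.assoc) (rule sum.swap)
    also have "\<dots> = (\<Sum>c<p. M a c * (if c = b then 1 else 0))"
      using orthogonal_mat_rows[OF oQ] ab by (intro sum.cong) auto
    also have "\<dots> = M a b" using ab by (simp add: if_distrib cong: if_cong)
    finally show "M a b = (\<Sum>k<p. Q a k * d k * Q b k)" by simp
  qed
qed

section \<open>The inverse square root of a positive definite matrix\<close>

text \<open>Functional calculus Q diag(f) Q^T. With Q fixed, all functions of one symmetric matrix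
  multiply eigenvalue by eigenvalue.\<close>

definition mat_fun :: "nat \<Rightarrow> rmat \<Rightarrow> (nat \<Rightarrow> real) \<Rightarrow> rmat" where
  "mat_fun p Q f = (\<lambda>a b. \<Sum>k<p. Q a k * f k * Q b k)"

lemma mat_fun_vec_coeff:
  assumes "orthogonal_mat p Q" "k < p"
  shows "(\<Sum>c<p. Q c k * (\<Sum>l<p. Q c l * g l)) = g k"
proof -
  have "(\<Sum>c<p. Q c k * (\<Sum>l<p. Q c l * g l)) = (\<Sum>l<p. (\<Sum>c<p. Q c k * Q c l) * g l)"
    by (simp add: sum_distrib_left sum_distrib_right mult.assoc) (rule sum.swap)
  also have "\<dots> = (\<Sum>l<p. (if k = l then 1 else 0) * g l)"
    using assms by (intro sum.cong) (auto simp: orthogonal_mat_cols)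
  also have "\<dots> = g k" using assms by (simp add: if_distribR if_distrib cong: if_cong)
  finally show ?thesis .
qed

lemma mat_fun_mult:
  assumes "orthogonal_mat p Q"
  shows "(\<Sum>c<p. mat_fun p Q f a c * mat_fun p Q g c b) = mat_fun p Q (\<lambda>k. f k * g k) a b"
proof -
  have "(\<Sum>c<p. mat_fun p Q f a c * mat_fun p Q g c b) =
      (\<Sum>c<p. \<Sum>k<p. Q a k * f k * (Q c k * (\<Sum>l<p. Q c l * (g l * Q b l))))"
    by (simp add: mat_fun_def sum_distrib_right mult.assoc)
  also have "\<dots> = (\<Sum>k<p. Q a k * f k * (\<Sum>c<p. Q c k * (\<Sum>l<p. Q c l * (g l * Q b l))))"
    by (subst sum.swap) (simp add: sum_distrib_left)
  also have "\<dots> = (\<Sum>k<p. Q a k * f k * (g k * Q b k))"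
    using mat_fun_vec_coeff[OF assms, where g = "\<lambda>l. g l * Q b l"] by (intro sum.cong) auto
  finally show ?thesis by (simp add: mat_fun_def mult_ac)
qed

lemma mat_fun_const:
  assumes "orthogonal_mat p Q" "a < p" "b < p"
  shows "mat_fun p Q (\<lambda>_. c) a b = (if a = b then c else 0)"
proof -
  have "mat_fun p Q (\<lambda>_. c) a b = c * (\<Sum>k<p. Q a k * Q b k)"
    by (simp add: mat_fun_def sum_distrib_left mult_ac)
  thus ?thesis using orthogonal_mat_rows[OF assms] by simp
qed

lemma mat_fun_diff:
  "mat_fun p Q (\<lambda>k. f k - g k) a b = mat_fun p Q f a b - mat_fun p Q g a b"
  by (simp add: mat_fun_def sum_subtractf[symmetric] algebra_simps)

lemma mat_fun_sym: "mat_fun p Q f a b = mat_fun p Q f b a"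
  by (simp add: mat_fun_def mult_ac)

text \<open>Parseval in the eigenbasis. It reduces norm comparisons between functions of one matrix
  to comparisons of eigenvalues.\<close>

lemma mat_fun_norm:
  assumes "orthogonal_mat p Q"
  shows "(\<Sum>j<p. (\<Sum>l<p. mat_fun p Q f j l * v l)\<^sup>2) = (\<Sum>k<p. (f k)\<^sup>2 * (\<Sum>l<p. Q l k * v l)\<^sup>2)"
proof -
  define c where "c k = (\<Sum>l<p. Q l k * v l)" for k
  have e: "(\<Sum>l<p. mat_fun p Q f j l * v l) = (\<Sum>k<p. Q j k * (f k * c k))" for j
    by (simp add: mat_fun_def c_def sum_distrib_left sum_distrib_right mult.assoc) (rule sum.swap)
  have "(\<Sum>j<p. (\<Sum>l<p. mat_fun p Q f j l * v l)\<^sup>2) =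
      (\<Sum>j<p. \<Sum>k<p. (f k * c k) * (Q j k * (\<Sum>l<p. Q j l * (f l * c l))))"
    unfolding e power2_eq_square by (simp add: sum_distrib_right mult_ac)
  also have "\<dots> = (\<Sum>k<p. (f k * c k) * (\<Sum>j<p. Q j k * (\<Sum>l<p. Q j l * (f l * c l))))"
    by (subst sum.swap) (simp add: sum_distrib_left)
  also have "\<dots> = (\<Sum>k<p. (f k * c k) * (f k * c k))"
    using mat_fun_vec_coeff[OF assms, where g = "\<lambda>l. f l * c l"] by (intro sum.cong) auto
  finally show ?thesis by (simp add: c_def power2_eq_square mult_ac)
qed

definition eigen_decomp :: "nat \<Rightarrow> rmat \<Rightarrow> rmat \<Rightarrow> (nat \<Rightarrow> real) \<Rightarrow> bool" where
  "eigen_decomp p M Q d \<longleftrightarrow> orthogonal_mat p Q \<and> (\<forall>a<p. \<forall>b<p. M a b = mat_fun p Q d a b)"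

text \<open>Exactly the condition under which the choice in \<open>inv_sqrt\<close> has a
  witness.\<close>

definition pos_decomposable :: "nat \<Rightarrow> rmat \<Rightarrow> bool" where
  "pos_decomposable p M \<longleftrightarrow> (\<exists>Q d. eigen_decomp p M Q d \<and> (\<forall>k<p. d k > 0))"

lemma inv_sqrt_decomp:
  assumes "pos_decomposable p M"
  obtains Q d where "eigen_decomp p M Q d" "\<And>k. k < p \<Longrightarrow> d k > 0"
    "inv_sqrt p M = mat_fun p Q (\<lambda>k. 1 / sqrt (d k))"
proof -
  let ?P = "\<lambda>S. \<exists>Q d. orthogonal_mat p Q \<and> (\<forall>k<p. d k > 0) \<and>
      (\<forall>a<p. \<forall>b<p. M a b = (\<Sum>k<p. Q a k * d k * Q b k)) \<and>
      S = (\<lambda>a b. \<Sum>k<p. Q a k * (1 / sqrt (d k)) * Q b k)"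
  have "\<exists>S. ?P S" using assms unfolding pos_decomposable_def eigen_decomp_def mat_fun_def by blast
  hence "?P (inv_sqrt p M)" unfolding inv_sqrt_def by (rule someI_ex)
  thus ?thesis using that unfolding eigen_decomp_def mat_fun_def by blast
qed

text \<open>Without a witness the chosen predicate is constantly false, so the value is one fixed
  matrix that does not vary with M. Hence \<open>inv_sqrt\<close> is constant, and so measurable, on
  this set as well.\<close>

lemma inv_sqrt_undefined:
  assumes "\<not> pos_decomposable p M"
  shows "inv_sqrt p M = (SOME S. False)"
proof -
  have "(\<exists>Q d. orthogonal_mat p Q \<and> (\<forall>k<p. d k > 0) \<and>
      (\<forall>a<p. \<forall>b<p. M a b = (\<Sum>k<p. Q a k * d k * Q b k)) \<and>
      S = (\<lambda>a b. \<Sum>k<p. Q a k * (1 / sqrt (d k)) * Q b k)) = False" for S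
    using assms unfolding pos_decomposable_def eigen_decomp_def mat_fun_def by blast
  thus ?thesis unfolding inv_sqrt_def by (simp only:)
qed

text \<open>Each eigenvalue is the quadratic form of M at a unit vector, the corresponding column of
  Q.\<close>

lemma pos_def_decomposable:
  assumes "pos_def p M"
  shows "pos_decomposable p M"
proof -
  obtain Q d where Q: "orthogonal_mat p Q"
    and M: "\<And>a b. a < p \<Longrightarrow> b < p \<Longrightarrow> M a b = (\<Sum>k<p. Q a k * d k * Q b k)"
    by (rule symmetric_spectral_decomposition[of p M]) (use assms in \<open>auto simp: pos_def_def\<close>)
  have "d k > 0" if k: "k < p" for k
  proof -
    have "(\<Sum>a<p. Q a k * Q a k) = 1" using orthogonal_mat_cols[OF Q k k] by simp
    hence "\<exists>a<p. Q a k \<noteq> 0" by (metis (no_types, lifting) lessThan_iff mult_zero_left sum.neutral zero_neq_one)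
    moreover have "\<forall>v::rvec. (\<exists>a<p. v a \<noteq> 0) \<longrightarrow> (\<Sum>a<p. \<Sum>b<p. v a * M a b * v b) > 0"
      using assms by (simp add: pos_def_def)
    ultimately have "0 < (\<Sum>a<p. \<Sum>b<p. Q a k * M a b * Q b k)"
      by (elim allE[where x = "\<lambda>a. Q a k"]) (rule mp)
    also have "\<dots> = (\<Sum>a<p. Q a k * (\<Sum>b<p. Q b k * (\<Sum>l<p. Q b l * (d l * Q a l))))"
      using M by (intro sum.cong) (auto simp: sum_distrib_left sum_distrib_right mult_ac)
    also have "\<dots> = (\<Sum>a<p. Q a k * (d k * Q a k))"
      using mat_fun_vec_coeff[OF Q k, where g = "\<lambda>l. d l * Q a l" for a] by simp
    also have "\<dots> = d k * (\<Sum>a<p. Q a k * Q a k)" by (simp add: sum_distrib_left mult_ac)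
    finally show ?thesis using orthogonal_mat_cols[OF Q k k] by simp
  qed
  thus ?thesis using Q M unfolding pos_decomposable_def eigen_decomp_def mat_fun_def by blast
qed

section \<open>Measurable dependence of the inverse square root on the matrix\<close>

definition mat_trace :: "nat \<Rightarrow> rmat \<Rightarrow> real" where
  "mat_trace p M = (\<Sum>a<p. M a a)"

text \<open>The powers of $I - M/c$; for $c = \mathrm{tr}\, M$ the eigenvalues of $I - M/c$ lie in
  $[0,1)$ exactly when $M$ is positive definite.\<close>

primrec contr_pow :: "nat \<Rightarrow> real \<Rightarrow> rmat \<Rightarrow> nat \<Rightarrow> rmat" where
  "contr_pow p c M 0 = (\<lambda>a b. if a = b then 1 else 0)"
| "contr_pow p c M (Suc m) =
     (\<lambda>a b. \<Sum>e<p. ((if a = e then 1 else 0) - M a e / c) * contr_pow p c M m e b)"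

lemma contr_pow_eigen:
  assumes "eigen_decomp p M Q d" "a < p" "b < p"
  shows "contr_pow p c M m a b = mat_fun p Q (\<lambda>k. (1 - d k / c) ^ m) a b"
  using assms(2,3)
proof (induction m arbitrary: a)
  case 0
  thus ?case using assms(1) by (simp add: mat_fun_const eigen_decomp_def)
next
  case (Suc m)
  have Q: "orthogonal_mat p Q" using assms(1) by (simp add: eigen_decomp_def)
  have "(if a = e then 1 else 0) - M a e / c = mat_fun p Q (\<lambda>k. 1 - d k / c) a e" if "e < p" for e
  proof -
    have "mat_fun p Q (\<lambda>k. d k / c) a e = M a e / c"
      using assms(1) that Suc.prems by (simp add: eigen_decomp_def) (simp add: mat_fun_def sum_divide_distrib)
    thus ?thesis using mat_fun_const[OF Q Suc.prems(1) that, of 1] by (simp add: mat_fun_diff)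
  qed
  hence "contr_pow p c M (Suc m) a b =
     (\<Sum>e<p. mat_fun p Q (\<lambda>k. 1 - d k / c) a e * mat_fun p Q (\<lambda>k. (1 - d k / c) ^ m) e b)"
    using Suc.IH Suc.prems by simp
  thus ?case by (simp add: mat_fun_mult[OF Q])
qed

lemma mat_trace_eigen:
  assumes "eigen_decomp p M Q d"
  shows "mat_trace p M = (\<Sum>k<p. d k)"
proof -
  have "mat_trace p M = (\<Sum>a<p. \<Sum>k<p. d k * (Q a k * Q a k))"
    using assms by (simp add: mat_trace_def eigen_decomp_def mat_fun_def mult_ac)
  also have "\<dots> = (\<Sum>k<p. d k * (\<Sum>a<p. Q a k * Q a k))"
    by (subst sum.swap) (simp add: sum_distrib_left)
  also have "\<dots> = (\<Sum>k<p. d k)"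
    using assms by (intro sum.cong) (auto simp: eigen_decomp_def orthogonal_mat_cols)
  finally show ?thesis .
qed

lemma trace_contraction:
  assumes "eigen_decomp p M Q d" "\<And>k. k < p \<Longrightarrow> d k > 0" "k < p"
  shows "mat_trace p M > 0" "0 \<le> 1 - d k / mat_trace p M" "1 - d k / mat_trace p M < 1"
proof -
  have "d k \<le> (\<Sum>k<p. d k)" using assms by (intro member_le_sum) (auto simp: less_imp_le)
  thus "mat_trace p M > 0" "0 \<le> 1 - d k / mat_trace p M" "1 - d k / mat_trace p M < 1"
    using assms(2)[OF assms(3)] by (auto simp: mat_trace_eigen[OF assms(1)] field_simps)
qed

text \<open>The binomial series of (I - (I - M/c))^(-1/2) with c = tr M. Its terms are polynomials
  in M/c, so the result no longer mentions the chosen eigenbasis: the value is independent of the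
  choice and is a limit of measurable functions of the entries.\<close>

lemma inv_sqrt_series:
  assumes "pos_decomposable p M" "a < p" "b < p"
  shows "inv_sqrt p M a b = 1 / sqrt (mat_trace p M) *
     (\<Sum>m. ((-1/2) gchoose m) * (-1) ^ m * contr_pow p (mat_trace p M) M m a b)"
proof -
  obtain Q d where D: "eigen_decomp p M Q d" and d: "\<And>k. k < p \<Longrightarrow> d k > 0"
    and S: "inv_sqrt p M = mat_fun p Q (\<lambda>k. 1 / sqrt (d k))"
    using inv_sqrt_decomp[OF assms(1)] by blast
  define c where "c = mat_trace p M"
  have c: "c > 0" using trace_contraction(1)[OF D d assms(2)] by (simp add: c_def)
  have "(\<lambda>m. ((-1/2) gchoose m) * (-(1 - d k / c)) ^ m) sums (sqrt c / sqrt (d k))" if k: "k < p" for k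
  proof -
    have "(\<lambda>m. ((-1/2) gchoose m) * (-(1 - d k / c)) ^ m) sums (1 + (-(1 - d k / c))) powr (-1/2)"
      using trace_contraction(2,3)[OF D d k] by (intro gen_binomial_real) (simp add: c_def)
    also have "(1 + (-(1 - d k / c))) powr (-1/2) = sqrt c / sqrt (d k)"
      using c d[OF k] by (simp add: powr_minus powr_half_sqrt real_sqrt_divide field_simps powr_divide)
    finally show ?thesis .
  qed
  hence "(\<lambda>m. \<Sum>k<p. Q a k * Q b k * (((-1/2) gchoose m) * (-(1 - d k / c)) ^ m)) sums
     (\<Sum>k<p. Q a k * Q b k * (sqrt c / sqrt (d k)))"
    by (intro sums_sum sums_mult) auto
  also have "(\<lambda>m. \<Sum>k<p. Q a k * Q b k * (((-1/2) gchoose m) * (-(1 - d k / c)) ^ m)) =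
     (\<lambda>m. ((-1/2) gchoose m) * (-1) ^ m * contr_pow p c M m a b)"
  proof
    fix m
    have "(-(1 - d k / c)) ^ m = (-1) ^ m * (1 - d k / c) ^ m" for k
      by (simp add: power_mult_distrib[symmetric])
    thus "(\<Sum>k<p. Q a k * Q b k * (((-1/2) gchoose m) * (-(1 - d k / c)) ^ m)) =
       ((-1/2) gchoose m) * (-1) ^ m * contr_pow p c M m a b"
      using contr_pow_eigen[OF D assms(2,3)] by (simp add: mat_fun_def sum_distrib_left mult_ac)
  qed
  finally have "(\<Sum>m. ((-1/2) gchoose m) * (-1) ^ m * contr_pow p c M m a b) =
     (\<Sum>k<p. Q a k * Q b k * (sqrt c / sqrt (d k)))"
    by (rule sums_unique[symmetric])
  also have "\<dots> = sqrt c * inv_sqrt p M a b"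
    by (simp add: S mat_fun_def sum_distrib_left mult_ac)
  finally show ?thesis using c by (simp add: c_def)
qed

text \<open>A description by countably many measurable conditions. For positive eigenvalues the
  powers of I - M/c tend to 0. Conversely, an eigenvalue d \<le> 0 gives (1 - d/c)^m \<ge> 1. This
  number is the quadratic form of the m-th power at a unit eigenvector, a sum of p^2 terms with
  coefficients at most 1, so entries below 1/p^2 exclude it.\<close>

lemma pos_decomposable_iff:
  assumes sym: "\<And>a b. a < p \<Longrightarrow> b < p \<Longrightarrow> M a b = M b a" and p: "p > 0"
  shows "pos_decomposable p M \<longleftrightarrow> mat_trace p M > 0 \<and>
     (\<exists>m. \<forall>a<p. \<forall>b<p. \<bar>contr_pow p (mat_trace p M) M m a b\<bar> < 1 / (real p)\<^sup>2)"
    (is "_ \<longleftrightarrow> ?R")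
proof
  assume "pos_decomposable p M"
  then obtain Q d where D: "eigen_decomp p M Q d" and d: "\<And>k. k < p \<Longrightarrow> d k > 0"
    unfolding pos_decomposable_def by blast
  have "(\<lambda>m. contr_pow p (mat_trace p M) M m a b) \<longlonglongrightarrow> 0" if "a < p" "b < p" for a b
  proof -
    have "(\<lambda>m. \<Sum>k<p. Q a k * (1 - d k / mat_trace p M) ^ m * Q b k) \<longlonglongrightarrow> (\<Sum>k<p. Q a k * 0 * Q b k)"
      using trace_contraction[OF D d] by (intro tendsto_intros LIMSEQ_realpow_zero) auto
    thus ?thesis using contr_pow_eigen[OF D that] by (simp add: mat_fun_def)
  qed
  hence "eventually (\<lambda>m. \<bar>contr_pow p (mat_trace p M) M m a b\<bar> < 1 / (real p)\<^sup>2) sequentially"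
    if "a < p" "b < p" for a b
    using tendstoD[of "\<lambda>m. contr_pow p (mat_trace p M) M m a b" 0 sequentially "1 / (real p)\<^sup>2"] that p
    by (simp add: dist_real_def)
  hence "eventually (\<lambda>m. \<forall>a\<in>{..<p}. \<forall>b\<in>{..<p}. \<bar>contr_pow p (mat_trace p M) M m a b\<bar> < 1 / (real p)\<^sup>2) sequentially"
    by (intro eventually_ball_finite ballI) auto
  hence "\<exists>m. \<forall>a\<in>{..<p}. \<forall>b\<in>{..<p}. \<bar>contr_pow p (mat_trace p M) M m a b\<bar> < 1 / (real p)\<^sup>2"
    by (simp add: eventually_sequentially) blast
  thus ?R using trace_contraction(1)[OF D d p] by auto
next
  assume R: ?R
  then obtain m where m: "\<And>a b. a < p \<Longrightarrow> b < p \<Longrightarrow> \<bar>contr_pow p (mat_trace p M) M m a b\<bar> < 1 / (real p)\<^sup>2"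
    by blast
  define c where "c = mat_trace p M"
  have c: "c > 0" using R by (simp add: c_def)
  obtain Q d where D: "eigen_decomp p M Q d"
    using symmetric_spectral_decomposition[of p M] sym unfolding eigen_decomp_def mat_fun_def by metis
  have Q: "orthogonal_mat p Q" using D by (simp add: eigen_decomp_def)
  have "d k > 0" if k: "k < p" for k
  proof (rule ccontr)
    assume "\<not> d k > 0"
    hence "d k / c \<le> 0" using c by (simp add: divide_nonpos_pos)
    hence ge1: "1 \<le> (1 - d k / c) ^ m" by (intro one_le_power) linarith
    have Q1: "\<bar>Q a k\<bar> \<le> 1" if "a < p" for a
    proof -
      have "Q a k * Q a k \<le> (\<Sum>a<p. Q a k * Q a k)" using that by (intro member_le_sum) auto
      thus ?thesis using orthogonal_mat_cols[OF Q k k]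
        by (simp add: power2_eq_square[symmetric] abs_square_le_1)
    qed
    have "(\<Sum>a<p. Q a k * (\<Sum>b<p. Q b k * contr_pow p c M m a b)) =
        (\<Sum>a<p. Q a k * (\<Sum>b<p. Q b k * (\<Sum>l<p. Q b l * ((1 - d l / c) ^ m * Q a l))))"
      using contr_pow_eigen[OF D] by (intro sum.cong) (auto simp: mat_fun_def mult_ac)
    also have "\<dots> = (\<Sum>a<p. Q a k * ((1 - d k / c) ^ m * Q a k))"
      using mat_fun_vec_coeff[OF Q k, where g = "\<lambda>l. (1 - d l / c) ^ m * Q a l" for a] by simp
    also have "\<dots> = (1 - d k / c) ^ m * (\<Sum>a<p. Q a k * Q a k)"
      by (simp add: sum_distrib_left mult_ac)
    also have "\<dots> = (1 - d k / c) ^ m" using orthogonal_mat_cols[OF Q k k] by simp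
    finally have "1 \<le> (\<Sum>a<p. \<Sum>b<p. Q a k * Q b k * contr_pow p c M m a b)"
      using ge1 by (simp add: sum_distrib_left mult_ac)
    also have "\<dots> < (\<Sum>a<p. \<Sum>b<p. 1 / (real p)\<^sup>2)"
    proof (intro sum_strict_mono)
      fix a b assume ab: "a \<in> {..<p}" "b \<in> {..<p}"
      have "Q a k * Q b k * contr_pow p c M m a b \<le> \<bar>Q a k\<bar> * \<bar>Q b k\<bar> * \<bar>contr_pow p c M m a b\<bar>"
        by (metis abs_ge_self abs_mult)
      also have "\<dots> \<le> 1 * 1 * \<bar>contr_pow p c M m a b\<bar>"
        using Q1 ab by (intro mult_mono) auto
      finally show "Q a k * Q b k * contr_pow p c M m a b < 1 / (real p)\<^sup>2"
        using m[of a b] ab by (simp add: c_def)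
    qed (use p in auto)
    finally show False using p by (simp add: power2_eq_square)
  qed
  thus "pos_decomposable p M" using D unfolding pos_decomposable_def by blast
qed

lemma measurable_contr_pow:
  assumes [measurable]: "\<And>a b. a < p \<Longrightarrow> b < p \<Longrightarrow> (\<lambda>x. M x a b) \<in> borel_measurable N"
    and [measurable]: "c \<in> borel_measurable N" and "a < p" "b < p"
  shows "(\<lambda>x. contr_pow p (c x) (M x) m a b) \<in> borel_measurable N"
  using assms(3,4)
proof (induction m arbitrary: a)
  case (Suc m)
  have [measurable]: "(\<lambda>x. contr_pow p (c x) (M x) m e b) \<in> borel_measurable N" if "e < p" for e
    using Suc that by blast
  show ?case using Suc.prems unfolding contr_pow.simps by measurable
qed simp

text \<open>On the measurable set of decomposable matrices the series applies; off it the value is a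
  constant.\<close>

lemma measurable_inv_sqrt:
  assumes M[measurable]: "\<And>a b. a < p \<Longrightarrow> b < p \<Longrightarrow> (\<lambda>x. M x a b) \<in> borel_measurable N"
    and sym: "\<And>x a b. a < p \<Longrightarrow> b < p \<Longrightarrow> M x a b = M x b a" and ab: "a < p" "b < p"
  shows "(\<lambda>x. inv_sqrt p (M x) a b) \<in> borel_measurable N"
proof -
  have [measurable]: "(\<lambda>x. mat_trace p (M x)) \<in> borel_measurable N"
    unfolding mat_trace_def by measurable
  note [measurable] = measurable_contr_pow[where M = M and p = p and N = N and c = "\<lambda>x. mat_trace p (M x)", OF M]
  have p: "p > 0" using ab by simp
  have [measurable]: "Measurable.pred N (\<lambda>x. pos_decomposable p (M x))"
  proof -
    have "pos_decomposable p (M x) \<longleftrightarrow> mat_trace p (M x) > 0 \<and>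
     (\<exists>m. \<forall>a<p. \<forall>b<p. \<bar>contr_pow p (mat_trace p (M x)) (M x) m a b\<bar> < 1 / (real p)\<^sup>2)" for x
      by (rule pos_decomposable_iff) (use sym p in auto)
    thus ?thesis by (simp only:) measurable
  qed
  have "(\<lambda>x. inv_sqrt p (M x) a b) = (\<lambda>x. if pos_decomposable p (M x) then
      1 / sqrt (mat_trace p (M x)) *
     (\<Sum>m. ((-1/2) gchoose m) * (-1) ^ m * contr_pow p (mat_trace p (M x)) (M x) m a b)
      else (SOME S. False) a b)"
    using inv_sqrt_series[OF _ ab] inv_sqrt_undefined by auto
  also have "\<dots> \<in> borel_measurable N" using ab by measurable
  finally show ?thesis .
qed

text \<open>Let G be the Gram matrix and S its inverse square root. Then W = S X^T has orthonormal
  rows because S G S = I, and \<mu> = G^(1/2) \<beta> because S G = G^(1/2). The last bound holds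
  eigenvalue by eigenvalue: |d - n| = |sqrt d - sqrt n| (sqrt d + sqrt n) \<ge> |sqrt d - sqrt n|
  sqrt n.\<close>

lemma zvec_representation:
  assumes G: "pos_decomposable p (gram n p X)" and n: "n > 0"
  obtains W \<mu> where
    "\<And>a b. a < p \<Longrightarrow> b < p \<Longrightarrow> (\<Sum>i<n. W a i * W b i) = (if a = b then 1 else 0)"
    "\<And>e j. j < p \<Longrightarrow> zvec n p (\<lambda>i. (\<Sum>k<p. X i k * \<beta> k) + e i) X j = \<mu> j + (\<Sum>i<n. W j i * e i)"
    "(\<Sum>j<p. (\<mu> j - sqrt (real n) * \<beta> j)\<^sup>2) \<le>
       (\<Sum>j<p. (\<Sum>l<p. (gram n p X j l - (if j = l then real n else 0)) * \<beta> l)\<^sup>2) / real n"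
proof -
  obtain Q d where D: "eigen_decomp p (gram n p X) Q d" and d: "\<And>k. k < p \<Longrightarrow> d k > 0"
    and S: "inv_sqrt p (gram n p X) = mat_fun p Q (\<lambda>k. 1 / sqrt (d k))"
    using inv_sqrt_decomp[OF G] by blast
  have Q: "orthogonal_mat p Q" and GQ: "\<And>a b. a < p \<Longrightarrow> b < p \<Longrightarrow> gram n p X a b = mat_fun p Q d a b"
    using D by (auto simp: eigen_decomp_def)
  define S' where "S' = inv_sqrt p (gram n p X)"
  define W where "W j i = (\<Sum>k<p. S' j k * X i k)" for j i
  define R where "R = mat_fun p Q (\<lambda>k. sqrt (d k))"
  define \<mu> where "\<mu> j = (\<Sum>k<p. R j k * \<beta> k)" for j
  have SG: "(\<Sum>k<p. S' j k * gram n p X k l) = R j l" if "l < p" for j l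
  proof -
    have "(\<Sum>k<p. S' j k * gram n p X k l) = (\<Sum>k<p. mat_fun p Q (\<lambda>k. 1 / sqrt (d k)) j k * mat_fun p Q d k l)"
      using that GQ by (simp add: S S'_def)
    also have "\<dots> = R j l" unfolding mat_fun_mult[OF Q] unfolding R_def mat_fun_def
      using d by (intro sum.cong) (auto simp: real_div_sqrt less_imp_le)
    finally show ?thesis .
  qed
  have one: "sqrt (d k) / sqrt (d k) = 1" if "k < p" for k
    using d[OF that] by simp
  show ?thesis
  proof
    fix a b assume ab: "a < p" "b < p"
    have "(\<Sum>i<n. W a i * W b i) = (\<Sum>i<n. \<Sum>l<p. \<Sum>k<p. S' b l * (S' a k * (X i k * X i l)))"
      by (simp add: W_def sum_distrib_left sum_distrib_right mult_ac)
    also have "\<dots> = (\<Sum>l<p. \<Sum>k<p. \<Sum>i<n. S' b l * (S' a k * (X i k * X i l)))"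
      by (subst sum.swap, rule sum.cong[OF refl], rule sum.swap)
    also have "\<dots> = (\<Sum>l<p. (\<Sum>k<p. S' a k * gram n p X k l) * S' b l)"
      by (simp add: gram_def sum_distrib_left sum_distrib_right mult_ac)
    also have "\<dots> = (\<Sum>l<p. R a l * S' l b)"
      using SG by (intro sum.cong) (auto simp: S S'_def mat_fun_sym[of p Q _ b])
    also have "\<dots> = mat_fun p Q (\<lambda>k. sqrt (d k) * (1 / sqrt (d k))) a b"
      unfolding R_def S'_def S by (rule mat_fun_mult[OF Q])
    also have "\<dots> = mat_fun p Q (\<lambda>k. 1) a b"
      unfolding mat_fun_def using one by (intro sum.cong) auto
    finally show "(\<Sum>i<n. W a i * W b i) = (if a = b then 1 else 0)"
      using ab by (simp add: mat_fun_const[OF Q])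
  next
    fix e and j assume j: "j < p"
    have "(\<Sum>k<p. S' j k * (\<Sum>i<n. X i k * (\<Sum>l<p. X i l * \<beta> l))) =
        (\<Sum>k<p. \<Sum>i<n. \<Sum>l<p. S' j k * (X i k * X i l) * \<beta> l)"
      by (simp add: sum_distrib_left mult_ac)
    also have "\<dots> = (\<Sum>k<p. \<Sum>l<p. S' j k * gram n p X k l * \<beta> l)"
      by (rule sum.cong[OF refl], subst sum.swap) (simp add: gram_def sum_distrib_left sum_distrib_right mult_ac)
    also have "\<dots> = (\<Sum>l<p. (\<Sum>k<p. S' j k * gram n p X k l) * \<beta> l)"
      by (subst sum.swap) (simp add: sum_distrib_right)
    also have "\<dots> = \<mu> j" using SG by (simp add: \<mu>_def)
    finally have 1: "(\<Sum>k<p. S' j k * (\<Sum>i<n. X i k * (\<Sum>l<p. X i l * \<beta> l))) = \<mu> j" .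
    have 2: "(\<Sum>k<p. S' j k * (\<Sum>i<n. X i k * e i)) = (\<Sum>i<n. W j i * e i)"
      by (simp add: W_def sum_distrib_left sum_distrib_right mult.assoc) (rule sum.swap)
    show "zvec n p (\<lambda>i. (\<Sum>k<p. X i k * \<beta> k) + e i) X j = \<mu> j + (\<Sum>i<n. W j i * e i)"
      unfolding 1[symmetric] 2[symmetric] zvec_def S'_def[symmetric]
      by (simp add: distrib_left sum.distrib)
  next
    have 1: "(\<Sum>j<p. (\<mu> j - sqrt (real n) * \<beta> j)\<^sup>2) =
       (\<Sum>j<p. (\<Sum>l<p. mat_fun p Q (\<lambda>k. sqrt (d k) - sqrt (real n)) j l * \<beta> l)\<^sup>2)"
    proof (intro sum.cong refl arg_cong[where f = "\<lambda>x. x\<^sup>2"])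
      fix j assume "j \<in> {..<p}"
      hence "(\<Sum>l<p. mat_fun p Q (\<lambda>k. sqrt (d k) - sqrt (real n)) j l * \<beta> l) =
          (\<Sum>l<p. R j l * \<beta> l - (if j = l then sqrt (real n) * \<beta> l else 0))"
        by (intro sum.cong) (auto simp: mat_fun_diff mat_fun_const[OF Q] R_def left_diff_distrib)
      also have "\<dots> = \<mu> j - sqrt (real n) * \<beta> j"
        using \<open>j \<in> _\<close> by (simp add: sum_subtractf \<mu>_def)
      finally show "\<mu> j - sqrt (real n) * \<beta> j = (\<Sum>l<p. mat_fun p Q (\<lambda>k. sqrt (d k) - sqrt (real n)) j l * \<beta> l)" ..
    qed
    have 2: "(\<Sum>j<p. (\<Sum>l<p. (gram n p X j l - (if j = l then real n else 0)) * \<beta> l)\<^sup>2) =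
       (\<Sum>j<p. (\<Sum>l<p. mat_fun p Q (\<lambda>k. d k - real n) j l * \<beta> l)\<^sup>2)"
      by (intro sum.cong refl arg_cong[where f = "\<lambda>x. x\<^sup>2"])
         (auto simp: mat_fun_diff mat_fun_const[OF Q] GQ)
    have le: "(sqrt (d k) - sqrt (real n))\<^sup>2 \<le> (d k - real n)\<^sup>2 / real n" if "k < p" for k
    proof -
      have "(d k - real n)\<^sup>2 = ((sqrt (d k) - sqrt (real n)) * (sqrt (d k) + sqrt (real n)))\<^sup>2"
        using d[OF that] by (simp add: algebra_simps)
      also have "\<dots> = (sqrt (d k) - sqrt (real n))\<^sup>2 * (sqrt (d k) + sqrt (real n))\<^sup>2"
        by (rule power_mult_distrib)
      also have "\<dots> \<ge> (sqrt (d k) - sqrt (real n))\<^sup>2 * (sqrt (real n))\<^sup>2"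
        using d[OF that] by (intro mult_left_mono power_mono) auto
      finally show ?thesis using n by (simp add: field_simps)
    qed
    show "(\<Sum>j<p. (\<mu> j - sqrt (real n) * \<beta> j)\<^sup>2) \<le>
       (\<Sum>j<p. (\<Sum>l<p. (gram n p X j l - (if j = l then real n else 0)) * \<beta> l)\<^sup>2) / real n"
      unfolding 1 2 mat_fun_norm[OF Q] sum_divide_distrib
    proof (rule sum_mono)
      fix k assume "k \<in> {..<p}"
      thus "(sqrt (d k) - sqrt (real n))\<^sup>2 * (\<Sum>l<p. Q l k * \<beta> l)\<^sup>2
         \<le> (d k - real n)\<^sup>2 * (\<Sum>l<p. Q l k * \<beta> l)\<^sup>2 / real n"
        using mult_right_mono[OF le[of k], of "(\<Sum>l<p. Q l k * \<beta> l)\<^sup>2"] by simp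
    qed
  qed
qed

section \<open>Rotation invariance of Gaussian noise\<close>

definition std_gaussian :: "real measure" where
  "std_gaussian = density lborel std_normal_density"

lemma sets_std_gaussian [measurable_cong, simp]: "sets std_gaussian = sets borel"
  by (simp add: std_gaussian_def)

lemma space_std_gaussian [simp]: "space std_gaussian = UNIV"
  by (simp add: std_gaussian_def)

lemma prob_space_std_gaussian: "prob_space std_gaussian"
  unfolding std_gaussian_def by (rule prob_space_normal_density) simp

lemma noise_eq: "noise n = PiM {..<n} (\<lambda>_. std_gaussian)"
  by (simp add: noise_def std_gaussian_def)

lemma sets_noise [measurable_cong, simp]: "sets (noise n) = sets (vec_space n)"
  unfolding noise_eq vec_space_def by (intro sets_PiM_cong) auto

lemma space_noise: "space (noise n) = space (vec_space n)"
  by (rule sets_eq_imp_space_eq) simp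

lemma prob_space_noise: "prob_space (noise n)"
  unfolding noise_eq by (intro prob_space_PiM prob_space_std_gaussian)

lemma measurable_vec_component [measurable]: "i < n \<Longrightarrow> (\<lambda>x. x i) \<in> borel_measurable (vec_space n)"
  unfolding vec_space_def by measurable

lemma nn_integral_std_gaussian:
  assumes [measurable]: "f \<in> borel_measurable borel"
  shows "(\<integral>\<^sup>+x. f x \<partial>std_gaussian) = (\<integral>\<^sup>+x. ennreal (std_normal_density x) * f x \<partial>lborel)"
  unfolding std_gaussian_def by (subst nn_integral_density) auto

lemma nn_integral_shear_snd:
  fixes f :: "real \<times> real \<Rightarrow> ennreal"
  assumes [measurable]: "f \<in> borel_measurable (borel \<Otimes>\<^sub>M borel)"
  shows "(\<integral>\<^sup>+x. \<integral>\<^sup>+y. f (x, y + a * x) \<partial>lborel \<partial>lborel) = (\<integral>\<^sup>+x. \<integral>\<^sup>+y. f (x, y) \<partial>lborel \<partial>lborel)"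
proof (rule nn_integral_cong)
  fix x :: real
  show "(\<integral>\<^sup>+y. f (x, y + a * x) \<partial>lborel) = (\<integral>\<^sup>+y. f (x, y) \<partial>lborel)"
    using nn_integral_real_affine[of "\<lambda>y. f (x, y)" 1 "a * x"] by (simp add: add.commute)
qed

lemma nn_integral_shear_fst:
  fixes f :: "real \<times> real \<Rightarrow> ennreal"
  assumes [measurable]: "f \<in> borel_measurable (borel \<Otimes>\<^sub>M borel)"
  shows "(\<integral>\<^sup>+x. \<integral>\<^sup>+y. f (x + a * y, y) \<partial>lborel \<partial>lborel) = (\<integral>\<^sup>+x. \<integral>\<^sup>+y. f (x, y) \<partial>lborel \<partial>lborel)"
proof -
  have "(\<integral>\<^sup>+x. \<integral>\<^sup>+y. f (x + a * y, y) \<partial>lborel \<partial>lborel) = (\<integral>\<^sup>+y. \<integral>\<^sup>+x. f (x + a * y, y) \<partial>lborel \<partial>lborel)"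
    by (rule lborel_pair.Fubini') simp
  also have "\<dots> = (\<integral>\<^sup>+y. \<integral>\<^sup>+x. f (x, y) \<partial>lborel \<partial>lborel)"
    using nn_integral_shear_snd[of "\<lambda>(x, y). f (y, x)" a] by simp
  also have "\<dots> = (\<integral>\<^sup>+x. \<integral>\<^sup>+y. f (x, y) \<partial>lborel \<partial>lborel)"
    by (rule lborel_pair.Fubini'[symmetric]) simp
  finally show ?thesis .
qed

text \<open>A planar rotation by an angle other than $\pi$ is a composition of three shears.\<close>

lemma nn_integral_lborel_rotation:
  fixes f :: "real \<times> real \<Rightarrow> ennreal"
  assumes [measurable]: "f \<in> borel_measurable (borel \<Otimes>\<^sub>M borel)"
    and cs: "c\<^sup>2 + s\<^sup>2 = (1::real)" "c \<noteq> -1"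
  shows "(\<integral>\<^sup>+x. \<integral>\<^sup>+y. f (c * x - s * y, s * x + c * y) \<partial>lborel \<partial>lborel) = (\<integral>\<^sup>+x. \<integral>\<^sup>+y. f (x, y) \<partial>lborel \<partial>lborel)"
proof -
  \<comment> \<open>With c = cos \<theta> and s = sin \<theta> this is - tan (\<theta>/2); the
    rotation factors into shears with parameters a, s, a. The half-angle tangent is what excludes c
    = -1.\<close>
  define a where "a = - s / (1 + c)"
  have ac: "a * (1 + c) = - s" using cs(2) by (simp add: a_def)
  have "(1 + s * a) * (1 + c) = (1 + c) + s * (a * (1 + c))" by (simp add: algebra_simps)
  also have "\<dots> = (1 + c) - s\<^sup>2" unfolding ac by (simp add: power2_eq_square)
  also have "\<dots> = c * (1 + c)" using cs(1) by (simp add: algebra_simps power2_eq_square)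
  finally have sa: "1 + s * a = c" using cs(2) by simp
  have 1: "(x + a * y) + a * (y + s * (x + a * y)) = c * x - s * y" for x y
  proof -
    have "(x + a * y) + a * (y + s * (x + a * y)) = (1 + s * a) * x + (a * (1 + (1 + s * a))) * y"
      by (simp add: algebra_simps)
    also have "a * (1 + (1 + s * a)) = - s" unfolding sa by (rule ac)
    finally show ?thesis unfolding sa by simp
  qed
  have 2: "y + s * (x + a * y) = s * x + c * y" for x y
    using arg_cong[OF sa, of "\<lambda>t. t * y"] by (simp add: algebra_simps)
  have "(\<integral>\<^sup>+x. \<integral>\<^sup>+y. f (x, y) \<partial>lborel \<partial>lborel) = (\<integral>\<^sup>+x. \<integral>\<^sup>+y. f (x + a * y, y) \<partial>lborel \<partial>lborel)"
    using nn_integral_shear_fst[of f a] by simp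
  also have "\<dots> = (\<integral>\<^sup>+x. \<integral>\<^sup>+y. f (x + a * (y + s * x), y + s * x) \<partial>lborel \<partial>lborel)"
    using nn_integral_shear_snd[of "\<lambda>(x, y). f (x + a * y, y)" s] by simp
  also have "\<dots> = (\<integral>\<^sup>+x. \<integral>\<^sup>+y. f ((x + a * y) + a * (y + s * (x + a * y)), y + s * (x + a * y)) \<partial>lborel \<partial>lborel)"
    using nn_integral_shear_fst[of "\<lambda>(x, y). f (x + a * (y + s * x), y + s * x)" a] by simp
  finally show ?thesis unfolding 1 unfolding 2 ..
qed

lemma nn_integral_gaussian_rotation:
  fixes f :: "real \<times> real \<Rightarrow> ennreal"
  assumes [measurable]: "f \<in> borel_measurable (borel \<Otimes>\<^sub>M borel)"
    and cs: "c\<^sup>2 + s\<^sup>2 = (1::real)" "c \<noteq> -1"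
  shows "(\<integral>\<^sup>+x. \<integral>\<^sup>+y. f (c * x - s * y, s * x + c * y) \<partial>std_gaussian \<partial>std_gaussian) =
    (\<integral>\<^sup>+x. \<integral>\<^sup>+y. f (x, y) \<partial>std_gaussian \<partial>std_gaussian)"
proof -
  define h where "h = (\<lambda>(x, y). ennreal (std_normal_density x * std_normal_density y) * f (x, y))"
  have [measurable]: "h \<in> borel_measurable (borel \<Otimes>\<^sub>M borel)" unfolding h_def by measurable
  have dens: "std_normal_density (c * x - s * y) * std_normal_density (s * x + c * y) =
     std_normal_density x * std_normal_density y" for x y
  proof -
    have "(c * x - s * y)\<^sup>2 + (s * x + c * y)\<^sup>2 = (c\<^sup>2 + s\<^sup>2) * (x\<^sup>2 + y\<^sup>2)"
      by (simp add: algebra_simps power2_eq_square)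
    hence "exp (- (c * x - s * y)\<^sup>2 / 2) * exp (- (s * x + c * y)\<^sup>2 / 2) = exp (- x\<^sup>2 / 2) * exp (- y\<^sup>2 / 2)"
      using cs(1) by (simp add: exp_add[symmetric] field_simps)
    thus ?thesis by (simp add: std_normal_density_def)
  qed
  have two: "(\<integral>\<^sup>+x. \<integral>\<^sup>+y. g (x, y) \<partial>std_gaussian \<partial>std_gaussian) =
     (\<integral>\<^sup>+x. \<integral>\<^sup>+y. ennreal (std_normal_density x * std_normal_density y) * g (x, y) \<partial>lborel \<partial>lborel)"
    if [measurable]: "g \<in> borel_measurable (borel \<Otimes>\<^sub>M borel)" for g
    by (simp add: nn_integral_std_gaussian nn_integral_cmult[symmetric] ennreal_mult mult.assoc)
  have "(\<integral>\<^sup>+x. \<integral>\<^sup>+y. f (c * x - s * y, s * x + c * y) \<partial>std_gaussian \<partial>std_gaussian) =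
     (\<integral>\<^sup>+x. \<integral>\<^sup>+y. h (c * x - s * y, s * x + c * y) \<partial>lborel \<partial>lborel)"
    using two[of "\<lambda>(x, y). f (c * x - s * y, s * x + c * y)"] by (simp add: h_def dens)
  also have "\<dots> = (\<integral>\<^sup>+x. \<integral>\<^sup>+y. h (x, y) \<partial>lborel \<partial>lborel)"
    by (rule nn_integral_lborel_rotation) (use cs in auto)
  also have "\<dots> = (\<integral>\<^sup>+x. \<integral>\<^sup>+y. f (x, y) \<partial>std_gaussian \<partial>std_gaussian)"
    using two[of f] by (simp add: h_def)
  finally show ?thesis .
qed

lemma nn_integral_gaussian_uminus:
  assumes [measurable]: "f \<in> borel_measurable borel"
  shows "(\<integral>\<^sup>+x. f (- x) \<partial>std_gaussian) = (\<integral>\<^sup>+x. f x \<partial>std_gaussian)"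
  using nn_integral_real_affine[of "\<lambda>x. ennreal (std_normal_density x) * f x" "-1" 0]
  by (simp add: nn_integral_std_gaussian std_normal_density_def)

definition plane_rotation :: "nat \<Rightarrow> nat \<Rightarrow> real \<Rightarrow> real \<Rightarrow> rvec \<Rightarrow> rvec" where
  "plane_rotation k j c s e = e(k := c * e k - s * e j, j := s * e k + c * e j)"

lemma measurable_fun_upd_noise [measurable (raw)]:
  assumes "f \<in> borel_measurable N" "g \<in> measurable N (vec_space n)" "k < n"
  shows "(\<lambda>x. (g x)(k := f x)) \<in> measurable N (vec_space n)"
  using assms unfolding vec_space_def by (intro measurable_fun_upd[where J = "{..<n}"]) auto

lemma measurable_plane_rotation:
  assumes [measurable]: "k < n" "j < n"
  shows "plane_rotation k j c s \<in> measurable (vec_space n) (vec_space n)"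
  unfolding plane_rotation_def by measurable

lemma nn_integral_noise_plane_rotation:
  assumes F[measurable]: "F \<in> borel_measurable (vec_space n)" and kj: "k < n" "j < n" "k \<noteq> j"
    and cs: "c\<^sup>2 + s\<^sup>2 = (1::real)" "c \<noteq> -1"
  shows "(\<integral>\<^sup>+e. F (plane_rotation k j c s e) \<partial>noise n) = (\<integral>\<^sup>+e. F e \<partial>noise n)"
proof -
  interpret G: prob_space std_gaussian by (rule prob_space_std_gaussian)
  interpret product_sigma_finite "\<lambda>_::nat. std_gaussian" ..
  define I where "I = {..<n} - {k, j}"
  have n: "{..<n} = insert k (insert j I)" and I: "finite I" "k \<notin> insert j I" "j \<notin> I" "finite (insert j I)"
    using kj by (auto simp: I_def)
  have sets: "sets (vec_space n) = sets (PiM (insert k (insert j I)) (\<lambda>_. std_gaussian))"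
    unfolding vec_space_def n by (intro sets_PiM_cong) auto
  have split: "(\<integral>\<^sup>+e. H e \<partial>noise n) = (\<integral>\<^sup>+x. \<integral>\<^sup>+v. \<integral>\<^sup>+u. H (x(j := v, k := u)) \<partial>std_gaussian \<partial>std_gaussian \<partial>PiM I (\<lambda>_. std_gaussian))"
    if "H \<in> borel_measurable (vec_space n)" for H
  proof -
    have [measurable]: "H \<in> borel_measurable (PiM (insert k (insert j I)) (\<lambda>_. std_gaussian))"
      using that measurable_cong_sets[OF sets refl] by blast
    have "(\<integral>\<^sup>+e. H e \<partial>noise n) = (\<integral>\<^sup>+x. \<integral>\<^sup>+u. H (x(k := u)) \<partial>std_gaussian \<partial>PiM (insert j I) (\<lambda>_. std_gaussian))"
      unfolding noise_eq n by (rule product_nn_integral_insert) (use I in auto)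
    also have "\<dots> = (\<integral>\<^sup>+x. \<integral>\<^sup>+v. \<integral>\<^sup>+u. H (x(j := v, k := u)) \<partial>std_gaussian \<partial>std_gaussian \<partial>PiM I (\<lambda>_. std_gaussian))"
      by (rule product_nn_integral_insert) (use I in auto)
    finally show ?thesis .
  qed
  have "(\<integral>\<^sup>+v. \<integral>\<^sup>+u. F (plane_rotation k j c s (x(j := v, k := u))) \<partial>std_gaussian \<partial>std_gaussian) =
        (\<integral>\<^sup>+v. \<integral>\<^sup>+u. F (x(j := v, k := u)) \<partial>std_gaussian \<partial>std_gaussian)" if x: "x \<in> space (PiM I (\<lambda>_. std_gaussian))" for x
  proof -
    have "(\<lambda>(v, u). x(j := v, k := u)) \<in> measurable (borel \<Otimes>\<^sub>M borel) (PiM (insert k (insert j I)) (\<lambda>_. std_gaussian))"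
      using x by measurable
    hence [measurable]: "(\<lambda>(v, u). x(j := v, k := u)) \<in> measurable (borel \<Otimes>\<^sub>M borel) (vec_space n)"
      using measurable_cong_sets[OF refl sets] by blast
    have "(\<lambda>(v, u). F (x(j := v, k := u))) = (\<lambda>w. F ((\<lambda>(v, u). x(j := v, k := u)) w))"
      by auto
    also have "\<dots> \<in> borel_measurable (borel \<Otimes>\<^sub>M borel)" by measurable
    \<comment> \<open>The outer variable \<open>v\<close> is coordinate \<open>j\<close> and the
      inner \<open>u\<close> is coordinate \<open>k\<close>. In this order of integration the
      rotation appears with \<open>- s\<close> in place of \<open>s\<close>.\<close>
    finally have "(\<integral>\<^sup>+v. \<integral>\<^sup>+u. F (x(j := c * v - (- s) * u, k := (- s) * v + c * u)) \<partial>std_gaussian \<partial>std_gaussian) =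
        (\<integral>\<^sup>+v. \<integral>\<^sup>+u. F (x(j := v, k := u)) \<partial>std_gaussian \<partial>std_gaussian)"
      using nn_integral_gaussian_rotation[of "\<lambda>(v, u). F (x(j := v, k := u))" c "- s"] cs by simp
    moreover have "plane_rotation k j c s (x(j := v, k := u)) = x(j := c * v - (- s) * u, k := (- s) * v + c * u)" for u v
      using kj by (auto simp: plane_rotation_def)
    ultimately show ?thesis by simp
  qed
  thus ?thesis
    by (subst (1 2) split)
       (use kj in \<open>auto intro: measurable_compose[OF measurable_plane_rotation F] cong: nn_integral_cong\<close>)
qed

lemma nn_integral_noise_reflection:
  assumes F[measurable]: "F \<in> borel_measurable (vec_space n)" and k: "k < n"
  shows "(\<integral>\<^sup>+e. F (e(k := - e k)) \<partial>noise n) = (\<integral>\<^sup>+e. F e \<partial>noise n)"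
proof -
  interpret G: prob_space std_gaussian by (rule prob_space_std_gaussian)
  interpret product_sigma_finite "\<lambda>_::nat. std_gaussian" ..
  define I where "I = {..<n} - {k}"
  have n: "{..<n} = insert k I" and I: "finite I" "k \<notin> I"
    using k by (auto simp: I_def)
  have sets: "sets (vec_space n) = sets (PiM (insert k I) (\<lambda>_. std_gaussian))"
    unfolding vec_space_def n by (intro sets_PiM_cong) auto
  have split: "(\<integral>\<^sup>+e. H e \<partial>noise n) = (\<integral>\<^sup>+x. \<integral>\<^sup>+u. H (x(k := u)) \<partial>std_gaussian \<partial>PiM I (\<lambda>_. std_gaussian))"
    if "H \<in> borel_measurable (vec_space n)" for H
  proof -
    have [measurable]: "H \<in> borel_measurable (PiM (insert k I) (\<lambda>_. std_gaussian))"
      using that measurable_cong_sets[OF sets refl] by blast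
    show ?thesis
      unfolding noise_eq n by (rule product_nn_integral_insert) (use I in auto)
  qed
  have "(\<integral>\<^sup>+u. F (x(k := - u)) \<partial>std_gaussian) = (\<integral>\<^sup>+u. F (x(k := u)) \<partial>std_gaussian)"
    if x: "x \<in> space (PiM I (\<lambda>_. std_gaussian))" for x
  proof -
    have "(\<lambda>u. x(k := u)) \<in> measurable borel (PiM (insert k I) (\<lambda>_. std_gaussian))"
      using x by measurable
    hence [measurable]: "(\<lambda>u. x(k := u)) \<in> measurable borel (vec_space n)"
      using measurable_cong_sets[OF refl sets] by blast
    show ?thesis by (rule nn_integral_gaussian_uminus[of "\<lambda>u. F (x(k := u))"]) measurable
  qed
  moreover have "(\<lambda>e. F (e(k := - e k))) \<in> borel_measurable (vec_space n)"
    using k by measurable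
  ultimately show ?thesis
    by (subst (1 2) split) (auto cong: nn_integral_cong)
qed

section \<open>Gaussian noise seen through a matrix with orthonormal rows\<close>

definition orthonormal_rows :: "nat \<Rightarrow> nat \<Rightarrow> rmat \<Rightarrow> bool" where
  "orthonormal_rows p n W \<longleftrightarrow> (\<forall>a<p. \<forall>b<p. (\<Sum>i<n. W a i * W b i) = (if a = b then 1 else 0))"

text \<open>The restriction makes the result extensional, hence a point of the product space
  \<open>vec_space p\<close>.\<close>

definition row_map :: "nat \<Rightarrow> nat \<Rightarrow> rmat \<Rightarrow> rvec \<Rightarrow> rvec" where
  "row_map p n W e = (\<lambda>j\<in>{..<p}. \<Sum>i<n. W j i * e i)"

lemma measurable_row_map [measurable]: "row_map p n W \<in> measurable (vec_space n) (vec_space p)"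
proof -
  have "(\<lambda>e. \<lambda>j\<in>{..<p}. \<Sum>i<n. W j i * e i) \<in> measurable (vec_space n) (PiM {..<p} (\<lambda>_. borel))"
    by (intro measurable_restrict) measurable
  thus ?thesis by (simp add: row_map_def[abs_def] vec_space_def)
qed

lemma sum_two_terms:
  fixes g :: "nat \<Rightarrow> real"
  assumes "k < n" "j < n" "k \<noteq> j"
  shows "(\<Sum>i<n. g i) = g k + g j + (\<Sum>i\<in>{..<n} - {k, j}. g i)"
proof -
  have "(\<Sum>i<n. g i) = g k + (\<Sum>i\<in>{..<n} - {k}. g i)" using assms by (intro sum.remove) auto
  also have "(\<Sum>i\<in>{..<n} - {k}. g i) = g j + (\<Sum>i\<in>{..<n} - {k} - {j}. g i)" using assms by (intro sum.remove) auto
  also have "{..<n} - {k} - {j} = {..<n} - {k, j}" by auto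
  finally show ?thesis by simp
qed

text \<open>The rotation moved from the noise to the matrix: W (R e) = (W R) e.\<close>

definition rotate_columns :: "nat \<Rightarrow> nat \<Rightarrow> real \<Rightarrow> real \<Rightarrow> rmat \<Rightarrow> rmat" where
  "rotate_columns k j c s W = (\<lambda>a. (W a)(k := c * W a k + s * W a j, j := c * W a j - s * W a k))"

lemma row_map_plane_rotation:
  assumes "k < n" "j < n" "k \<noteq> j"
  shows "row_map p n W (plane_rotation k j c s e) = row_map p n (rotate_columns k j c s W) e"
proof -
  have "(\<Sum>i<n. W a i * plane_rotation k j c s e i) = (\<Sum>i<n. rotate_columns k j c s W a i * e i)" for a
    unfolding sum_two_terms[OF assms]
    using assms by (simp add: plane_rotation_def rotate_columns_def algebra_simps)
  thus ?thesis by (simp add: row_map_def)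
qed

lemma orthonormal_rows_rotate:
  assumes "k < n" "j < n" "k \<noteq> j" "c\<^sup>2 + s\<^sup>2 = (1::real)" "orthonormal_rows p n W"
  shows "orthonormal_rows p n (rotate_columns k j c s W)"
proof -
  have "(\<Sum>i<n. rotate_columns k j c s W a i * rotate_columns k j c s W b i) = (\<Sum>i<n. W a i * W b i)" for a b
  proof -
    have "(c * W a k + s * W a j) * (c * W b k + s * W b j) + (c * W a j - s * W a k) * (c * W b j - s * W b k) =
       (c\<^sup>2 + s\<^sup>2) * (W a k * W b k + W a j * W b j)"
      by (simp add: algebra_simps power2_eq_square)
    thus ?thesis unfolding sum_two_terms[OF assms(1-3)]
      using assms(3,4) by (simp add: rotate_columns_def)
  qed
  thus ?thesis using assms(5) by (simp add: orthonormal_rows_def)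
qed

text \<open>Givens elimination: rotations and sign changes of the columns, which preserve the noise
  distribution, bring $W$ to the form $[I_p\; 0]$; \<open>k\<close> counts the rows already in this form.\<close>

lemma nn_integral_row_map_aux:
  assumes F[measurable]: "F \<in> borel_measurable (vec_space p)"
    and "k \<le> p" "orthonormal_rows p n W" "\<And>a i. a < k \<Longrightarrow> i < n \<Longrightarrow> W a i = (if i = a then 1 else 0)"
  shows "(\<integral>\<^sup>+e. F (row_map p n W e) \<partial>noise n) = (\<integral>\<^sup>+e. F e \<partial>noise p)"
  using assms(2-4)
proof (induction k arbitrary: W rule: inc_induct)
  case base
  \<comment> \<open>Otherwise the row with index n would vanish in all n columns, against its unit
    norm.\<close>
  have pn: "p \<le> n"
  proof (rule ccontr)
    assume "\<not> p \<le> n"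
    hence "(\<Sum>i<n. W n i * W n i) = 1" using base(1) by (simp add: orthonormal_rows_def)
    moreover have "W n i = 0" if "i < n" for i using base(2)[of n i] \<open>\<not> p \<le> n\<close> that by simp
    ultimately show False by simp
  qed
  have rm: "row_map p n W e = restrict e {..<p}" for e
  proof
    fix j
    have "(\<Sum>i<n. W j i * e i) = (\<Sum>i<n. if i = j then e i else 0)" if "j < p"
      using base(2)[OF that] by (intro sum.cong) auto
    thus "row_map p n W e j = restrict e {..<p} j" using pn by (auto simp: row_map_def)
  qed
  interpret G: prob_space std_gaussian by (rule prob_space_std_gaussian)
  interpret product_prob_space "\<lambda>_::nat. std_gaussian" "{..<n}" ..
  have "noise p = distr (noise n) (noise p) (\<lambda>e. restrict e {..<p})"
    unfolding noise_eq by (rule distr_restrict) (use pn in auto)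
  hence "(\<integral>\<^sup>+e. F e \<partial>noise p) = (\<integral>\<^sup>+e. F e \<partial>distr (noise n) (noise p) (\<lambda>e. restrict e {..<p}))"
    by simp
  also have "\<dots> = (\<integral>\<^sup>+e. F (restrict e {..<p}) \<partial>noise n)"
  proof (rule nn_integral_distr)
    show "(\<lambda>e. restrict e {..<p}) \<in> measurable (noise n) (noise p)"
      unfolding noise_eq by (rule measurable_restrict_subset) (use pn in auto)
  qed (use F in \<open>simp add: measurable_cong_sets[OF sets_noise refl]\<close>)
  finally show ?case by (simp only: rm)
next
  case (step k)
  \<comment> \<open>Row \<open>k\<close> is orthogonal to the earlier rows, which are already basis
    vectors, so its entries in those columns are 0.\<close>
  have low: "V k b = 0" if V: "orthonormal_rows p n V" "\<And>a i. a < k \<Longrightarrow> i < n \<Longrightarrow> V a i = (if i = a then 1 else 0)"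
    and b: "b < k" "b < n" for V b
  proof -
    have "(\<Sum>i<n. V k i * V b i) = 0" using V(1) b step.hyps by (auto simp: orthonormal_rows_def)
    moreover have "(\<Sum>i<n. V k i * V b i) = (\<Sum>i<n. if i = b then V k i else 0)"
      using V(2)[OF b(1)] by (intro sum.cong) auto
    ultimately show ?thesis using b by simp
  qed
  show ?case using step.prems
  \<comment> \<open>Inner induction on the number of nonzero entries of row \<open>k\<close> to the
    right of the diagonal; each rotation clears one of them and creates none.\<close>
  proof (induction "card {i. k < i \<and> i < n \<and> W k i \<noteq> 0}" arbitrary: W rule: less_induct)
    case less
    have kn: "k < n"
    proof (rule ccontr)
      assume "\<not> k < n"
      hence "W k i = 0" if "i < n" for i using low[OF less.prems, of i] that by simp
      moreover have "(\<Sum>i<n. W k i * W k i) = 1" using less.prems(1) step.hyps by (simp add: orthonormal_rows_def)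
      ultimately show False by simp
    qed
    show ?case
    proof (cases "\<exists>i. k < i \<and> i < n \<and> W k i \<noteq> 0")
      case True
      then obtain j where j: "k < j" "j < n" "W k j \<noteq> 0" by blast
      define r where "r = sqrt ((W k k)\<^sup>2 + (W k j)\<^sup>2)"
      have r: "r > 0" "r\<^sup>2 = (W k k)\<^sup>2 + (W k j)\<^sup>2"
        using j(3) by (auto simp: r_def sum_power2_gt_zero_iff)
      define c s where "c = W k k / r" and "s = W k j / r"
      have cs: "c\<^sup>2 + s\<^sup>2 = 1"
        unfolding c_def s_def power_divide add_divide_distrib[symmetric] r(2)[symmetric] using r(1) by simp
      \<comment> \<open>The half turn is the one rotation not covered; it cannot occur since the
        entry being cleared makes s nonzero.\<close>
      have "c \<noteq> -1"
      proof
        assume "c = -1"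
        hence "s = 0" using cs by simp
        thus False using j(3) r(1) by (simp add: s_def)
      qed
      let ?W = "rotate_columns k j c s W"
      have kj: "k < n" "j < n" "k \<noteq> j" using kn j by auto
      have "(\<integral>\<^sup>+e. F (row_map p n W e) \<partial>noise n) = (\<integral>\<^sup>+e. F (row_map p n W (plane_rotation k j c s e)) \<partial>noise n)"
        by (rule nn_integral_noise_plane_rotation[symmetric, where F = "\<lambda>e. F (row_map p n W e)"])
           (use kj cs \<open>c \<noteq> -1\<close> in measurable)
      also have "\<dots> = (\<integral>\<^sup>+e. F (row_map p n ?W e) \<partial>noise n)"
        by (simp add: row_map_plane_rotation[OF kj])
      also have "\<dots> = (\<integral>\<^sup>+e. F e \<partial>noise p)"
      proof (rule less.hyps)
        show "orthonormal_rows p n ?W" by (rule orthonormal_rows_rotate[OF kj cs less.prems(1)])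
        show "?W a i = (if i = a then 1 else 0)" if "a < k" "i < n" for a i
          using that less.prems(2)[OF that(1)] kj j(1) by (auto simp: rotate_columns_def)
        have "?W k j = 0" using r(1) kj by (simp add: rotate_columns_def c_def s_def)
        hence "{i. k < i \<and> i < n \<and> ?W k i \<noteq> 0} \<subseteq> {i. k < i \<and> i < n \<and> W k i \<noteq> 0} - {j}"
          by (auto simp: rotate_columns_def split: if_splits)
        also have "\<dots> \<subset> {i. k < i \<and> i < n \<and> W k i \<noteq> 0}" using j by auto
        finally show "card {i. k < i \<and> i < n \<and> ?W k i \<noteq> 0} < card {i. k < i \<and> i < n \<and> W k i \<noteq> 0}"
          by (intro psubset_card_mono) auto
      qed
      finally show ?thesis .
    next
      case False
      have z: "W k i = 0" if "i < n" "i \<noteq> k" for i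
        using low[OF less.prems, of i] False that by (cases "i < k") auto
      have "(\<Sum>i<n. W k i * W k i) = (\<Sum>i<n. if i = k then W k k * W k k else 0)"
        using z by (intro sum.cong) auto
      hence "W k k * W k k = 1" using less.prems(1) step.hyps kn by (simp add: orthonormal_rows_def)
      \<comment> \<open>Row \<open>k\<close> is now plus or minus a basis vector. The negative sign
        is removed by reflecting one noise coordinate.\<close>
      hence "W k k = 1 \<or> W k k = -1" by (metis mult.commute square_eq_1_iff)
      thus ?thesis
      proof
        assume "W k k = 1"
        thus ?thesis using z less.prems by (intro step.IH) (auto simp: less_Suc_eq)
      next
        assume m: "W k k = -1"
        let ?W = "\<lambda>a. (W a)(k := - W a k)"
        have rm: "row_map p n W (e(k := - e k)) = row_map p n ?W e" for e
        proof -
          have "(\<Sum>i<n. W a i * (e(k := - e k)) i) = (\<Sum>i<n. ?W a i * e i)" for a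
            by (intro sum.cong) auto
          thus ?thesis unfolding row_map_def by (simp only:)
        qed
        have "(\<integral>\<^sup>+e. F (row_map p n W e) \<partial>noise n) = (\<integral>\<^sup>+e. F (row_map p n W (e(k := - e k))) \<partial>noise n)"
          by (rule nn_integral_noise_reflection[symmetric, where F = "\<lambda>e. F (row_map p n W e)"])
             (use kn in measurable)
        also have "\<dots> = (\<integral>\<^sup>+e. F (row_map p n ?W e) \<partial>noise n)" by (simp only: rm)
        also have "\<dots> = (\<integral>\<^sup>+e. F e \<partial>noise p)"
        proof (rule step.IH)
          have "(\<Sum>i<n. ?W a i * ?W b i) = (\<Sum>i<n. W a i * W b i)" for a b
            by (intro sum.cong) auto
          thus "orthonormal_rows p n ?W" using less.prems(1) unfolding orthonormal_rows_def by (simp only:)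
          show "?W a i = (if i = a then 1 else 0)" if "a < Suc k" "i < n" for a i
            using that less.prems(2)[of a i] z m by (auto simp: less_Suc_eq)
        qed
        finally show ?thesis .
      qed
    qed
  qed
qed

theorem nn_integral_row_map:
  assumes "F \<in> borel_measurable (vec_space p)" "orthonormal_rows p n W"
  shows "(\<integral>\<^sup>+e. F (row_map p n W e) \<partial>noise n) = (\<integral>\<^sup>+e. F e \<partial>noise p)"
  using nn_integral_row_map_aux[OF assms(1) _ assms(2), of 0] by simp

section \<open>Exceedance probabilities\<close>

lemma emeasure_std_gaussian:
  assumes [measurable]: "A \<in> sets borel"
  shows "emeasure std_gaussian A = (\<integral>\<^sup>+x. ennreal (std_normal_density x) * indicator A x \<partial>lborel)"
  unfolding std_gaussian_def by (rule emeasure_density) auto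

text \<open>The density decreases in |x| and the interval has length 1, so no integral has to be
  evaluated. Used with c = \<tau> + 1 this loses roughly a factor exp (- \<tau>) against the true
  tail, which is invisible on the scale of log p.\<close>

lemma measure_std_gaussian_interval:
  assumes "\<And>x. a < x \<Longrightarrow> x < a + 1 \<Longrightarrow> \<bar>x\<bar> \<le> c"
  shows "std_normal_density c \<le> measure std_gaussian {a<..<a+1}"
proof -
  interpret prob_space std_gaussian by (rule prob_space_std_gaussian)
  have "std_normal_density c \<le> std_normal_density x" if "a < x" "x < a + 1" for x
  proof -
    have "\<bar>x\<bar>\<^sup>2 \<le> c\<^sup>2" using assms[OF that] by (intro power_mono) auto
    thus ?thesis by (simp add: std_normal_density_def divide_right_mono)
  qed
  hence "(\<integral>\<^sup>+x. ennreal (std_normal_density c) * indicator {a<..<a+1} x \<partial>lborel) \<le> emeasure std_gaussian {a<..<a+1}"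
    by (subst emeasure_std_gaussian) (auto intro!: nn_integral_mono simp: indicator_def ennreal_leI)
  hence "ennreal (std_normal_density c) \<le> emeasure std_gaussian {a<..<a+1}"
    by (simp add: nn_integral_cmult)
  thus ?thesis by (simp add: emeasure_eq_measure)
qed

lemma measure_std_gaussian_greaterThan:
  assumes u: "u \<ge> 0"
  shows "measure std_gaussian {u<..} \<le> exp (- u\<^sup>2 / 2)"
proof -
  interpret prob_space std_gaussian by (rule prob_space_std_gaussian)
  have one: "(\<integral>\<^sup>+x. ennreal (std_normal_density x) \<partial>lborel) = 1"
    using emeasure_space_1 by (simp add: emeasure_std_gaussian)
  have "emeasure std_gaussian {u<..} \<le> (\<integral>\<^sup>+x. ennreal (exp (- u\<^sup>2 / 2)) * ennreal (std_normal_density (- u + 1 * x)) \<partial>lborel)"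
  proof (subst emeasure_std_gaussian)
    show "(\<integral>\<^sup>+x. ennreal (std_normal_density x) * indicator {u<..} x \<partial>lborel) \<le>
      (\<integral>\<^sup>+x. ennreal (exp (- u\<^sup>2 / 2)) * ennreal (std_normal_density (- u + 1 * x)) \<partial>lborel)"
    proof (rule nn_integral_mono)
      fix x
      have "std_normal_density x \<le> exp (- u\<^sup>2 / 2) * std_normal_density (- u + 1 * x)" if "u < x"
      proof -
        \<comment> \<open>This yields x^2 \<ge> u^2 + (x - u)^2, so beyond u the density is at most
          exp (- u^2 / 2) times the density shifted by u.\<close>
        have "0 \<le> u * (x - u)" using u that by simp
        hence "- x\<^sup>2 / 2 \<le> - u\<^sup>2 / 2 + (- (x - u)\<^sup>2 / 2)" by (simp add: power2_eq_square algebra_simps)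
        hence "exp (- x\<^sup>2 / 2) \<le> exp (- u\<^sup>2 / 2) * exp (- (x - u)\<^sup>2 / 2)" by (simp add: exp_add[symmetric])
        thus ?thesis by (simp add: std_normal_density_def divide_right_mono)
      qed
      thus "ennreal (std_normal_density x) * indicator {u<..} x \<le>
         ennreal (exp (- u\<^sup>2 / 2)) * ennreal (std_normal_density (- u + 1 * x))"
        by (auto simp: indicator_def ennreal_mult[symmetric] intro!: ennreal_leI)
    qed
  qed simp
  also have "\<dots> = ennreal (exp (- u\<^sup>2 / 2)) * (\<integral>\<^sup>+x. ennreal (std_normal_density (- u + 1 * x)) \<partial>lborel)"
    by (rule nn_integral_cmult) simp
  also have "(\<integral>\<^sup>+x. ennreal (std_normal_density (- u + 1 * x)) \<partial>lborel) = 1"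
    using nn_integral_real_affine[of "\<lambda>x. ennreal (std_normal_density x)" 1 "- u"] one by simp
  finally show ?thesis by (simp add: emeasure_eq_measure)
qed

lemma measure_std_gaussian_abs_greaterThan:
  assumes u: "u \<ge> 0"
  shows "measure std_gaussian {x. \<bar>x\<bar> > u} \<le> 2 * exp (- u\<^sup>2 / 2)"
proof -
  interpret prob_space std_gaussian by (rule prob_space_std_gaussian)
  have "emeasure std_gaussian {..<-u} = (\<integral>\<^sup>+x. indicator {u<..} (- x) \<partial>std_gaussian)"
  proof -
    have "(\<lambda>x. indicator {u<..} (- x) :: ennreal) = indicator {..<-u}"
      by (auto simp: indicator_def fun_eq_iff)
    thus ?thesis by simp
  qed
  also have "\<dots> = emeasure std_gaussian {u<..}"
    by (subst nn_integral_gaussian_uminus) auto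
  finally have "measure std_gaussian {..<-u} = measure std_gaussian {u<..}" by (simp add: measure_def)
  moreover have "measure std_gaussian ({..<-u} \<union> {u<..}) \<le> measure std_gaussian {..<-u} + measure std_gaussian {u<..}"
    by (rule measure_Un_le) auto
  moreover have "{x. \<bar>x\<bar> > u} = {..<-u} \<union> {u<..}" using u by auto
  ultimately show ?thesis using measure_std_gaussian_greaterThan[OF u] by simp
qed

lemma shifted_gaussian_within:
  assumes "\<bar>m\<bar> \<le> 1" "\<tau> \<ge> 1"
  shows "1 - 2 * exp (- (\<tau> - 1)\<^sup>2 / 2) \<le> measure std_gaussian {x. \<bar>m + x\<bar> \<le> \<tau>}"
proof -
  interpret prob_space std_gaussian by (rule prob_space_std_gaussian)
  have "1 - 2 * exp (- (\<tau> - 1)\<^sup>2 / 2) \<le> 1 - measure std_gaussian {x. \<bar>x\<bar> > \<tau> - 1}"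
    using measure_std_gaussian_abs_greaterThan[of "\<tau> - 1"] assms by simp
  also have "\<dots> = measure std_gaussian (space std_gaussian - {x. \<bar>x\<bar> > \<tau> - 1})"
    by (rule prob_compl[symmetric]) simp
  also have "\<dots> \<le> measure std_gaussian {x. \<bar>m + x\<bar> \<le> \<tau>}"
    using assms by (intro finite_measure_mono) auto
  finally show ?thesis .
qed

lemma shifted_gaussian_within_large:
  assumes "\<bar>m\<bar> \<le> \<tau> + b" "\<tau> \<ge> 1" "b \<ge> 0"
  shows "std_normal_density (b + 1) \<le> measure std_gaussian {x. \<bar>m + x\<bar> \<le> \<tau>}"
proof -
  interpret prob_space std_gaussian by (rule prob_space_std_gaussian)
  \<comment> \<open>A unit interval of admissible x close to 0: it ends (for m \<ge> 0) or starts
    (for m < 0) at 0, unless the admissible set misses 0, and then at the endpoint of that set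
    nearest to 0.\<close>
  define a where "a = (if m \<ge> 0 then min 0 (\<tau> - m) - 1 else max 0 (- \<tau> - m))"
  have "std_normal_density (b + 1) \<le> measure std_gaussian {a<..<a+1}"
    by (rule measure_std_gaussian_interval) (use assms in \<open>auto simp: a_def min_def max_def split: if_splits\<close>)
  also have "\<dots> \<le> measure std_gaussian {x. \<bar>m + x\<bar> \<le> \<tau>}"
    by (rule finite_measure_mono) (use assms in \<open>auto simp: a_def min_def max_def split: if_splits\<close>)
  finally show ?thesis .
qed

lemma gaussian_exceed_lower:
  assumes "\<tau> \<ge> 0"
  shows "std_normal_density (\<tau> + 1) \<le> measure std_gaussian {x. \<bar>x\<bar> > \<tau>}"
proof -
  interpret prob_space std_gaussian by (rule prob_space_std_gaussian)
  have "std_normal_density (\<tau> + 1) \<le> measure std_gaussian {\<tau><..<\<tau>+1}"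
    by (rule measure_std_gaussian_interval) (use assms in auto)
  also have "\<dots> \<le> measure std_gaussian {x. \<bar>x\<bar> > \<tau>}" by (rule finite_measure_mono) auto
  finally show ?thesis .
qed

lemma measure_noise_box:
  assumes "\<And>j. j < p \<Longrightarrow> A j \<in> sets borel"
  shows "measure (noise p) (PiE {..<p} A) = (\<Prod>j<p. measure std_gaussian (A j))"
proof -
  interpret G: prob_space std_gaussian by (rule prob_space_std_gaussian)
  interpret product_sigma_finite "\<lambda>_::nat. std_gaussian" ..
  have "emeasure (noise p) (PiE {..<p} A) = (\<Prod>j<p. emeasure std_gaussian (A j))"
    unfolding noise_eq using assms by (intro emeasure_PiM) auto
  also have "\<dots> = ennreal (\<Prod>j<p. measure std_gaussian (A j))"
    by (simp add: G.emeasure_eq_measure prod_ennreal)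
  finally show ?thesis by (simp add: measure_def prod_nonneg)
qed

definition exceed_count :: "nat \<Rightarrow> real \<Rightarrow> rvec \<Rightarrow> rvec \<Rightarrow> real" where
  "exceed_count p \<tau> \<mu> x = real (card {j\<in>{..<p}. \<bar>\<mu> j + x j\<bar> > \<tau>})"

lemma real_card_Collect:
  "real (card {j\<in>{..<p::nat}. P j}) = (\<Sum>j<p. if P j then 1 else 0)"
  by (simp add: sum.If_cases Int_def)

lemma measurable_exceed_count [measurable]:
  "exceed_count p \<tau> \<mu> \<in> borel_measurable (vec_space p)"
  unfolding exceed_count_def[abs_def] real_card_Collect by measurable

text \<open>The events that exactly the coordinates in J exceed, over all J of size k, are disjoint.
  Their union has probability C(p,k) q^k (1 - q)^(p - k), where q is the exceedance probability of
  one coordinate, and C(p,k) \<ge> (p/k)^k. The exponent p - k is relaxed to p so that null and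
  alternative share the same factor.\<close>

lemma null_exceed_lower:
  assumes k: "k \<le> p" and \<tau>: "\<tau> \<ge> 1" and \<delta>: "2 * exp (- (\<tau> - 1)\<^sup>2 / 2) \<le> 1"
  shows "(real p * std_normal_density (\<tau> + 1) / real k) ^ k * (1 - 2 * exp (- (\<tau> - 1)\<^sup>2 / 2)) ^ p
     \<le> measure (noise p) {x\<in>space (noise p). exceed_count p \<tau> (\<lambda>_. 0) x \<ge> real k}"
proof -
  interpret G: prob_space std_gaussian by (rule prob_space_std_gaussian)
  interpret N: prob_space "noise p" by (rule prob_space_noise)
  define q where "q = measure std_gaussian {x. \<bar>x\<bar> > \<tau>}"
  define \<delta> where "\<delta> = 2 * exp (- (\<tau> - 1)\<^sup>2 / 2)"
  define B where "B J = PiE {..<p} (\<lambda>j. if j \<in> J then {x::real. \<bar>x\<bar> > \<tau>} else {x. \<bar>x\<bar> \<le> \<tau>})" for J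
  define JJ where "JJ = {J. J \<subseteq> {..<p} \<and> card J = k}"
  have qc: "measure std_gaussian {x. \<bar>x\<bar> \<le> \<tau>} = 1 - q"
  proof -
    have "{x. \<bar>x\<bar> \<le> \<tau>} = space std_gaussian - {x. \<bar>x\<bar> > \<tau>}" by auto
    thus ?thesis using G.prob_compl[of "{x. \<bar>x\<bar> > \<tau>}"] by (simp add: q_def)
  qed
  have q1: "1 - \<delta> \<le> 1 - q"
    using shifted_gaussian_within[of 0 \<tau>] \<tau> qc by (simp add: \<delta>_def)
  have mB: "measure (noise p) (B J) = q ^ k * (1 - q) ^ (p - k)" if "J \<in> JJ" for J
  proof -
    have J: "J \<subseteq> {..<p}" "card J = k" using that by (auto simp: JJ_def)
    have "measure (noise p) (B J) = (\<Prod>j<p. if j \<in> J then q else 1 - q)"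
      unfolding B_def by (subst measure_noise_box) (auto simp: q_def[symmetric] qc if_distrib intro!: prod.cong)
    also have "\<dots> = (\<Prod>j\<in>{..<p} \<inter> {j. j \<in> J}. q) * (\<Prod>j\<in>{..<p} \<inter> - {j. j \<in> J}. 1 - q)"
      by (rule prod.If_cases) simp
    also have "{..<p} \<inter> {j. j \<in> J} = J" using J by auto
    also have "{..<p} \<inter> - {j. j \<in> J} = {..<p} - J" by auto
    finally show ?thesis using J by (simp add: card_Diff_subset finite_subset[OF J(1)])
  qed
  have sB: "B J \<in> sets (noise p)" for J
  proof -
    have "B J \<in> sets (PiM {..<p} (\<lambda>_. borel))"
      unfolding B_def by (rule sets_PiM_I_finite) auto
    thus ?thesis by (simp add: vec_space_def)
  qed
  have fin: "finite JJ" unfolding JJ_def by (rule finite_subset[of _ "Pow {..<p}"]) auto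
  have disj: "disjoint_family_on B JJ"
    unfolding disjoint_family_on_def
  proof (intro ballI impI)
    fix I J assume IJ: "I \<in> JJ" "J \<in> JJ" "I \<noteq> J"
    then obtain j where j: "j < p" "(j \<in> I) \<noteq> (j \<in> J)" unfolding JJ_def by blast
    show "B I \<inter> B J = {}"
    proof (rule equals0I)
      fix x assume "x \<in> B I \<inter> B J"
      hence "x j \<in> (if j \<in> I then {x::real. \<bar>x\<bar> > \<tau>} else {x. \<bar>x\<bar> \<le> \<tau>})"
        "x j \<in> (if j \<in> J then {x::real. \<bar>x\<bar> > \<tau>} else {x. \<bar>x\<bar> \<le> \<tau>})"
        using j(1) by (auto simp: B_def PiE_iff)
      thus False using j(2) by (auto split: if_splits)
    qed
  qed
  have "std_normal_density (\<tau> + 1) \<le> q" unfolding q_def by (rule gaussian_exceed_lower) (use \<tau> in simp)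
  hence "(real p * std_normal_density (\<tau> + 1) / real k) ^ k * (1 - \<delta>) ^ p \<le> (real p * q / real k) ^ k * (1 - q) ^ (p - k)"
  proof (intro mult_mono power_mono divide_right_mono mult_left_mono)
    have "(1 - \<delta>) ^ p \<le> (1 - \<delta>) ^ (p - k)" using \<delta> by (intro power_decreasing) (auto simp: \<delta>_def)
    also have "\<dots> \<le> (1 - q) ^ (p - k)" using \<delta> q1 by (intro power_mono) (auto simp: \<delta>_def)
    finally show "(1 - \<delta>) ^ p \<le> (1 - q) ^ (p - k)" .
  qed (use \<delta> in \<open>auto simp: \<delta>_def q_def\<close>)
  also have "\<dots> = (real p / real k) ^ k * (q ^ k * (1 - q) ^ (p - k))"
    by (simp add: power_mult_distrib power_divide)
  also have "\<dots> \<le> real (p choose k) * (q ^ k * (1 - q) ^ (p - k))"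
    using binomial_ge_n_over_k_pow_k[OF k, where 'a = real]
    by (intro mult_right_mono) (auto simp: q_def)
  also have "\<dots> = (\<Sum>J\<in>JJ. measure (noise p) (B J))"
    using mB n_subsets[of "{..<p}" k] by (simp add: JJ_def)
  also have "\<dots> = measure (noise p) (\<Union>J\<in>JJ. B J)"
    by (rule N.finite_measure_finite_Union[symmetric]) (use fin sB disj in auto)
  also have "\<dots> \<le> measure (noise p) {x\<in>space (noise p). exceed_count p \<tau> (\<lambda>_. 0) x \<ge> real k}"
  proof (rule N.finite_measure_mono)
    show "(\<Union>J\<in>JJ. B J) \<subseteq> {x\<in>space (noise p). exceed_count p \<tau> (\<lambda>_. 0) x \<ge> real k}"
    proof safe
      fix J x assume J: "J \<in> JJ" and x: "x \<in> B J"
      show "x \<in> space (noise p)" using sB[of J] x sets.sets_into_space by blast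
      have "{j\<in>{..<p}. \<bar>0 + x j\<bar> > \<tau>} = J"
        using x J by (auto simp: B_def PiE_iff JJ_def split: if_splits)
      thus "real k \<le> exceed_count p \<tau> (\<lambda>_. 0) x" using J by (simp add: exceed_count_def JJ_def)
    qed
  qed measurable
  finally show ?thesis by (simp add: \<delta>_def)
qed

text \<open>The event is a box: the first k signal coordinates are free, the other s - k are forced
  below \<tau> at density cost, and the null coordinates stay below \<tau>. The bound on the sum of
  squares limits each mean deviation to 1, which is the 1 in h + 1 \<le> \<tau> + b.\<close>

lemma alternative_exceed_lower:
  assumes ks: "k \<le> s" "s \<le> p" and \<tau>: "\<tau> \<ge> 1" and \<delta>: "2 * exp (- (\<tau> - 1)\<^sup>2 / 2) \<le> 1"
    and \<mu>: "(\<Sum>j<p. (\<mu> j - (if j < s then h else 0))\<^sup>2) \<le> 1" and h: "0 \<le> h" "h + 1 \<le> \<tau> + b" "0 \<le> b"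
  shows "std_normal_density (b + 1) ^ (s - k) * (1 - 2 * exp (- (\<tau> - 1)\<^sup>2 / 2)) ^ p
     \<le> measure (noise p) {x\<in>space (noise p). exceed_count p \<tau> \<mu> x \<le> real k}"
proof -
  interpret G: prob_space std_gaussian by (rule prob_space_std_gaussian)
  interpret N: prob_space "noise p" by (rule prob_space_noise)
  define w where "w = std_normal_density (b + 1)"
  define v where "v = 1 - 2 * exp (- (\<tau> - 1)\<^sup>2 / 2)"
  have v: "0 \<le> v" "v \<le> 1" using \<delta> by (auto simp: v_def)
  have w: "0 \<le> w" by (simp add: w_def)
  define A where "A j = (if j < k then UNIV else {x. \<bar>\<mu> j + x\<bar> \<le> \<tau>})" for j
  have dev: "\<bar>\<mu> j - (if j < s then h else 0)\<bar> \<le> 1" if "j < p" for j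
  proof -
    have "(\<mu> j - (if j < s then h else 0))\<^sup>2 \<le> (\<Sum>j<p. (\<mu> j - (if j < s then h else 0))\<^sup>2)"
      by (rule member_le_sum[of j "{..<p}" "\<lambda>j. (\<mu> j - (if j < s then h else 0))\<^sup>2"]) (use that in auto)
    hence "(\<mu> j - (if j < s then h else 0))\<^sup>2 \<le> 1" using \<mu> by simp
    thus ?thesis by (simp add: abs_square_le_1)
  qed
  have A: "(if j < k then 1 else if j < s then w else v) \<le> measure std_gaussian (A j)" if j: "j < p" for j
  proof -
    consider "j < k" | "k \<le> j" "j < s" | "s \<le> j" by linarith
    thus ?thesis
    proof cases
      case 1
      thus ?thesis using G.prob_space by (simp add: A_def)
    next
      case 2
      have "\<bar>\<mu> j\<bar> \<le> \<tau> + b" using dev[OF j] 2 h by simp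
      thus ?thesis using shifted_gaussian_within_large[of "\<mu> j" \<tau> b] 2 \<tau> h by (simp add: A_def w_def)
    next
      case 3
      thus ?thesis using shifted_gaussian_within[of "\<mu> j" \<tau>] dev[OF j] \<tau> ks by (simp add: A_def v_def)
    qed
  qed
  have "w ^ (s - k) * v ^ p \<le> w ^ (s - k) * v ^ (p - s)"
    using v w by (intro mult_left_mono power_decreasing) auto
  also have "\<dots> = (\<Prod>j\<in>{..<k}. 1) * (\<Prod>j\<in>{k..<s}. w) * (\<Prod>j\<in>{s..<p}. v)" by simp
  also have "\<dots> = (\<Prod>j<p. if j < k then 1 else if j < s then w else v)"
  proof -
    have "{..<p} = {..<k} \<union> {k..<s} \<union> {s..<p}" using ks by auto
    hence "(\<Prod>j<p. if j < k then 1 else if j < s then w else v) =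
      (\<Prod>j\<in>{..<k} \<union> {k..<s} \<union> {s..<p}. if j < k then 1 else if j < s then w else v)" by simp
    also have "\<dots> = (\<Prod>j\<in>{..<k}. if j < k then 1 else if j < s then w else v) *
       (\<Prod>j\<in>{k..<s}. if j < k then 1 else if j < s then w else v) *
       (\<Prod>j\<in>{s..<p}. if j < k then 1 else if j < s then w else v)"
      using ks by (subst prod.union_disjoint, simp, simp, force, subst prod.union_disjoint) auto
    also have "(\<Prod>j\<in>{..<k}. if j < k then 1 else if j < s then w else v) = (\<Prod>j\<in>{..<k}. 1)"
      by (rule prod.cong) auto
    also have "(\<Prod>j\<in>{k..<s}. if j < k then 1 else if j < s then w else v) = (\<Prod>j\<in>{k..<s}. w)"
      by (rule prod.cong) auto
    also have "(\<Prod>j\<in>{s..<p}. if j < k then 1 else if j < s then w else v) = (\<Prod>j\<in>{s..<p}. v)"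
      using ks by (intro prod.cong) auto
    finally show ?thesis ..
  qed
  also have "\<dots> \<le> (\<Prod>j<p. measure std_gaussian (A j))"
    using A v w by (intro prod_mono) auto
  also have "\<dots> = measure (noise p) (PiE {..<p} A)"
    by (rule measure_noise_box[symmetric]) (auto simp: A_def)
  also have "\<dots> \<le> measure (noise p) {x\<in>space (noise p). exceed_count p \<tau> \<mu> x \<le> real k}"
  proof (rule N.finite_measure_mono)
    show "PiE {..<p} A \<subseteq> {x\<in>space (noise p). exceed_count p \<tau> \<mu> x \<le> real k}"
    proof safe
      fix x assume x: "x \<in> PiE {..<p} A"
      show "x \<in> space (noise p)" using x by (auto simp: space_noise vec_space_def space_PiM PiE_iff)
      have "{j\<in>{..<p}. \<bar>\<mu> j + x j\<bar> > \<tau>} \<subseteq> {..<k}"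
      proof safe
        fix j assume "j < p" "\<bar>\<mu> j + x j\<bar> > \<tau>"
        moreover have "x j \<in> A j" using x \<open>j < p\<close> by auto
        ultimately show "j < k" by (auto simp: A_def split: if_splits)
      qed
      hence "card {j\<in>{..<p}. \<bar>\<mu> j + x j\<bar> > \<tau>} \<le> card {..<k}" by (intro card_mono) auto
      thus "exceed_count p \<tau> \<mu> x \<le> real k" by (simp add: exceed_count_def)
    qed
  qed measurable
  finally show ?thesis by (simp add: v_def w_def)
qed

section \<open>A lower bound on the risk for a fixed dimension\<close>

lemma measure_row_map:
  assumes W: "orthonormal_rows p n W" and A[measurable]: "A \<in> sets (vec_space p)"
  shows "measure (noise n) {e\<in>space (noise n). row_map p n W e \<in> A} = measure (noise p) A"
proof -
  have "emeasure (noise n) {e\<in>space (noise n). row_map p n W e \<in> A} =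
     (\<integral>\<^sup>+e. indicator A (row_map p n W e) \<partial>noise n)"
  proof (subst nn_integral_indicator[symmetric])
    show "{e\<in>space (noise n). row_map p n W e \<in> A} \<in> sets (noise n)" by measurable
  qed (auto intro!: nn_integral_cong simp: indicator_def)
  also have "\<dots> = (\<integral>\<^sup>+x. indicator A x \<partial>noise p)"
    by (rule nn_integral_row_map[OF _ W]) measurable
  also have "\<dots> = emeasure (noise p) A" by (rule nn_integral_indicator) simp
  finally show ?thesis by (simp add: measure_def)
qed

lemma xi_test_noise_integral:
  assumes G: "pos_decomposable p (gram n p X)" and n: "n > 0"
  obtains \<mu> where
    "(\<Sum>j<p. (\<mu> j - sqrt (real n) * \<beta> j)\<^sup>2) \<le>
       (\<Sum>j<p. (\<Sum>l<p. (gram n p X j l - (if j = l then real n else 0)) * \<beta> l)\<^sup>2) / real n"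
    "\<And>t. (\<integral>e. xi_test n p t \<tau> (\<lambda>i. (\<Sum>k<p. X i k * \<beta> k) + e i) X \<partial>noise n) =
       measure (noise p) {x\<in>space (noise p). exceed_count p \<tau> \<mu> x > t}"
    "\<And>t. (\<integral>e. 1 - xi_test n p t \<tau> (\<lambda>i. (\<Sum>k<p. X i k * \<beta> k) + e i) X \<partial>noise n) =
       measure (noise p) {x\<in>space (noise p). exceed_count p \<tau> \<mu> x \<le> t}"
proof -
  obtain W \<mu> where W: "\<And>a b. a < p \<Longrightarrow> b < p \<Longrightarrow> (\<Sum>i<n. W a i * W b i) = (if a = b then 1 else 0)"
    and z: "\<And>e j. j < p \<Longrightarrow> zvec n p (\<lambda>i. (\<Sum>k<p. X i k * \<beta> k) + e i) X j = \<mu> j + (\<Sum>i<n. W j i * e i)"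
    and \<mu>: "(\<Sum>j<p. (\<mu> j - sqrt (real n) * \<beta> j)\<^sup>2) \<le>
       (\<Sum>j<p. (\<Sum>l<p. (gram n p X j l - (if j = l then real n else 0)) * \<beta> l)\<^sup>2) / real n"
    using zvec_representation[OF G n, of \<beta>] by blast
  have W': "orthonormal_rows p n W" using W by (simp add: orthonormal_rows_def)
  have T: "Tstat n p \<tau> (\<lambda>i. (\<Sum>k<p. X i k * \<beta> k) + e i) X = exceed_count p \<tau> \<mu> (row_map p n W e)" for e
  proof -
    have "{j\<in>{..<p}. \<bar>zvec n p (\<lambda>i. (\<Sum>k<p. X i k * \<beta> k) + e i) X j\<bar> > \<tau>} =
       {j\<in>{..<p}. \<bar>\<mu> j + row_map p n W e j\<bar> > \<tau>}" by (auto simp: z row_map_def)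
    thus ?thesis by (simp add: Tstat_def exceed_count_def)
  qed
  have eq: "(\<integral>e. indicator A (row_map p n W e) \<partial>noise n) = measure (noise p) A"
    if A: "A \<in> sets (vec_space p)" for A
  proof -
    have "(\<integral>e. indicator A (row_map p n W e) \<partial>noise n) =
       (\<integral>e. indicator {e\<in>space (noise n). row_map p n W e \<in> A} e \<partial>noise n :: real)"
      by (intro Bochner_Integration.integral_cong) (auto simp: indicator_def)
    also have "\<dots> = measure (noise n) {e\<in>space (noise n). row_map p n W e \<in> A}"
    proof -
      have "{e\<in>space (noise n). row_map p n W e \<in> A} \<inter> space (noise n) =
         {e\<in>space (noise n). row_map p n W e \<in> A}" by auto
      thus ?thesis by simp
    qed
    finally show ?thesis using measure_row_map[OF W' A] by simp
  qed
  have m[measurable]: "{x\<in>space (vec_space p). exceed_count p \<tau> \<mu> x > t} \<in> sets (vec_space p)"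
    "{x\<in>space (vec_space p). exceed_count p \<tau> \<mu> x \<le> t} \<in> sets (vec_space p)" for t
    by measurable
  have sp: "row_map p n W e \<in> space (vec_space p)" for e
    by (simp add: row_map_def vec_space_def space_PiM)
  show ?thesis
  proof
    show "(\<Sum>j<p. (\<mu> j - sqrt (real n) * \<beta> j)\<^sup>2) \<le>
       (\<Sum>j<p. (\<Sum>l<p. (gram n p X j l - (if j = l then real n else 0)) * \<beta> l)\<^sup>2) / real n" by (rule \<mu>)
    fix t
    show "(\<integral>e. xi_test n p t \<tau> (\<lambda>i. (\<Sum>k<p. X i k * \<beta> k) + e i) X \<partial>noise n) =
       measure (noise p) {x\<in>space (noise p). exceed_count p \<tau> \<mu> x > t}"
      unfolding space_noise eq[OF m(1), symmetric]
      by (rule Bochner_Integration.integral_cong) (auto simp: xi_test_def T indicator_def sp)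
    show "(\<integral>e. 1 - xi_test n p t \<tau> (\<lambda>i. (\<Sum>k<p. X i k * \<beta> k) + e i) X \<partial>noise n) =
       measure (noise p) {x\<in>space (noise p). exceed_count p \<tau> \<mu> x \<le> t}"
      unfolding space_noise eq[OF m(2), symmetric]
      by (rule Bochner_Integration.integral_cong) (auto simp: xi_test_def T indicator_def sp)
  qed
qed

lemma measurable_mat_entry [measurable]:
  assumes "i < n" "k < p"
  shows "(\<lambda>X. X i k) \<in> borel_measurable (mat_space n p)"
proof -
  have "(\<lambda>X. X i) \<in> measurable (mat_space n p) (vec_space p)"
    unfolding mat_space_def by (rule measurable_component_singleton) (use assms in simp)
  from measurable_compose[OF this measurable_vec_component[OF assms(2)]] show ?thesis .
qed

text \<open>The integrand is jointly measurable in design and noise, since \<open>zvec\<close>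
  involves the design only through its entries and \<open>inv_sqrt\<close> of the Gram matrix;
  integrating out the noise keeps measurability.\<close>

lemma measurable_xi_test_integral:
  assumes D[measurable_cong]: "sets DX = sets (mat_space n p)"
  shows "(\<lambda>X. \<integral>e. xi_test n p t \<tau> (\<lambda>i. (\<Sum>k<p. X i k * \<beta> k) + e i) X \<partial>noise n) \<in> borel_measurable DX"
    and "(\<lambda>X. \<integral>e. 1 - xi_test n p t \<tau> (\<lambda>i. (\<Sum>k<p. X i k * \<beta> k) + e i) X \<partial>noise n) \<in> borel_measurable DX"
proof -
  interpret N: prob_space "noise n" by (rule prob_space_noise)
  let ?N = "DX \<Otimes>\<^sub>M noise n"
  have [measurable]: "(\<lambda>w. fst w i k) \<in> borel_measurable ?N" if "i < n" "k < p" for i k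
    using that by measurable
  have [measurable]: "(\<lambda>w. snd w i) \<in> borel_measurable ?N" if "i < n" for i
    using that by measurable
  have [measurable]: "(\<lambda>w. inv_sqrt p (gram n p (fst w)) a b) \<in> borel_measurable ?N" if "a < p" "b < p" for a b
  proof (rule measurable_inv_sqrt[OF _ _ that])
    show "gram n p (fst w) a b = gram n p (fst w) b a" for w a b by (simp add: gram_def mult.commute)
    show "(\<lambda>w. gram n p (fst w) a b) \<in> borel_measurable ?N" if "a < p" "b < p" for a b
      using that unfolding gram_def by measurable
  qed
  have [measurable]: "(\<lambda>w. zvec n p (\<lambda>i. (\<Sum>k<p. fst w i k * \<beta> k) + snd w i) (fst w) j) \<in> borel_measurable ?N"
    if "j < p" for j
    using that unfolding zvec_def by measurable
  have [measurable]: "(\<lambda>w. xi_test n p t \<tau> (\<lambda>i. (\<Sum>k<p. fst w i k * \<beta> k) + snd w i) (fst w)) \<in> borel_measurable ?N"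
    unfolding xi_test_def Tstat_def real_card_Collect by measurable
  have "(\<lambda>(X, e). xi_test n p t \<tau> (\<lambda>i. (\<Sum>k<p. X i k * \<beta> k) + e i) X) \<in> borel_measurable ?N"
    "(\<lambda>(X, e). 1 - xi_test n p t \<tau> (\<lambda>i. (\<Sum>k<p. X i k * \<beta> k) + e i) X) \<in> borel_measurable ?N"
    unfolding case_prod_beta by measurable
  note this[THEN N.borel_measurable_lebesgue_integral]
  thus "(\<lambda>X. \<integral>e. xi_test n p t \<tau> (\<lambda>i. (\<Sum>k<p. X i k * \<beta> k) + e i) X \<partial>noise n) \<in> borel_measurable DX"
    and "(\<lambda>X. \<integral>e. 1 - xi_test n p t \<tau> (\<lambda>i. (\<Sum>k<p. X i k * \<beta> k) + e i) X \<partial>noise n) \<in> borel_measurable DX"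
    by simp_all
qed

text \<open>The squared norm |(X^T X - n I) \<beta>|^2. A value of at most n keeps \<mu> within
  distance 1 of sqrt n \<beta>.\<close>

definition gram_defect :: "nat \<Rightarrow> nat \<Rightarrow> rvec \<Rightarrow> rmat \<Rightarrow> real" where
  "gram_defect n p \<beta> X = (\<Sum>j<p. (\<Sum>l<p. (gram n p X j l - (if j = l then real n else 0)) * \<beta> l)\<^sup>2)"

lemma measurable_gram_defect [measurable]: "gram_defect n p \<beta> \<in> borel_measurable (mat_space n p)"
  unfolding gram_defect_def[abs_def] gram_def by measurable

definition block_signal :: "nat \<Rightarrow> real \<Rightarrow> rvec" where
  "block_signal s A = (\<lambda>j. if j < s then A else 0)"

text \<open>Stated for arbitrary f: a nonintegrable f has integral 0, which also lies in
  [0, 1].\<close>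

lemma noise_integral_bounds:
  fixes f :: "rvec \<Rightarrow> real"
  assumes "\<And>e. 0 \<le> f e" "\<And>e. f e \<le> 1"
  shows "0 \<le> (\<integral>e. f e \<partial>noise n)" "(\<integral>e. f e \<partial>noise n) \<le> 1"
proof -
  interpret N: prob_space "noise n" by (rule prob_space_noise)
  show "0 \<le> (\<integral>e. f e \<partial>noise n)" using assms by (intro integral_nonneg_AE) auto
  show "(\<integral>e. f e \<partial>noise n) \<le> 1"
  proof (cases "integrable (noise n) f")
    case True
    thus ?thesis using assms by (intro N.integral_le_const) auto
  qed (simp add: not_integrable_integral_eq)
qed

text \<open>For \<beta> = 0 the bound on \<mu> - sqrt n \<beta> is 0, so \<mu> = 0 for almost every
  X. The null law of the count is therefore exact and the same for every design.\<close>

lemma Exp_null_eq: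
  assumes D: "prob_space DX" "sets DX = sets (mat_space n p)" and n: "n > 0"
    and pd: "AE X in DX. pos_decomposable p (gram n p X)"
  shows "Exp n p DX (\<lambda>_. 0) (xi_test n p t \<tau>) =
     measure (noise p) {x\<in>space (noise p). exceed_count p \<tau> (\<lambda>_. 0) x > t}"
proof -
  interpret prob_space DX by (rule D(1))
  have "AE X in DX. (\<integral>e. xi_test n p t \<tau> (\<lambda>i. (\<Sum>k<p. X i k * 0) + e i) X \<partial>noise n) =
      measure (noise p) {x\<in>space (noise p). exceed_count p \<tau> (\<lambda>_. 0) x > t}"
    using pd
  proof eventually_elim
    case (elim X)
    obtain \<mu> where \<mu>: "(\<Sum>j<p. (\<mu> j - sqrt (real n) * 0)\<^sup>2) \<le>
       (\<Sum>j<p. (\<Sum>l<p. (gram n p X j l - (if j = l then real n else 0)) * 0)\<^sup>2) / real n"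
      and I: "\<And>t. (\<integral>e. xi_test n p t \<tau> (\<lambda>i. (\<Sum>k<p. X i k * 0) + e i) X \<partial>noise n) =
       measure (noise p) {x\<in>space (noise p). exceed_count p \<tau> \<mu> x > t}"
      by (rule xi_test_noise_integral[OF elim n, where \<beta> = "\<lambda>_. 0" and \<tau> = \<tau>]) (rule that)
    have "(\<Sum>j<p. (\<mu> j)\<^sup>2) = 0"
      using \<mu> sum_nonneg[of "{..<p}" "\<lambda>j. (\<mu> j)\<^sup>2"] by simp
    hence "\<mu> j = 0" if "j < p" for j using that by (subst (asm) sum_nonneg_eq_0_iff) auto
    hence "exceed_count p \<tau> \<mu> x = exceed_count p \<tau> (\<lambda>_. 0) x" for x
      unfolding exceed_count_def by (metis (no_types, lifting) lessThan_iff)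
    thus ?case using I by simp
  qed
  hence "(\<integral>X. (\<integral>e. xi_test n p t \<tau> (\<lambda>i. (\<Sum>k<p. X i k * 0) + e i) X \<partial>noise n) \<partial>DX) =
     (\<integral>X. measure (noise p) {x\<in>space (noise p). exceed_count p \<tau> (\<lambda>_. 0) x > t} \<partial>DX)"
    by (intro integral_cong_AE measurable_xi_test_integral[OF D(2)]) auto
  thus ?thesis unfolding Exp_def by (simp add: prob_space)
qed

text \<open>Only designs in the good event are kept. They have probability at least 1/2, and on them
  \<mu> is close enough to sqrt n \<beta> for the hypothesis on B to apply.\<close>

lemma Exp_alternative_ge:
  assumes D: "prob_space DX" "sets DX = sets (mat_space n p)" and n: "n > 0"
    and pd: "AE X in DX. pos_decomposable p (gram n p X)"
    and good: "measure DX {X\<in>space DX. gram_defect n p \<beta> X \<le> real n} \<ge> 1/2"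
    and B: "\<And>\<mu>. (\<Sum>j<p. (\<mu> j - sqrt (real n) * \<beta> j)\<^sup>2) \<le> 1 \<Longrightarrow>
       B \<le> measure (noise p) {x\<in>space (noise p). exceed_count p \<tau> \<mu> x \<le> t}" and B0: "B \<ge> 0"
  shows "Exp n p DX \<beta> (\<lambda>y X. 1 - xi_test n p t \<tau> y X) \<ge> B / 2"
proof -
  interpret prob_space DX by (rule D(1))
  note [measurable_cong] = D(2)
  define g where "g X = (\<integral>e. 1 - xi_test n p t \<tau> (\<lambda>i. (\<Sum>k<p. X i k * \<beta> k) + e i) X \<partial>noise n)" for X
  have g: "0 \<le> g X" "g X \<le> 1" for X
    unfolding g_def by (rule noise_integral_bounds; simp add: xi_test_def)+
  have [measurable]: "g \<in> borel_measurable DX"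
    unfolding g_def[abs_def] by (rule measurable_xi_test_integral(2)[OF D(2)])
  let ?E = "{X\<in>space DX. gram_defect n p \<beta> X \<le> real n}"
  have E[measurable]: "?E \<in> sets DX" by measurable
  have "AE X in DX. B * indicator ?E X \<le> g X"
    using pd
  proof eventually_elim
    case (elim X)
    show ?case
    proof (cases "X \<in> ?E")
      case True
      obtain \<mu> where \<mu>: "(\<Sum>j<p. (\<mu> j - sqrt (real n) * \<beta> j)\<^sup>2) \<le> gram_defect n p \<beta> X / real n"
        and I: "\<And>t. (\<integral>e. 1 - xi_test n p t \<tau> (\<lambda>i. (\<Sum>k<p. X i k * \<beta> k) + e i) X \<partial>noise n) =
          measure (noise p) {x\<in>space (noise p). exceed_count p \<tau> \<mu> x \<le> t}"
        by (rule xi_test_noise_integral[OF elim n, where \<beta> = \<beta> and \<tau> = \<tau>])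
           (rule that[unfolded gram_defect_def])
      have "gram_defect n p \<beta> X / real n \<le> 1" using True n by (simp add: field_simps)
      thus ?thesis using B[of \<mu>] \<mu> I[of t] True by (simp add: g_def)
    qed (use g in auto)
  qed
  hence "(\<integral>X. B * indicator ?E X \<partial>DX) \<le> (\<integral>X. g X \<partial>DX)"
    using g by (intro integral_mono_AE integrable_const_bound[where B = 1] integrable_mult_right) 
      (auto simp: emeasure_eq_measure)
  moreover have "(\<integral>X. B * indicator ?E X \<partial>DX) = B * measure DX ?E" by simp
  moreover have "B * (1/2) \<le> B * measure DX ?E" by (rule mult_left_mono[OF good B0])
  ultimately show ?thesis unfolding Exp_def g_def by simp
qed

text \<open>Supplies the boundedness that \<open>cSUP_upper\<close> needs before a single signal can
  be compared with the supremum in \<open>Risk\<close>.\<close>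

lemma Exp_one_minus_le_1:
  assumes "prob_space DX"
  shows "Exp n p DX \<beta> (\<lambda>y X. 1 - xi_test n p t \<tau> y X) \<le> 1"
proof -
  interpret prob_space DX by (rule assms)
  define g where "g X = (\<integral>e. 1 - xi_test n p t \<tau> (\<lambda>i. (\<Sum>k<p. X i k * \<beta> k) + e i) X \<partial>noise n)" for X
  have g: "g X \<le> 1" for X
    unfolding g_def by (rule noise_integral_bounds; simp add: xi_test_def)
  have "(\<integral>X. g X \<partial>DX) \<le> 1"
  proof (cases "integrable DX g")
    case True
    thus ?thesis using g by (intro integral_le_const) auto
  qed (simp add: not_integrable_integral_eq)
  thus ?thesis by (simp add: Exp_def g_def)
qed

lemma Exp_one_minus_nonneg:
  "0 \<le> Exp n p DX \<beta> (\<lambda>y X. 1 - xi_test n p t \<tau> y X)"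
  unfolding Exp_def by (intro integral_nonneg_AE AE_I2) (auto simp: xi_test_def)

text \<open>If t < k, then k exceedances reject the null, and the type I error alone gives the
  bound. If t \<ge> k, then at most k exceedances accept, and the type II error at the block signal
  alone gives it. Hence k can be chosen without regard to t.\<close>

lemma Risk_ge:
  assumes D: "prob_space DX" "sets DX = sets (mat_space n p)" and n: "n > 0"
    and pd: "AE X in DX. pos_decomposable p (gram n p X)"
    and good: "measure DX {X\<in>space DX. gram_defect n p (block_signal s A) X \<le> real n} \<ge> 1/2"
    and ks: "k \<le> s" "s \<le> p" and A: "A > 0"
    and \<tau>: "\<tau> \<ge> 1" and \<delta>: "2 * exp (- (\<tau> - 1)\<^sup>2 / 2) \<le> 1"
    and b: "sqrt (real n) * A + 1 \<le> \<tau> + b" "0 \<le> b"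
  shows "Risk n p DX (xi_test n p t \<tau>) s A \<ge>
     min ((real p * std_normal_density (\<tau> + 1) / real k) ^ k)
         (std_normal_density (b + 1) ^ (s - k) / 2) * (1 - 2 * exp (- (\<tau> - 1)\<^sup>2 / 2)) ^ p"
proof -
  interpret N: prob_space "noise p" by (rule prob_space_noise)
  define v where "v = (1 - 2 * exp (- (\<tau> - 1)\<^sup>2 / 2)) ^ p"
  define C where "C = (real p * std_normal_density (\<tau> + 1) / real k) ^ k"
  define w where "w = std_normal_density (b + 1) ^ (s - k)"
  have v: "v \<ge> 0" using \<delta> by (simp add: v_def)
  have w: "w \<ge> 0" by (simp add: w_def)
  let ?\<beta> = "block_signal s A"
  have mem: "?\<beta> \<in> Xi p s A"
  proof -
    have "{i\<in>{..<p}. ?\<beta> i \<noteq> 0} = {..<s}" using ks A by (auto simp: block_signal_def)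
    thus ?thesis using ks A by (auto simp: Xi_def block_signal_def)
  qed
  have bdd: "bdd_above ((\<lambda>\<beta>. Exp n p DX \<beta> (\<lambda>y X. 1 - xi_test n p t \<tau> y X)) ` Xi p s A)"
    using Exp_one_minus_le_1[OF D(1)] by (intro bdd_aboveI[of _ 1]) auto
  have sup: "Exp n p DX ?\<beta> (\<lambda>y X. 1 - xi_test n p t \<tau> y X) \<le> (SUP \<beta>\<in>Xi p s A. Exp n p DX \<beta> (\<lambda>y X. 1 - xi_test n p t \<tau> y X))"
    by (rule cSUP_upper[OF mem bdd])
  have null: "Exp n p DX (\<lambda>_. 0) (xi_test n p t \<tau>) =
     measure (noise p) {x\<in>space (noise p). exceed_count p \<tau> (\<lambda>_. 0) x > t}"
    by (rule Exp_null_eq[OF D n pd])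
  show ?thesis
  proof (cases "t < real k")
    case True
    have "C * v \<le> measure (noise p) {x\<in>space (noise p). exceed_count p \<tau> (\<lambda>_. 0) x \<ge> real k}"
      using null_exceed_lower[of k p \<tau>] ks \<tau> \<delta> by (simp add: C_def v_def)
    also have "\<dots> \<le> Exp n p DX (\<lambda>_. 0) (xi_test n p t \<tau>)"
      unfolding null by (rule N.finite_measure_mono, use True in force, measurable)
    also have "\<dots> \<le> Risk n p DX (xi_test n p t \<tau>) s A"
      using sup Exp_one_minus_nonneg[of n p DX ?\<beta> t \<tau>] by (simp add: Risk_def)
    finally have "C * v \<le> Risk n p DX (xi_test n p t \<tau>) s A" .
    moreover have "min C (w / 2) * v \<le> C * v" using v by (intro mult_right_mono) auto
    ultimately show ?thesis by (simp add: C_def w_def v_def)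
  next
    case False
    have "(w * v) / 2 \<le> Exp n p DX ?\<beta> (\<lambda>y X. 1 - xi_test n p t \<tau> y X)"
    proof (rule Exp_alternative_ge[OF D n pd good])
      fix \<mu> assume \<mu>: "(\<Sum>j<p. (\<mu> j - sqrt (real n) * ?\<beta> j)\<^sup>2) \<le> 1"
      have "(\<Sum>j<p. (\<mu> j - (if j < s then sqrt (real n) * A else 0))\<^sup>2) = (\<Sum>j<p. (\<mu> j - sqrt (real n) * ?\<beta> j)\<^sup>2)"
        by (intro sum.cong) (auto simp: block_signal_def)
      hence "w * v \<le> measure (noise p) {x\<in>space (noise p). exceed_count p \<tau> \<mu> x \<le> real k}"
        unfolding w_def v_def using \<mu> ks \<tau> \<delta> b A
        by (intro alternative_exceed_lower[where h = "sqrt (real n) * A"]) auto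
      also have "\<dots> \<le> measure (noise p) {x\<in>space (noise p). exceed_count p \<tau> \<mu> x \<le> t}"
        by (rule N.finite_measure_mono, use False in force, measurable)
      finally show "w * v \<le> measure (noise p) {x\<in>space (noise p). exceed_count p \<tau> \<mu> x \<le> t}" .
    qed (use v w in simp)
    also have "\<dots> \<le> Risk n p DX (xi_test n p t \<tau>) s A"
      unfolding Risk_def null using sup by (rule add_increasing[OF measure_nonneg])
    finally have "w / 2 * v \<le> Risk n p DX (xi_test n p t \<tau>) s A" by simp
    moreover have "min C (w / 2) * v \<le> w / 2 * v" using v by (intro mult_right_mono) auto
    ultimately show ?thesis by (simp add: C_def w_def v_def)
  qed
qed

section \<open>Concentration of the Gram matrix\<close>

lemma Orth_design_good:
  assumes D: "Orth_design n p DX" and n: "n > 0"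
  shows "prob_space DX" "sets DX = sets (mat_space n p)"
    "AE X in DX. pos_decomposable p (gram n p X)"
    "measure DX {X\<in>space DX. gram_defect n p \<beta> X \<le> real n} \<ge> 1/2"
proof -
  show ps: "prob_space DX" and s: "sets DX = sets (mat_space n p)" using D by (auto simp: Orth_design_def)
  interpret prob_space DX by (rule ps)
  note [measurable_cong] = s
  have ae: "AE X in DX. \<forall>a<p. \<forall>b<p. gram n p X a b = (if a = b then real n else 0)"
    using D by (simp add: Orth_design_def)
  from ae show "AE X in DX. pos_decomposable p (gram n p X)"
  proof eventually_elim
    case (elim X)
    show ?case
    proof (rule pos_def_decomposable, unfold pos_def_def, intro conjI allI impI)
      fix v :: rvec assume "\<exists>a<p. v a \<noteq> 0"
      then obtain a where a: "a < p" "v a \<noteq> 0" by blast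
      have "(\<Sum>a<p. \<Sum>b<p. v a * gram n p X a b * v b) = (\<Sum>a<p. \<Sum>b<p. if a = b then real n * (v a)\<^sup>2 else 0)"
        using elim by (intro sum.cong) (auto simp: power2_eq_square)
      also have "\<dots> = (\<Sum>a<p. real n * (v a)\<^sup>2)" by simp
      also have "\<dots> > 0" using n a by (intro sum_pos2[of _ a]) auto
      finally show "0 < (\<Sum>a<p. \<Sum>b<p. v a * gram n p X a b * v b)" .
    qed (use elim in auto)
  qed
  have "AE X in DX. X \<in> {X\<in>space DX. gram_defect n p \<beta> X \<le> real n}"
    using ae AE_space
  proof eventually_elim
    case (elim X)
    have "gram_defect n p \<beta> X = (\<Sum>j<p. (\<Sum>l<p. 0)\<^sup>2)"
      unfolding gram_defect_def using elim by (intro sum.cong arg_cong[where f = "\<lambda>x. x\<^sup>2"]) auto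
    thus ?case using elim by simp
  qed
  hence "measure DX {X\<in>space DX. gram_defect n p \<beta> X \<le> real n} = 1"
    by (subst prob_eq_1) auto
  thus "measure DX {X\<in>space DX. gram_defect n p \<beta> X \<le> real n} \<ge> 1/2" by simp
qed

section \<open>Moments of sub-Gaussian rows\<close>

lemma power4_le_exp: "(y::real) ^ 4 \<le> 256 * (exp y + exp (- y))"
proof -
  have *: "z ^ 4 \<le> 256 * exp z" if "z \<ge> 0" for z :: real
  proof -
    \<comment> \<open>The fourth power of this inequality produces the constant 256 = 4^4.\<close>
    have "z / 4 \<le> exp (z / 4)" using exp_ge_add_one_self[of "z / 4"] by linarith
    hence "(z / 4) ^ 4 \<le> exp (z / 4) ^ 4" using that by (intro power_mono) auto
    also have "\<dots> = exp z" by (simp add: exp_of_nat_mult[symmetric])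
    finally show ?thesis by (simp add: power_divide)
  qed
  show ?thesis
  proof (cases "y \<ge> 0")
    case True
    thus ?thesis using *[of y] exp_gt_zero[of "- y"] by (smt (verit))
  next
    case False
    thus ?thesis using *[of "- y"] exp_gt_zero[of y] by (smt (verit) power_minus_even even_numeral)
  qed
qed

text \<open>The exponential moment bounds at t = 1 and t = -1, each weighted by 256, dominate the
  fourth moment; this gives the 512.\<close>

lemma subg_row_fourth_moment:
  assumes S: "subg_row p \<sigma>2 \<mu>" and u: "(\<Sum>a<p. (u a)\<^sup>2) = 1"
  shows "integrable \<mu> (\<lambda>x. (\<Sum>a<p. u a * x a) ^ 4)"
    and "(\<integral>x. (\<Sum>a<p. u a * x a) ^ 4 \<partial>\<mu>) \<le> 512 * exp (\<sigma>2 / 2)"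
proof -
  interpret prob_space \<mu> using S by (simp add: subg_row_def)
  have [measurable_cong]: "sets \<mu> = sets (vec_space p)" using S by (simp add: subg_row_def)
  have int: "integrable \<mu> (\<lambda>x. exp (t * (\<Sum>a<p. u a * x a)))"
    and ln: "ln (\<integral>x. exp (t * (\<Sum>a<p. u a * x a)) \<partial>\<mu>) \<le> \<sigma>2 * t\<^sup>2 / 2" for t
    using S u unfolding subg_row_def by blast+
  \<comment> \<open>A bound on \<open>ln\<close> controls its argument only where that is positive;
    elsewhere the claim is immediate.\<close>
  have bd: "(\<integral>x. exp (t * (\<Sum>a<p. u a * x a)) \<partial>\<mu>) \<le> exp (\<sigma>2 / 2)" if "t\<^sup>2 = 1" for t
  proof (cases "(\<integral>x. exp (t * (\<Sum>a<p. u a * x a)) \<partial>\<mu>) > 0")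
    case True
    hence "(\<integral>x. exp (t * (\<Sum>a<p. u a * x a)) \<partial>\<mu>) = exp (ln (\<integral>x. exp (t * (\<Sum>a<p. u a * x a)) \<partial>\<mu>))"
      by (rule exp_ln[symmetric])
    also have "\<dots> \<le> exp (\<sigma>2 / 2)" using ln[of t] that by simp
    finally show ?thesis .
  next
    case False
    thus ?thesis using exp_ge_zero[of "\<sigma>2 / 2"] by linarith
  qed
  let ?h = "\<lambda>x. 256 * (exp (1 * (\<Sum>a<p. u a * x a)) + exp ((- 1) * (\<Sum>a<p. u a * x a)))"
  have ih: "integrable \<mu> ?h" by (intro integrable_mult_right Bochner_Integration.integrable_add int)
  have le: "(\<Sum>a<p. u a * x a) ^ 4 \<le> ?h x" for x using power4_le_exp by simp
  show i4: "integrable \<mu> (\<lambda>x. (\<Sum>a<p. u a * x a) ^ 4)"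
    by (rule Bochner_Integration.integrable_bound[OF ih])
       (use le in \<open>auto simp: zero_le_even_power intro!: AE_I2 order.trans[OF _ abs_ge_self]\<close>)
  have "(\<integral>x. (\<Sum>a<p. u a * x a) ^ 4 \<partial>\<mu>) \<le> (\<integral>x. ?h x \<partial>\<mu>)"
    by (rule integral_mono[OF i4 ih le])
  also have "\<dots> = 256 * ((\<integral>x. exp (1 * (\<Sum>a<p. u a * x a)) \<partial>\<mu>) + (\<integral>x. exp ((- 1) * (\<Sum>a<p. u a * x a)) \<partial>\<mu>))"
    by (subst Bochner_Integration.integral_mult_right_zero, subst Bochner_Integration.integral_add[OF int int]) simp
  also have "\<dots> \<le> 256 * (exp (\<sigma>2 / 2) + exp (\<sigma>2 / 2))"
    by (intro mult_left_mono add_mono bd) auto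
  finally show "(\<integral>x. (\<Sum>a<p. u a * x a) ^ 4 \<partial>\<mu>) \<le> 512 * exp (\<sigma>2 / 2)" by simp
qed

text \<open>The j-th entry of (x x^T - I) u, centered by isotropy of the row x.\<close>

definition row_fluctuation :: "nat \<Rightarrow> rvec \<Rightarrow> nat \<Rightarrow> rvec \<Rightarrow> real" where
  "row_fluctuation p u j x = x j * (\<Sum>a<p. u a * x a) - u j"

text \<open>By the arithmetic-geometric mean inequality (x_j <u,x>)^2 is at most the average of
  x_j^4 and <u,x>^4, fourth powers along the unit directions e_j and u. Subtracting the mean u_j
  only lowers the second moment.\<close>

lemma subg_row_fluctuation:
  assumes S: "subg_row p \<sigma>2 \<mu>" and u: "(\<Sum>a<p. (u a)\<^sup>2) = 1" and j: "j < p"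
  shows "integrable \<mu> (row_fluctuation p u j)" "(\<integral>x. row_fluctuation p u j x \<partial>\<mu>) = 0"
    "integrable \<mu> (\<lambda>x. (row_fluctuation p u j x)\<^sup>2)"
    "(\<integral>x. (row_fluctuation p u j x)\<^sup>2 \<partial>\<mu>) \<le> 512 * exp (\<sigma>2 / 2)"
proof -
  interpret prob_space \<mu> using S by (simp add: subg_row_def)
  have [measurable_cong]: "sets \<mu> = sets (vec_space p)" using S by (simp add: subg_row_def)
  note [measurable] = j
  have cov: "integrable \<mu> (\<lambda>x. x a * x b)" "(\<integral>x. x a * x b \<partial>\<mu>) = (if a = b then 1 else 0)"
    if "a < p" "b < p" for a b using S that unfolding subg_row_def by blast+
  let ?g = "\<lambda>x. x j * (\<Sum>a<p. u a * x a)"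
  have geq: "?g = (\<lambda>x. \<Sum>a<p. u a * (x j * x a))" by (simp add: sum_distrib_left mult_ac)
  have ig: "integrable \<mu> ?g"
    unfolding geq by (intro Bochner_Integration.integrable_sum integrable_mult_right cov j) auto
  have "(\<integral>x. ?g x \<partial>\<mu>) = (\<Sum>a<p. u a * (\<integral>x. x j * x a \<partial>\<mu>))"
    unfolding geq using cov j by (subst Bochner_Integration.integral_sum) auto
  also have "\<dots> = (\<Sum>a<p. if j = a then u a else 0)" using cov(2)[OF j] by (intro sum.cong) auto
  also have "\<dots> = u j" using j by simp
  finally have eg: "(\<integral>x. ?g x \<partial>\<mu>) = u j" .
  show i1: "integrable \<mu> (row_fluctuation p u j)"
    unfolding row_fluctuation_def[abs_def] using ig by simp
  show e0: "(\<integral>x. row_fluctuation p u j x \<partial>\<mu>) = 0"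
    unfolding row_fluctuation_def using ig eg by (simp add: prob_space)
  let ?e = "\<lambda>a. if a = j then 1 else (0::real)"
  have ej: "(\<Sum>a<p. ?e a * x a) = x j" for x :: rvec
    using j by (simp add: if_distribR if_distrib cong: if_cong)
  have ee: "(\<Sum>a<p. (?e a)\<^sup>2) = 1" using j by (simp add: if_distribR if_distrib cong: if_cong)
  note j4 = subg_row_fourth_moment[OF S ee, unfolded ej]
  note u4 = subg_row_fourth_moment[OF S u]
  let ?h = "\<lambda>x. ((x j) ^ 4 + (\<Sum>a<p. u a * x a) ^ 4) / 2"
  have ih: "integrable \<mu> ?h" using j4(1) u4(1) by simp
  have le: "(?g x)\<^sup>2 \<le> ?h x" for x
  proof -
    have "0 \<le> ((x j)\<^sup>2 - (\<Sum>a<p. u a * x a)\<^sup>2)\<^sup>2" by simp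
    thus ?thesis by (simp add: power2_diff power_mult_distrib)
  qed
  have ig2: "integrable \<mu> (\<lambda>x. (?g x)\<^sup>2)"
    by (rule Bochner_Integration.integrable_bound[OF ih])
       (use le in \<open>auto intro!: AE_I2 order.trans[OF _ abs_ge_self]\<close>)
  have feq: "(\<lambda>x. (row_fluctuation p u j x)\<^sup>2) = (\<lambda>x. (?g x)\<^sup>2 - 2 * u j * ?g x + (u j)\<^sup>2)"
    by (simp add: row_fluctuation_def power2_diff fun_eq_iff mult_ac)
  show "integrable \<mu> (\<lambda>x. (row_fluctuation p u j x)\<^sup>2)"
    unfolding feq using ig ig2 by (intro Bochner_Integration.integrable_add Bochner_Integration.integrable_diff integrable_mult_right) auto
  have "(\<integral>x. (row_fluctuation p u j x)\<^sup>2 \<partial>\<mu>) = (\<integral>x. (?g x)\<^sup>2 \<partial>\<mu>) - 2 * u j * (\<integral>x. ?g x \<partial>\<mu>) + (u j)\<^sup>2"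
    unfolding feq using ig ig2 
    by (subst Bochner_Integration.integral_add) 
       (auto simp: prob_space simp del: Bochner_Integration.integral_mult_right intro!: Bochner_Integration.integral_diff[THEN trans])
  also have "\<dots> \<le> (\<integral>x. (?g x)\<^sup>2 \<partial>\<mu>)" unfolding eg by (simp add: power2_eq_square)
  also have "\<dots> \<le> (\<integral>x. ?h x \<partial>\<mu>)" by (rule integral_mono[OF ig2 ih le])
  also have "\<dots> = ((\<integral>x. x j ^ 4 \<partial>\<mu>) + (\<integral>x. (\<Sum>a<p. u a * x a) ^ 4 \<partial>\<mu>)) / 2"
    using j4(1) u4(1) by simp
  also have "\<dots> \<le> 512 * exp (\<sigma>2 / 2)" using j4(2) u4(2) by simp
  finally show "(\<integral>x. (row_fluctuation p u j x)\<^sup>2 \<partial>\<mu>) \<le> 512 * exp (\<sigma>2 / 2)" .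
qed

lemma iid_sum_second_moment:
  fixes f :: "'a \<Rightarrow> real" and n :: nat
  assumes "prob_space \<mu>" and f: "integrable \<mu> f" "(\<integral>x. f x \<partial>\<mu>) = 0" "integrable \<mu> (\<lambda>x. (f x)\<^sup>2)"
  shows "integrable (PiM {..<n} (\<lambda>_. \<mu>)) (\<lambda>X. (\<Sum>i<n. f (X i))\<^sup>2)"
    "(\<integral>X. (\<Sum>i<n. f (X i))\<^sup>2 \<partial>PiM {..<n} (\<lambda>_. \<mu>)) = real n * (\<integral>x. (f x)\<^sup>2 \<partial>\<mu>)"
proof -
  interpret prob_space \<mu> by fact
  interpret product_sigma_finite "\<lambda>_::nat. \<mu>" ..
  let ?P = "PiM {..<n} (\<lambda>_. \<mu>)"
  have pair: "integrable ?P (\<lambda>X. f (X i) * f (X j))"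
    "(\<integral>X. f (X i) * f (X j) \<partial>?P) = (if i = j then (\<integral>x. (f x)\<^sup>2 \<partial>\<mu>) else 0)" if ij: "i < n" "j < n" for i j
  proof -
    \<comment> \<open>Writes f (X i) f (X j) as a product over all coordinates, with factor f^2 when
      i = j, so that the product integral formula covers both cases.\<close>
    define g where "g l x = (if l = i then f x else 1) * (if l = j then f x else 1)" for l x
    have eq: "(\<Prod>l\<in>{..<n}. g l (X l)) = f (X i) * f (X j)" for X
      unfolding g_def prod.distrib using ij by simp
    have ig: "integrable \<mu> (g l)" for l
    proof -
      consider "l = i" "l = j" | "l = i" "l \<noteq> j" | "l \<noteq> i" "l = j" | "l \<noteq> i" "l \<noteq> j" by blast
      thus ?thesis using f by cases (auto simp: g_def[abs_def] power2_eq_square)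
    qed
    show "integrable ?P (\<lambda>X. f (X i) * f (X j))"
      using product_integrable_prod[of "{..<n}" g] ig by (simp add: eq)
    have "(\<integral>X. f (X i) * f (X j) \<partial>?P) = (\<Prod>l\<in>{..<n}. \<integral>x. g l x \<partial>\<mu>)"
      using product_integral_prod[of "{..<n}" g] ig by (simp add: eq)
    also have "\<dots> = (if i = j then (\<integral>x. (f x)\<^sup>2 \<partial>\<mu>) else 0)"
    proof (cases "i = j")
      case True
      have "(\<Prod>l\<in>{..<n}. \<integral>x. g l x \<partial>\<mu>) = (\<Prod>l\<in>{..<n}. if l = i then (\<integral>x. (f x)\<^sup>2 \<partial>\<mu>) else 1)"
        using True by (intro prod.cong) (auto simp: g_def power2_eq_square prob_space)
      thus ?thesis using True ij by simp
    next
      case False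
      have "(\<integral>x. g i x \<partial>\<mu>) = 0" using False f(2) by (simp add: g_def)
      hence "(\<Prod>l\<in>{..<n}. \<integral>x. g l x \<partial>\<mu>) = 0" using ij by (intro prod_zero) auto
      thus ?thesis using False by simp
    qed
    finally show "(\<integral>X. f (X i) * f (X j) \<partial>?P) = (if i = j then (\<integral>x. (f x)\<^sup>2 \<partial>\<mu>) else 0)" .
  qed
  have sq: "(\<lambda>X. (\<Sum>i<n. f (X i))\<^sup>2) = (\<lambda>X. \<Sum>i<n. \<Sum>j<n. f (X i) * f (X j))"
    by (simp add: power2_eq_square sum_product)
  show "integrable ?P (\<lambda>X. (\<Sum>i<n. f (X i))\<^sup>2)"
    unfolding sq by (intro Bochner_Integration.integrable_sum pair) auto
  have "(\<integral>X. (\<Sum>i<n. f (X i))\<^sup>2 \<partial>?P) = (\<Sum>i<n. \<integral>X. (\<Sum>j<n. f (X i) * f (X j)) \<partial>?P)"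
    unfolding sq by (rule Bochner_Integration.integral_sum) (intro Bochner_Integration.integrable_sum pair, auto)
  also have "\<dots> = (\<Sum>i<n. \<Sum>j<n. \<integral>X. f (X i) * f (X j) \<partial>?P)"
    using pair(1) by (intro sum.cong refl Bochner_Integration.integral_sum) auto
  also have "\<dots> = (\<Sum>i<n. \<Sum>j<n. if i = j then (\<integral>x. (f x)\<^sup>2 \<partial>\<mu>) else 0)"
    using pair(2) by (intro sum.cong) auto
  finally show "(\<integral>X. (\<Sum>i<n. f (X i))\<^sup>2 \<partial>?P) = real n * (\<integral>x. (f x)\<^sup>2 \<partial>\<mu>)" by simp
qed

text \<open>X^T X - n I is the sum over the rows x of x x^T - I, so every coordinate of the defect
  is a sum of functions of single rows.\<close>

lemma gram_defect_row_fluctuation: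
  "gram_defect n p (\<lambda>l. c * u l) X = c\<^sup>2 * (\<Sum>j<p. (\<Sum>i<n. row_fluctuation p u j (X i))\<^sup>2)"
proof -
  have "(\<Sum>l<p. (gram n p X j l - (if j = l then real n else 0)) * (c * u l)) = c * (\<Sum>i<n. row_fluctuation p u j (X i))"
    if j: "j < p" for j
  proof -
    have "(\<Sum>l<p. gram n p X j l * (c * u l)) = c * (\<Sum>i<n. X i j * (\<Sum>l<p. u l * X i l))"
      by (simp add: gram_def sum_distrib_left sum_distrib_right mult_ac) (rule sum.swap)
    moreover have "(\<Sum>l<p. (if j = l then real n else 0) * (c * u l)) = c * (real n * u j)"
      using j by (simp add: if_distribR if_distrib cong: if_cong)
    ultimately show ?thesis
      by (simp add: left_diff_distrib sum_subtractf row_fluctuation_def right_diff_distrib)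
  qed
  hence "gram_defect n p (\<lambda>l. c * u l) X = (\<Sum>j<p. (c * (\<Sum>i<n. row_fluctuation p u j (X i)))\<^sup>2)"
    unfolding gram_defect_def by (intro sum.cong arg_cong[where f = "\<lambda>x. x\<^sup>2"]) auto
  thus ?thesis unfolding power_mult_distrib sum_distrib_left[symmetric] .
qed

text \<open>Writing the block signal as c u with u a unit vector gives c^2 = A^2 s. The p
  coordinates each contribute at most n K, so \<open>small\<close> makes the expected defect at most
  n/2, and Markov's inequality at level n leaves probability at least 1/2.\<close>

lemma SubG_design_good:
  assumes D: "SubG_design n p \<sigma>2 DX" and n: "n > 0" and s: "0 < s" "s \<le> p"
    and small: "A\<^sup>2 * real s * real p * (512 * exp (\<sigma>2 / 2)) \<le> 1/2"
  shows "prob_space DX" "sets DX = sets (mat_space n p)"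
    "AE X in DX. pos_decomposable p (gram n p X)"
    "measure DX {X\<in>space DX. gram_defect n p (block_signal s A) X \<le> real n} \<ge> 1/2"
proof -
  obtain \<mu> where S: "subg_row p \<sigma>2 \<mu>" and DX: "DX = PiM {..<n} (\<lambda>_. \<mu>)"
    and pd: "AE X in DX. pos_def p (gram n p X)"
    using D by (auto simp: SubG_design_def)
  interpret M: prob_space \<mu> using S by (simp add: subg_row_def)
  show ps: "prob_space DX" unfolding DX by (intro prob_space_PiM M.prob_space_axioms)
  show sets: "sets DX = sets (mat_space n p)"
    unfolding DX mat_space_def using S by (intro sets_PiM_cong) (auto simp: subg_row_def)
  show "AE X in DX. pos_decomposable p (gram n p X)"
    using pd by eventually_elim (rule pos_def_decomposable)
  interpret prob_space DX by (rule ps)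
  note [measurable_cong] = sets
  define u where "u = block_signal s (1 / sqrt (real s))"
  define c where "c = A * sqrt (real s)"
  have bs: "block_signal s A = (\<lambda>l. c * u l)" using s by (auto simp: u_def c_def block_signal_def)
  have unit: "(\<Sum>a<p. (u a)\<^sup>2) = 1"
  proof -
    have "(\<Sum>a<p. (u a)\<^sup>2) = (\<Sum>a<p. if a \<in> {..<s} then 1 / real s else 0)"
      using s by (intro sum.cong) (auto simp: u_def block_signal_def power_divide)
    also have "\<dots> = (\<Sum>a\<in>{..<p} \<inter> {..<s}. 1 / real s)" by (rule sum.inter_restrict[symmetric]) simp
    also have "{..<p} \<inter> {..<s} = {..<s}" using s by auto
    finally show ?thesis using s by simp
  qed
  define K where "K = 512 * exp (\<sigma>2 / 2)"
  note fl = subg_row_fluctuation[OF S unit]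
  have i2: "integrable DX (\<lambda>X. (\<Sum>i<n. row_fluctuation p u j (X i))\<^sup>2)"
    and e2: "(\<integral>X. (\<Sum>i<n. row_fluctuation p u j (X i))\<^sup>2 \<partial>DX) \<le> real n * K" if "j < p" for j
  proof -
    note iid = iid_sum_second_moment[OF M.prob_space_axioms fl(1)[OF that] fl(2)[OF that] fl(3)[OF that], of n]
    show "integrable DX (\<lambda>X. (\<Sum>i<n. row_fluctuation p u j (X i))\<^sup>2)" unfolding DX by (rule iid)
    show "(\<integral>X. (\<Sum>i<n. row_fluctuation p u j (X i))\<^sup>2 \<partial>DX) \<le> real n * K"
      unfolding DX iid(2) K_def using fl(4)[OF that] by (intro mult_left_mono) auto
  qed
  have int: "integrable DX (gram_defect n p (block_signal s A))"
    unfolding bs gram_defect_row_fluctuation[abs_def]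
    by (intro integrable_mult_right Bochner_Integration.integrable_sum i2) auto
  have "(\<integral>X. gram_defect n p (block_signal s A) X \<partial>DX) = c\<^sup>2 * (\<Sum>j<p. \<integral>X. (\<Sum>i<n. row_fluctuation p u j (X i))\<^sup>2 \<partial>DX)"
    unfolding bs gram_defect_row_fluctuation
    by (subst Bochner_Integration.integral_mult_right_zero, subst Bochner_Integration.integral_sum) (auto intro: i2)
  also have "\<dots> \<le> c\<^sup>2 * (\<Sum>j<p. real n * K)"
    by (intro mult_left_mono sum_mono e2) auto
  also have "\<dots> = real n * (A\<^sup>2 * real s * real p * K)"
    by (simp add: c_def power_mult_distrib)
  also have "\<dots> \<le> real n * (1/2)" unfolding K_def by (intro mult_left_mono small) auto
  finally have E: "(\<integral>X. gram_defect n p (block_signal s A) X \<partial>DX) \<le> real n / 2" by simp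
  have "measure DX {X\<in>space DX. gram_defect n p (block_signal s A) X \<ge> real n} \<le>
      (\<integral>X. gram_defect n p (block_signal s A) X \<partial>DX) / real n"
    by (rule integral_Markov_inequality_measure[OF int, where A = "{}"]) (use n in \<open>auto simp: gram_defect_def sum_nonneg\<close>)
  also have "\<dots> \<le> 1/2" using E n by (simp add: field_simps)
  finally have M: "measure DX {X\<in>space DX. gram_defect n p (block_signal s A) X \<ge> real n} \<le> 1/2" .
  have "1 - measure DX {X\<in>space DX. gram_defect n p (block_signal s A) X \<ge> real n} =
     measure DX (space DX - {X\<in>space DX. gram_defect n p (block_signal s A) X \<ge> real n})"
    by (rule prob_compl[symmetric]) measurable
  also have "\<dots> \<le> measure DX {X\<in>space DX. gram_defect n p (block_signal s A) X \<le> real n}"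
    by (rule finite_measure_mono, force, measurable)
  finally show "measure DX {X\<in>space DX. gram_defect n p (block_signal s A) X \<le> real n} \<ge> 1/2" using M by simp
qed

section \<open>Asymptotics\<close>

text \<open>Allowing \<open>\<kappa> s\<close> exceedances costs $\kappa(1-\alpha)$ under the null and
  $(1-\kappa)(\sqrt r-1)_+^2$ under the alternative; for $r > 1$ the two are balanced.\<close>

lemma exists_exceedance_fraction:
  fixes \<alpha> r :: real
  assumes \<alpha>: "1/2 < \<alpha>" "\<alpha> < 1" and r: "r > \<alpha>"
  obtains \<kappa> where "0 < \<kappa>" "\<kappa> < 1" "\<kappa> * (1 - \<alpha>) < (r - \<alpha>)\<^sup>2 / (4 * r)"
    "(1 - \<kappa>) * (max 0 (sqrt r - 1))\<^sup>2 < (r - \<alpha>)\<^sup>2 / (4 * r)"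
proof -
  define D where "D = (r - \<alpha>)\<^sup>2 / (4 * r)"
  have r0: "r > 0" using assms by simp
  have D: "D > 0" using assms r0 by (simp add: D_def)
  show ?thesis
  proof (cases "r \<le> 1")
    case True
    \<comment> \<open>For r \<le> 1 the alternative costs nothing, so any small fraction
      works.\<close>
    define \<kappa> where "\<kappa> = min (1/2) (D / 2)"
    have "\<kappa> * (1 - \<alpha>) < D * 1"
      using D \<alpha> by (intro mult_strict_mono') (auto simp: \<kappa>_def)
    moreover have "max 0 (sqrt r - 1) = 0" using True r0 by simp
    ultimately show ?thesis using that[of \<kappa>] D by (auto simp: \<kappa>_def D_def)
  next
    case False
    \<comment> \<open>With r = (1 + w)^2 and a = 1 - \<alpha> one has r - \<alpha> = w^2 + 2 w + a,
      and the claim becomes a polynomial inequality.\<close>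
    define w where "w = sqrt r - 1"
    define a where "a = 1 - \<alpha>"
    have w: "w > 0" using False by (simp add: w_def)
    have a: "0 < a" "a < 1" using \<alpha> by (auto simp: a_def)
    have rw: "r = (1 + w)\<^sup>2" using r0 by (simp add: w_def)
    define m where "m = w\<^sup>2"
    have m: "m > 0" using w by (simp add: m_def)
    \<comment> \<open>The left side is the common value of \<kappa> a and (1 - \<kappa>) m at
      \<kappa> = m / (m + a).\<close>
    have key: "m * a / (m + a) < D"
    proof -
      have "4 * (1 + w)\<^sup>2 * (w\<^sup>2 * a) < (w\<^sup>2 + 2 * w + a)\<^sup>2 * (w\<^sup>2 + a)"
      proof -
        \<comment> \<open>The difference regrouped into visibly positive terms; (w + 2)^2 > 4 > a
          settles the first.\<close>
        have "(w\<^sup>2 + 2 * w + a)\<^sup>2 * (w\<^sup>2 + a) - 4 * (1 + w)\<^sup>2 * (w\<^sup>2 * a) =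
           w ^ 4 * ((w + 2)\<^sup>2 - a) + (a\<^sup>2 * (2 * w * (w + 2) + w\<^sup>2) + a ^ 3)"
          by (simp add: algebra_simps power2_eq_square power3_eq_cube power4_eq_xxxx)
        also have "\<dots> > 0"
        proof -
          have "(w + 2)\<^sup>2 \<ge> 2\<^sup>2" using w by (intro power_mono) auto
          hence "w ^ 4 * ((w + 2)\<^sup>2 - a) > 0" using w a by simp
          moreover have "a\<^sup>2 * (2 * w * (w + 2) + w\<^sup>2) + a ^ 3 > 0"
            using w a by (intro add_pos_pos mult_pos_pos) auto
          ultimately show ?thesis by linarith
        qed
        finally show ?thesis by simp
      qed
      moreover have "r - \<alpha> = w\<^sup>2 + 2 * w + a" unfolding rw a_def by (simp add: power2_eq_square algebra_simps)
      ultimately have "4 * r * (m * a) < (r - \<alpha>)\<^sup>2 * (m + a)" by (simp add: m_def rw)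
      thus ?thesis using r0 m a by (simp add: D_def field_simps)
    qed
    have e: "1 - m / (m + a) = a / (m + a)" using m a by (simp add: field_simps)
    show ?thesis
    proof (rule that[of "m / (m + a)"])
      show "m / (m + a) * (1 - \<alpha>) < (r - \<alpha>)\<^sup>2 / (4 * r)" using key by (simp add: D_def a_def)
      have "max 0 (sqrt r - 1) = w" using w by (simp add: w_def)
      thus "(1 - m / (m + a)) * (max 0 (sqrt r - 1))\<^sup>2 < (r - \<alpha>)\<^sup>2 / (4 * r)"
        unfolding e using key by (simp add: D_def m_def mult.commute)
    qed (use m a in auto)
  qed
qed

section \<open>Exponential form of the three factors in the risk bound\<close>

lemma std_normal_density_exp: "std_normal_density x = exp (- (x\<^sup>2 / 2) - ln (sqrt (2 * pi)))"
proof -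
  have "exp (ln (sqrt (2 * pi))) = sqrt (2 * pi)" by (rule exp_ln) simp
  thus ?thesis by (simp add: std_normal_density_def exp_diff)
qed

text \<open>Since exp (\<tau>^2 / 2) = p, the factor p cancels the leading part of the density at
  \<tau> + 1. What is left of each of the k factors is 1/k \<ge> p^(-a), up to exp (- \<tau>) and a
  constant.\<close>

lemma null_factor_ge:
  fixes p k :: nat and a :: real
  assumes p: "p \<ge> 2" and k: "0 < k" "real k \<le> real p powr a"
  defines "\<tau> \<equiv> sqrt (2 * ln (real p))"
  shows "exp (- (real k * (a * ln (real p) + \<tau> + (1/2 + ln (sqrt (2 * pi)))))) \<le>
    (real p * std_normal_density (\<tau> + 1) / real k) ^ k"
proof -
  define L where "L = ln (real p)"
  have L: "L > 0" using p by (simp add: L_def)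
  have \<tau>2: "\<tau>\<^sup>2 = 2 * L" using L by (simp add: \<tau>_def L_def)
  have pL: "real p = exp L" using p by (simp add: L_def)
  have kL: "real k \<le> exp (a * L)" using k p by (simp add: powr_def L_def)
  have "exp (- (a * L + \<tau> + (1/2 + ln (sqrt (2 * pi))))) = exp L * exp (- ((\<tau> + 1)\<^sup>2 / 2) - ln (sqrt (2 * pi))) / exp (a * L)"
    by (simp add: exp_add[symmetric] exp_diff[symmetric] power2_sum \<tau>2 field_simps)
  also have "\<dots> \<le> real p * std_normal_density (\<tau> + 1) / real k"
    unfolding std_normal_density_exp pL[symmetric] using kL k by (intro divide_left_mono) auto
  finally have "exp (- (a * L + \<tau> + (1/2 + ln (sqrt (2 * pi))))) ^ k \<le> (real p * std_normal_density (\<tau> + 1) / real k) ^ k"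
    by (intro power_mono) auto
  thus ?thesis unfolding exp_of_nat_mult[symmetric] L_def by (simp only: mult_minus_right)
qed

text \<open>Each of the d suppressed signals costs m^2 log p to leading order, since \<tau>^2 / 2 =
  log p. One of the two added units pays for the deviation of the mean, the other for the unit
  interval; ln 2 is the probability 1/2 of a good design.\<close>

lemma alternative_factor_eq:
  fixes p d :: nat and m :: real
  assumes p: "p \<ge> 2"
  defines "\<tau> \<equiv> sqrt (2 * ln (real p))"
  shows "exp (- (real d * (m\<^sup>2 * ln (real p) + 2 * m * \<tau> + (2 + ln (sqrt (2 * pi)))) + ln 2)) =
    std_normal_density (m * \<tau> + 1 + 1) ^ d / 2"
proof -
  have \<tau>2: "\<tau>\<^sup>2 = 2 * ln (real p)" using p by (simp add: \<tau>_def)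
  have e: "(m * \<tau> + 1 + 1)\<^sup>2 / 2 = m\<^sup>2 * (\<tau>\<^sup>2 / 2) + 2 * m * \<tau> + 2"
    by (simp add: power2_eq_square algebra_simps)
  define Z where "Z = m\<^sup>2 * ln (real p) + 2 * m * \<tau> + (2 + ln (sqrt (2 * pi)))"
  have "std_normal_density (m * \<tau> + 1 + 1) = exp (- Z)"
    unfolding std_normal_density_exp e \<tau>2 by (simp add: Z_def)
  hence "std_normal_density (m * \<tau> + 1 + 1) ^ d / 2 = exp (real d * - Z) / exp (ln 2)"
    by (simp only: exp_of_nat_mult) simp
  thus ?thesis unfolding exp_diff[symmetric] Z_def[symmetric] by simp
qed

text \<open>With \<delta> the tail bound, p \<delta> = 2 exp (\<tau> - 1/2), and 1 - \<delta> \<ge>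
  exp (- 2 \<delta>) for \<delta> \<le> 1/2.\<close>

lemma bulk_factor_ge:
  fixes p :: nat
  assumes p: "p \<ge> 2"
  defines "\<tau> \<equiv> sqrt (2 * ln (real p))"
  assumes \<delta>: "2 * exp (- (\<tau> - 1)\<^sup>2 / 2) \<le> 1/2"
  shows "exp (- (4 * exp \<tau>)) \<le> (1 - 2 * exp (- (\<tau> - 1)\<^sup>2 / 2)) ^ p"
proof -
  define \<delta> where "\<delta> = 2 * exp (- (\<tau> - 1)\<^sup>2 / 2)"
  have \<delta>': "0 < \<delta>" "\<delta> \<le> 1/2" using \<delta> by (auto simp: \<delta>_def)
  have \<tau>2: "\<tau>\<^sup>2 = 2 * ln (real p)" using p by (simp add: \<tau>_def)
  have "real p * \<delta> = 2 * (exp (ln (real p)) * exp (- (\<tau> - 1)\<^sup>2 / 2))" using p by (simp add: \<delta>_def)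
  also have "\<dots> = 2 * exp (\<tau> - 1/2)"
    by (simp add: exp_add[symmetric] power2_diff \<tau>2 field_simps)
  also have "\<dots> \<le> 2 * exp \<tau>" by simp
  finally have p\<delta>: "real p * \<delta> \<le> 2 * exp \<tau>" .
  have "\<delta> * \<delta> \<le> \<delta> * (1/2)" using \<delta>' by (intro mult_left_mono) auto
  hence "- (2 * \<delta>) \<le> - \<delta> - 2 * \<delta>\<^sup>2" by (simp add: power2_eq_square)
  also have "\<dots> \<le> ln (1 - \<delta>)" using \<delta>' by (intro ln_one_minus_pos_lower_bound) auto
  finally have "exp (- (2 * \<delta>)) \<le> 1 - \<delta>" using \<delta>' by (simp add: ln_ge_iff)
  hence "exp (- (2 * \<delta>)) ^ p \<le> (1 - \<delta>) ^ p" by (intro power_mono) auto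
  moreover have "exp (- (4 * exp \<tau>)) \<le> exp (- (2 * \<delta>)) ^ p"
    unfolding exp_of_nat_mult[symmetric] using p\<delta> by (simp add: mult.commute)
  ultimately show ?thesis by (simp add: \<delta>_def)
qed

lemma ln_Risk_ge:
  fixes n p k s :: nat and \<alpha> r c :: real and DX :: "rmat measure"
  defines "\<tau> \<equiv> sqrt (2 * ln (real p))" and "A \<equiv> sqrt (2 * r * ln (real p) / real n)"
    and "m \<equiv> max 0 (sqrt r - 1)"
  assumes D: "prob_space DX" "sets DX = sets (mat_space n p)"
    and pd: "AE X in DX. pos_decomposable p (gram n p X)"
    and good: "measure DX {X\<in>space DX. gram_defect n p (block_signal s A) X \<le> real n} \<ge> 1/2"
    and n: "n > 0" and r: "r > 0" and p: "p \<ge> 2" and \<tau>1: "\<tau> \<ge> 1"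
    and \<delta>: "2 * exp (- (\<tau> - 1)\<^sup>2 / 2) \<le> 1/2"
    and ks: "0 < k" "k \<le> s" "s \<le> p" "real s \<le> real p powr (1 - \<alpha>)"
    and X1: "real k * ((1 - \<alpha>) * ln (real p) + \<tau> + (1/2 + ln (sqrt (2 * pi)))) + 4 * exp \<tau> \<le> c * (real s * ln (real p))"
    and X2: "real (s - k) * (m\<^sup>2 * ln (real p) + 2 * m * \<tau> + (2 + ln (sqrt (2 * pi)))) + ln 2 + 4 * exp \<tau> \<le> c * (real s * ln (real p))"
  shows "- c \<le> ln (INF t::real. Risk n p DX (xi_test n p t \<tau>) s A) / (real s * ln (real p))"
proof -
  define B where "B = exp (- (c * (real s * ln (real p))))"
  have L: "ln (real p) > 0" using p by simp
  have A: "A > 0" using r L n by (simp add: A_def)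
  have nA: "sqrt (real n) * A = sqrt r * \<tau>"
  proof -
    have "real n * (2 * r * ln (real p) / real n) = r * (2 * ln (real p))" using n by simp
    thus ?thesis unfolding A_def \<tau>_def real_sqrt_mult[symmetric] by simp
  qed
  \<comment> \<open>The signal mean sqrt r \<tau> exceeds the threshold by at most m \<tau>; the
    further 1 allows for the deviation of \<mu>.\<close>
  have "sqrt r * \<tau> + 1 \<le> \<tau> + (m * \<tau> + 1)"
  proof -
    have "(sqrt r - 1) * \<tau> \<le> m * \<tau>" using \<tau>1 by (intro mult_right_mono) (auto simp: m_def)
    thus ?thesis by (simp add: algebra_simps)
  qed
  moreover have "0 \<le> m * \<tau> + 1" using \<tau>1 by (simp add: m_def)
  ultimately have R: "min ((real p * std_normal_density (\<tau> + 1) / real k) ^ k)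
         (std_normal_density (m * \<tau> + 1 + 1) ^ (s - k) / 2) * (1 - 2 * exp (- (\<tau> - 1)\<^sup>2 / 2)) ^ p
     \<le> Risk n p DX (xi_test n p t \<tau>) s A" for t
    using Risk_ge[OF D n pd good ks(2,3) A \<tau>1, of "m * \<tau> + 1" t] \<delta> nA by simp
  have v: "exp (- (4 * exp \<tau>)) \<le> (1 - 2 * exp (- (\<tau> - 1)\<^sup>2 / 2)) ^ p"
    unfolding \<tau>_def by (rule bulk_factor_ge[OF p]) (use \<delta> in \<open>simp add: \<tau>_def\<close>)
  have C: "exp (- (real k * ((1 - \<alpha>) * ln (real p) + \<tau> + (1/2 + ln (sqrt (2 * pi)))))) \<le>
    (real p * std_normal_density (\<tau> + 1) / real k) ^ k"
    unfolding \<tau>_def by (rule null_factor_ge[OF p]) (use ks in auto)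
  have w: "exp (- (real (s - k) * (m\<^sup>2 * ln (real p) + 2 * m * \<tau> + (2 + ln (sqrt (2 * pi)))) + ln 2)) =
    std_normal_density (m * \<tau> + 1 + 1) ^ (s - k) / 2"
    unfolding \<tau>_def by (rule alternative_factor_eq[OF p])
  have B1: "B \<le> (real p * std_normal_density (\<tau> + 1) / real k) ^ k * (1 - 2 * exp (- (\<tau> - 1)\<^sup>2 / 2)) ^ p"
  proof -
    have "B \<le> exp (- (real k * ((1 - \<alpha>) * ln (real p) + \<tau> + (1/2 + ln (sqrt (2 * pi)))))) * exp (- (4 * exp \<tau>))"
      unfolding B_def exp_add[symmetric] exp_le_cancel_iff using X1 by linarith
    also have "\<dots> \<le> (real p * std_normal_density (\<tau> + 1) / real k) ^ k * (1 - 2 * exp (- (\<tau> - 1)\<^sup>2 / 2)) ^ p"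
      by (intro mult_mono C v) auto
    finally show ?thesis .
  qed
  have B2: "B \<le> std_normal_density (m * \<tau> + 1 + 1) ^ (s - k) / 2 * (1 - 2 * exp (- (\<tau> - 1)\<^sup>2 / 2)) ^ p"
  proof -
    have "B \<le> exp (- (real (s - k) * (m\<^sup>2 * ln (real p) + 2 * m * \<tau> + (2 + ln (sqrt (2 * pi)))) + ln 2)) * exp (- (4 * exp \<tau>))"
      unfolding B_def exp_add[symmetric] exp_le_cancel_iff using X2 by linarith
    also have "\<dots> \<le> std_normal_density (m * \<tau> + 1 + 1) ^ (s - k) / 2 * (1 - 2 * exp (- (\<tau> - 1)\<^sup>2 / 2)) ^ p"
      unfolding w by (intro mult_left_mono v) auto
    finally show ?thesis .
  qed
  \<comment> \<open>A bound uniform in t; being positive, it also makes the infimum positive so that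
    logarithms can be compared.\<close>
  have "B \<le> (INF t::real. Risk n p DX (xi_test n p t \<tau>) s A)"
  proof (rule cINF_greatest)
    fix t
    show "B \<le> Risk n p DX (xi_test n p t \<tau>) s A"
      using B1 B2 R[of t] by (simp add: min_def split: if_splits)
  qed simp
  hence "ln B \<le> ln (INF t::real. Risk n p DX (xi_test n p t \<tau>) s A)"
    by (subst ln_le_cancel_iff) (auto simp: B_def intro: less_le_trans[OF exp_gt_zero])
  hence "- c * (real s * ln (real p)) \<le> ln (INF t::real. Risk n p DX (xi_test n p t \<tau>) s A)"
    by (simp add: B_def)
  moreover have "real s * ln (real p) > 0" using ks L by simp
  ultimately show ?thesis by (simp add: pos_le_divide_eq)
qed

theorem mainTheorem10:
  fixes \<alpha> r \<sigma>2 :: real and n :: "nat \<Rightarrow> nat" and DX :: "nat \<Rightarrow> rmat measure"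
  assumes "1/2 < \<alpha>" and "\<alpha> < 1" and "r > \<alpha>"
    and "filterlim n at_top sequentially"
    and "((\<forall>p. SubG_design (n p) p \<sigma>2 (DX p)) \<and>
            filterlim (\<lambda>p. real (n p) / real p powr (3/2)) at_top sequentially)
         \<or> (\<forall>p. Orth_design (n p) p (DX p) \<and> n p \<ge> p)"
  shows "liminf (\<lambda>p. ereal (
            ln (INF t::real. Risk (n p) p (DX p) (xi_test (n p) p t (sqrt (2 * ln (real p))))
                   (nat \<lfloor>real p powr (1 - \<alpha>)\<rfloor>) (sqrt (2 * r * ln (real p) / real (n p))))
            / (real (nat \<lfloor>real p powr (1 - \<alpha>)\<rfloor>) * ln (real p))))
         > ereal (- (r - \<alpha>)\<^sup>2 / (4 * r))"
proof -
  let ?L = "\<lambda>p::nat. ln (real p)"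
  let ?T = "\<lambda>p::nat. sqrt (2 * ln (real p))"
  define m where "m = max 0 (sqrt r - 1)"
  define S where "S p = nat \<lfloor>real p powr (1 - \<alpha>)\<rfloor>" for p :: nat
  have r0: "r > 0" using assms by simp
  obtain \<kappa> where \<kappa>: "0 < \<kappa>" "\<kappa> < 1" "\<kappa> * (1 - \<alpha>) < (r - \<alpha>)\<^sup>2 / (4 * r)"
    "(1 - \<kappa>) * m\<^sup>2 < (r - \<alpha>)\<^sup>2 / (4 * r)"
    using exists_exceedance_fraction[OF assms(1-3)] unfolding m_def by blast
  \<comment> \<open>A number strictly between both exponents and the target makes the limit inferior
    strictly larger than the target.\<close>
  obtain c where c: "max (\<kappa> * (1 - \<alpha>)) ((1 - \<kappa>) * m\<^sup>2) < c" "c < (r - \<alpha>)\<^sup>2 / (4 * r)"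
    using dense[of "max (\<kappa> * (1 - \<alpha>)) ((1 - \<kappa>) * m\<^sup>2)" "(r - \<alpha>)\<^sup>2 / (4 * r)"] \<kappa> by auto
  \<comment> \<open>Half of this slack absorbs the terms of order s \<tau>, the other half the terms
    that carry no factor s.\<close>
  define \<epsilon> where "\<epsilon> = c - max (\<kappa> * (1 - \<alpha>)) ((1 - \<kappa>) * m\<^sup>2)"
  have \<epsilon>: "\<epsilon> > 0" "\<kappa> * (1 - \<alpha>) + \<epsilon> \<le> c" "(1 - \<kappa>) * m\<^sup>2 + \<epsilon> \<le> c" using c by (auto simp: \<epsilon>_def)
  define c0 where "c0 = 1/2 + ln (sqrt (2 * pi))"
  define c2 where "c2 = 2 + ln (sqrt (2 * pi))"
  define K where "K = 512 * exp (\<sigma>2 / 2)"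
  have a: "1 - \<alpha> > 0" "1/2 - \<alpha> < 0" using assms by auto
  have "eventually (\<lambda>p::nat. ?T p \<ge> 1) sequentially" by real_asymp
  moreover have "eventually (\<lambda>p::nat. 2 * exp (- (?T p - 1)\<^sup>2 / 2) \<le> 1/2) sequentially" by real_asymp
  moreover have "eventually (\<lambda>p::nat. real p powr (1 - \<alpha>) \<ge> 2) sequentially" using a by real_asymp
  moreover have "eventually (\<lambda>p::nat. \<kappa> * (?T p + c0) \<le> \<epsilon> / 2 * ?L p) sequentially" using \<epsilon>(1) \<kappa>(1) by real_asymp
  \<comment> \<open>The halved power stands for s: once p^(1 - \<alpha>) \<ge> 2, its floor is at
    least half of it. The left side is the cost of rounding k up plus that of the bulk
    factor.\<close>
  moreover have "eventually (\<lambda>p::nat. (1 - \<alpha>) * ?L p + ?T p + c0 + 4 * exp (?T p) \<le> \<epsilon> / 2 * (real p powr (1 - \<alpha>) / 2 * ?L p)) sequentially"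
    using \<epsilon>(1) a by real_asymp
  moreover have "eventually (\<lambda>p::nat. (1 - \<kappa>) * (2 * m * ?T p + c2) \<le> \<epsilon> / 2 * ?L p) sequentially"
  proof -
    have *: "eventually (\<lambda>p::nat. M * (?T p + 1) \<le> \<epsilon> / 2 * ?L p) sequentially" if "M > 0" for M
      using \<epsilon>(1) that by real_asymp
    \<comment> \<open>\<open>m\<close> vanishes for r \<le> 1, so the growth of the left side
      depends on r; one strictly positive constant dominates all cases.\<close>
    define M where "M = max 1 ((1 - \<kappa>) * (2 * m + \<bar>c2\<bar>))"
    have "eventually (\<lambda>p::nat. M * (?T p + 1) \<le> \<epsilon> / 2 * ?L p) sequentially"
      using \<epsilon>(1) by (intro *) (simp add: M_def)
    thus ?thesis using eventually_ge_at_top[of 1]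
    proof eventually_elim
      case (elim p)
      have T: "?T p \<ge> 0" using elim by simp
      have m0: "m \<ge> 0" by (simp add: m_def)
      have "2 * m * ?T p + c2 \<le> (2 * m + \<bar>c2\<bar>) * (?T p + 1)"
      proof -
        have "(2 * m + \<bar>c2\<bar>) * (?T p + 1) = 2 * m * ?T p + 2 * m + \<bar>c2\<bar> * ?T p + \<bar>c2\<bar>"
          by (simp add: algebra_simps)
        moreover have "0 \<le> \<bar>c2\<bar> * ?T p" using T by (intro mult_nonneg_nonneg) auto
        ultimately show ?thesis using m0 abs_ge_self[of c2] by linarith
      qed
      hence "(1 - \<kappa>) * (2 * m * ?T p + c2) \<le> (1 - \<kappa>) * ((2 * m + \<bar>c2\<bar>) * (?T p + 1))"
        using \<kappa> by (intro mult_left_mono) auto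
      also have "\<dots> = ((1 - \<kappa>) * (2 * m + \<bar>c2\<bar>)) * (?T p + 1)" by simp
      also have "\<dots> \<le> M * (?T p + 1)" using T by (intro mult_right_mono) (auto simp: M_def)
      finally show ?case using elim by linarith
    qed
  qed
  moreover have "eventually (\<lambda>p::nat. ln 2 + 4 * exp (?T p) \<le> \<epsilon> / 2 * (real p powr (1 - \<alpha>) / 2 * ?L p)) sequentially"
    using \<epsilon>(1) a by real_asymp
  moreover have "eventually (\<lambda>p::nat. 2 * r * ?L p * real p powr (1 - \<alpha>) * real p * K \<le> 1/2 * real p powr (3/2)) sequentially"
  proof -
    have "K > 0" by (simp add: K_def)
    \<comment> \<open>Here \<alpha> > 1/2 enters: the gap between the exponents 2 - \<alpha> and 3/2
      absorbs the logarithm.\<close>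
    have "eventually (\<lambda>p::nat. 4 * r * K * ?L p \<le> real p powr (\<alpha> - 1/2)) sequentially"
      using assms(1) \<open>K > 0\<close> r0 by real_asymp
    thus ?thesis using eventually_gt_at_top[of 0]
    proof eventually_elim
      case (elim p)
      have "4 * r * K * ?L p * (real p powr (1 - \<alpha>) * real p powr 1) \<le>
          real p powr (\<alpha> - 1/2) * (real p powr (1 - \<alpha>) * real p powr 1)"
        by (intro mult_right_mono elim) auto
      also have "\<dots> = real p powr (3/2)" by (simp only: powr_add[symmetric]) simp
      finally show ?case using elim by (simp add: mult_ac)
    qed
  qed
  moreover have "eventually (\<lambda>p. n p > 0) sequentially"
    using eventually_compose_filterlim[OF eventually_gt_at_top[of 0] assms(4)] .
  moreover have "eventually (\<lambda>p::nat. p \<ge> 2) sequentially" by (rule eventually_ge_at_top)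
  moreover have "eventually (\<lambda>p. Orth_design (n p) p (DX p) \<or> (SubG_design (n p) p \<sigma>2 (DX p) \<and> real (n p) \<ge> real p powr (3/2))) sequentially"
    using assms(5)
  proof
    assume H: "(\<forall>p. SubG_design (n p) p \<sigma>2 (DX p)) \<and> filterlim (\<lambda>p. real (n p) / real p powr (3/2)) at_top sequentially"
    hence "eventually (\<lambda>p. real (n p) / real p powr (3/2) \<ge> 1) sequentially"
      by (auto simp: filterlim_at_top)
    thus ?thesis using eventually_gt_at_top[of 0]
      by eventually_elim (use H in \<open>auto simp: field_simps\<close>)
  qed auto
  ultimately have "eventually (\<lambda>p. ereal (- c) \<le> ereal (
            ln (INF t::real. Risk (n p) p (DX p) (xi_test (n p) p t (?T p)) (S p) (sqrt (2 * r * ?L p / real (n p))))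
            / (real (S p) * ?L p))) sequentially"
  proof eventually_elim
    case (elim p)
    \<comment> \<open>Rounding up ensures k \<ge> 1 and s - k \<le> (1 - \<kappa>) s; the excess
      over \<kappa> s is at most 1 and costs only one additional term of order log p.\<close>
    define k where "k = nat \<lceil>\<kappa> * real (S p)\<rceil>"
    have L: "?L p > 0" using elim(10) by simp
    have T0: "?T p \<ge> 1" by (rule elim(1))
    have m0: "m \<ge> 0" by (simp add: m_def)
    have S1: "real (S p) \<le> real p powr (1 - \<alpha>)" "real (S p) \<ge> real p powr (1 - \<alpha>) - 1"
      using elim(3) unfolding S_def by linarith+
    have S2: "real p powr (1 - \<alpha>) / 2 \<le> real (S p)" using S1(2) elim(3) by linarith
    have S0: "S p > 0" using S2 elim(3) by linarith
    have "real p powr (1 - \<alpha>) \<le> real p powr 1" using a assms(1) elim(10) by (intro powr_mono) auto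
    hence Sp: "S p \<le> p" using S1(1) by simp
    have k1: "0 < k" using \<kappa>(1) S0 by (simp add: k_def)
    have "\<kappa> * real (S p) \<le> real (S p)" using \<kappa> by (simp add: mult_left_le_one_le)
    hence kS: "k \<le> S p" by (simp add: k_def nat_le_iff ceiling_le_iff)
    have k2: "real k \<le> \<kappa> * real (S p) + 1" "\<kappa> * real (S p) \<le> real k"
    proof -
      have "real k = of_int \<lceil>\<kappa> * real (S p)\<rceil>" using \<kappa>(1) by (simp add: k_def)
      thus "real k \<le> \<kappa> * real (S p) + 1" "\<kappa> * real (S p) \<le> real k"
        using of_int_ceiling_le_add_one[of "\<kappa> * real (S p)"] le_of_int_ceiling[of "\<kappa> * real (S p)"] by simp_all
    qed
    have c00: "c0 \<ge> 0" "c2 \<ge> 0"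
    proof -
      have "sqrt (2 * pi) \<ge> sqrt 1" using pi_gt3 by (intro real_sqrt_le_mono) simp
      hence "ln (sqrt (2 * pi)) \<ge> 0" by simp
      thus "c0 \<ge> 0" "c2 \<ge> 0" by (simp_all add: c0_def c2_def)
    qed
    have half: "\<epsilon> / 2 * (real p powr (1 - \<alpha>) / 2 * ?L p) \<le> \<epsilon> / 2 * (real (S p) * ?L p)"
      using S2 L \<epsilon>(1) by (intro mult_left_mono mult_right_mono) auto
    have X1: "real k * ((1 - \<alpha>) * ?L p + ?T p + (1/2 + ln (sqrt (2 * pi)))) + 4 * exp (?T p) \<le> c * (real (S p) * ?L p)"
    proof -
      have "real k * ((1 - \<alpha>) * ?L p + ?T p + c0) \<le> (\<kappa> * real (S p) + 1) * ((1 - \<alpha>) * ?L p + ?T p + c0)"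
        using k2 a L T0 c00 by (intro mult_right_mono) auto
      also have "\<dots> = real (S p) * (\<kappa> * (1 - \<alpha>) * ?L p) + real (S p) * (\<kappa> * (?T p + c0)) + ((1 - \<alpha>) * ?L p + ?T p + c0)"
        by (simp add: algebra_simps)
      also have "\<dots> \<le> real (S p) * (\<kappa> * (1 - \<alpha>) * ?L p) + real (S p) * (\<epsilon> / 2 * ?L p) + ((1 - \<alpha>) * ?L p + ?T p + c0)"
        by (intro add_left_mono add_right_mono mult_left_mono elim(4)) auto
      also have "\<dots> + 4 * exp (?T p) \<le> real (S p) * (\<kappa> * (1 - \<alpha>) * ?L p) + real (S p) * (\<epsilon> / 2 * ?L p) + \<epsilon> / 2 * (real (S p) * ?L p)"
        using elim(5) half by linarith
      also have "\<dots> = (\<kappa> * (1 - \<alpha>) + \<epsilon>) * (real (S p) * ?L p)" by (simp add: algebra_simps)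
      also have "\<dots> \<le> c * (real (S p) * ?L p)" using \<epsilon>(2) L by (intro mult_right_mono) auto
      finally show ?thesis by (simp add: c0_def)
    qed
    have X2: "real (S p - k) * (m\<^sup>2 * ?L p + 2 * m * ?T p + (2 + ln (sqrt (2 * pi)))) + ln 2 + 4 * exp (?T p) \<le> c * (real (S p) * ?L p)"
    proof -
      have "real (S p - k) \<le> (1 - \<kappa>) * real (S p)" using k2(2) kS by (simp add: of_nat_diff algebra_simps)
      hence "real (S p - k) * (m\<^sup>2 * ?L p + 2 * m * ?T p + c2) \<le> ((1 - \<kappa>) * real (S p)) * (m\<^sup>2 * ?L p + 2 * m * ?T p + c2)"
        using m0 L T0 c00 by (intro mult_right_mono add_nonneg_nonneg mult_nonneg_nonneg) auto
      also have "\<dots> = real (S p) * ((1 - \<kappa>) * m\<^sup>2 * ?L p) + real (S p) * ((1 - \<kappa>) * (2 * m * ?T p + c2))"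
        by (simp add: algebra_simps)
      also have "\<dots> \<le> real (S p) * ((1 - \<kappa>) * m\<^sup>2 * ?L p) + real (S p) * (\<epsilon> / 2 * ?L p)"
        by (intro add_left_mono mult_left_mono elim(6)) auto
      also have "\<dots> + (ln 2 + 4 * exp (?T p)) \<le> real (S p) * ((1 - \<kappa>) * m\<^sup>2 * ?L p) + real (S p) * (\<epsilon> / 2 * ?L p) + \<epsilon> / 2 * (real (S p) * ?L p)"
        using elim(7) half by linarith
      also have "\<dots> = ((1 - \<kappa>) * m\<^sup>2 + \<epsilon>) * (real (S p) * ?L p)" by (simp add: algebra_simps)
      also have "\<dots> \<le> c * (real (S p) * ?L p)" using \<epsilon>(3) L by (intro mult_right_mono) auto
      finally show ?thesis by (simp add: c2_def)
    qed
    have good: "prob_space (DX p)" "sets (DX p) = sets (mat_space (n p) p)"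
      "AE X in DX p. pos_decomposable p (gram (n p) p X)"
      "measure (DX p) {X\<in>space (DX p). gram_defect (n p) p (block_signal (S p) (sqrt (2 * r * ?L p / real (n p)))) X \<le> real (n p)} \<ge> 1/2"
    proof -
      let ?A = "sqrt (2 * r * ?L p / real (n p))"
      have small: "?A\<^sup>2 * real (S p) * real p * (512 * exp (\<sigma>2 / 2)) \<le> 1/2" if np: "real (n p) \<ge> real p powr (3/2)"
      proof -
        have "?A\<^sup>2 * real (S p) * real p * K = (2 * r * ?L p * real (S p) * real p * K) / real (n p)"
          using r0 L by simp
        also have "\<dots> \<le> (2 * r * ?L p * real p powr (1 - \<alpha>) * real p * K) / real (n p)"
          using S1(1) r0 L by (intro divide_right_mono mult_right_mono mult_left_mono) (auto simp: K_def)
        also have "\<dots> \<le> (1/2 * real p powr (3/2)) / real (n p)"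
          by (intro divide_right_mono elim(8)) auto
        also have "\<dots> \<le> 1/2" using np elim(9) by (simp add: field_simps)
        finally show ?thesis by (simp add: K_def)
      qed
      show "prob_space (DX p)" "sets (DX p) = sets (mat_space (n p) p)"
        "AE X in DX p. pos_decomposable p (gram (n p) p X)"
        "measure (DX p) {X\<in>space (DX p). gram_defect (n p) p (block_signal (S p) ?A) X \<le> real (n p)} \<ge> 1/2"
        using elim(11) Orth_design_good[of "n p" p "DX p", OF _ elim(9)]
          SubG_design_good[of "n p" p \<sigma>2 "DX p" "S p" ?A, OF _ elim(9) S0 Sp] small by blast+
    qed
    show ?case
      using ln_Risk_ge[OF good elim(9) r0 elim(10) T0 elim(2) k1 kS Sp S1(1) X1 X2[unfolded m_def]] by simp
  qed
  hence "ereal (- c) \<le> liminf (\<lambda>p. ereal (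
            ln (INF t::real. Risk (n p) p (DX p) (xi_test (n p) p t (?T p)) (S p) (sqrt (2 * r * ?L p / real (n p))))
            / (real (S p) * ?L p)))"
    by (rule Liminf_bounded)
  moreover have "ereal (- (r - \<alpha>)\<^sup>2 / (4 * r)) < ereal (- c)" using c(2) by simp
  ultimately show ?thesis unfolding S_def by (rule less_le_trans[rotated])
qed

end
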